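(* Let $\Bbbk$ be a commutative ring, $\mathcal{K}$ a $\Bbbk$-linear abelian category, $(\mathbb{X},\Gamma/{\sim})$ a triple whose set $\mathscr{P}$ of screens is nonempty, $C$ its path category, $\mathcal{C}$ its $\Bbbk$-linear path category, $\mathcal{I}$ a path based ideal of $\mathcal{C}$, and $\mathcal{A}=\mathcal{C}/\mathcal{I}$. Let $\mathbf{S}$ be the set of nonempty subsets $\mathscr{L}\subseteq\mathscr{P}$ such that for any finite collection $\{\mathfrak{P}_i\}_{i=1}^n\subset\mathscr{L}$ there is $\mathfrak{P}\in\mathscr{L}$ that refines each $\mathfrak{P}_i$. For each $\mathscr{L}\in\mathbf{S}$, the categories $\mathrm{Rep}^{\mathscr{L}}_{\mathcal{K}}(C)$, $\mathrm{rep}^{\mathscr{L}}_{\mathcal{K}}(C)$, $\mathrm{Rep}^{\mathscr{L}}_{\mathcal{K}}(\mathcal{A})$ and $\mathrm{rep}^{\mathscr{L}}_{\mathcal{K}}(\mathcal{A})$ are abelian, and their embeddings into $\mathrm{Rep}_{\mathcal{K}}(C)$, $\mathrm{rep}^{\mathrm{pwf}}_{\mathcal{K}}(C)$, $\mathrm{Rep}_{\mathcal{K}}(\mathcal{A})$ and $\mathrm{rep}^{\mathrm{pwf}}_{\mathcal{K}}(\mathcal{A})$, respectively, are exact.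
   Context: TRIPLES. A path in a nonempty set $\mathbb{X}$ is any function $\gamma:[0,1]\to\mathbb{X}$; $\mathrm{im}(\gamma)$ is its image. If $\gamma(1)=\gamma'(0)$, then $\gamma\cdot\gamma'$ is the path equal to $\gamma(2t)$ for $0\le t\le\frac12$ and to $\gamma'(2t-1)$ for $\frac12\le t\le1$. A triple $(\mathbb{X},\Gamma/{\sim})$ consists of a nonempty set $\mathbb{X}$, a set $\Gamma$ of paths in $\mathbb{X}$, and an equivalence relation $\sim$ on $\Gamma$ (equivalent paths have the same endpoints) such that: (a) $\gamma,\gamma'\in\Gamma$ with $\gamma(1)=\gamma'(0)$ implies $\gamma\cdot\gamma'\in\Gamma$; (b) if $\gamma\in\Gamma$ and $\phi:[0,1]\to[0,1]$ is weakly order preserving and sends intervals to intervals, then $\gamma\circ\phi\in\Gamma$; (c) all constant paths are in $\Gamma$; (d) a path equivalent to a constant path is constant; (e) if in (b) also $\phi(0)=0$, $\phi(1)=1$, then $\gamma\sim\gamma\circ\phi$; (f) if $\gamma,\gamma',\rho,\rho'\in\Gamma$ and $\rho\cdot\gamma\cdot\rho'$, $\rho\cdot\gamma'\cdot\rho'$ are defined and in $\Gamma$, then $\gamma\sim\gamma'$ if and only if $\rho\cdot\gamma\cdot\rho'\sim\rho\cdot\gamma'\cdot\rho'$. The class of $\gamma$ is $[\gamma]$. SCREENS. A screen of $(\mathbb{X},\Gamma/{\sim})$ is a partition $\mathfrak{P}$ of $\mathbb{X}$, whose elements are called pixels, such that: (S1) if $\gamma,\gamma'\in\Gamma$ have the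 same start and the same end and $\mathrm{im}(\gamma)\subset\mathsf{X}\in\mathfrak{P}$, then $\gamma\sim\gamma'$ if and only if $\mathrm{im}(\gamma')\subset\mathsf{X}$; (S2) any two points $x,y$ of a pixel $\mathsf{X}$ are joined by a finite walk $\gamma_0\cdot\gamma_1^{-1}\cdot\gamma_2\cdots\gamma_{2n-1}^{-1}\cdot\gamma_{2n}$ from $x$ to $y$ (where $\gamma^{-1}$ is $\gamma$ run backwards) with all $\gamma_i\in\Gamma$ and $\mathrm{im}(\gamma_i)\subset\mathsf{X}$; (S3) if $\rho,\gamma\in\Gamma$, $\rho(0)=\gamma(0)$ and $\mathrm{im}(\rho)$ lies in a pixel, then there are $\rho',\gamma'\in\Gamma$ with $\mathrm{im}(\rho')$ in a pixel and $\gamma\cdot\rho'\sim\rho\cdot\gamma'$; dually, if $\rho',\gamma'\in\Gamma$, $\rho'(1)=\gamma'(1)$ and $\mathrm{im}(\rho')$ lies in a pixel, then there are $\rho,\gamma\in\Gamma$ with $\mathrm{im}(\rho)$ in a pixel and $\gamma\cdot\rho'\sim\rho\cdot\gamma'$; (S4) for every $\gamma\in\Gamma$ there are a finite partition $\{I_i\}_{i=1}^n$ of $[0,1]$ into subintervals (listed in increasing order) and pixels $(\mathsf{X}_1,\dots,\mathsf{X}_n)$ with $\gamma(I_i)\subset\mathsf{X}_i$, where for $i\ne j$ the equality $\mathsf{X}_i=\mathsf{X}_j$ is allowed only if $|i-j|>1$; (S5) if $\gamma,\gamma'\in\Gamma$ have the same start and the same end and admit the same partition $\{I_i\}$ and the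 same list of pixels as in (S4), then $\gamma\sim\gamma'$. PATH CATEGORIES. $C$ has objects the points of $\mathbb{X}$, $\mathrm{Hom}_C(x,y)=\{[\gamma]\mid\gamma\in\Gamma,\gamma(0)=x,\gamma(1)=y\}$, composition $[\gamma']\circ[\gamma]=[\gamma\cdot\gamma']$. $\mathcal{C}$ has objects $\mathbb{X}\sqcup\{0\}$ with $0$ a zero object, $\mathrm{Hom}_{\mathcal{C}}(x,y)$ the free $\Bbbk$-module on $\mathrm{Hom}_C(x,y)$ for $x,y\in\mathbb{X}$, and bilinear composition. An ideal of $\mathcal{C}$ is path based if it is generated by finite sums $\sum_i\lambda_i[\gamma_i]$ with $\gamma_i\in\Gamma$, each $\lambda_i\in\Bbbk$ not a zero divisor (the zero ideal is allowed). THE CLASSES $\Sigma_{\mathfrak{P}}$. In $C$, $\Sigma_{\mathfrak{P}}$ is the class of $[\rho]$ with $\mathrm{im}(\rho)$ in a pixel. For the linear case: paths $\gamma,\gamma'\in\Gamma$ are $\mathfrak{P}$-equivalent if there are $\rho_1,\dots,\rho_4\in\Gamma$ with $\mathrm{im}(\rho_1)\cup\mathrm{im}(\rho_2)$ in one pixel, $\mathrm{im}(\rho_3)\cup\mathrm{im}(\rho_4)$ in one pixel, and $\rho_1\cdot\gamma\cdot\rho_3\sim\rho_2\cdot\gamma'\cdot\rho_4$; morphisms $\sum_{i=1}^m\lambda_i[\gamma_i]$, $\sum_{i=1}^m\lambda'_i[\gamma'_i]$ are $\mathfrak{P}$-equivalent if, up to permutation, $\lambda_i=\lambda'_i$ and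 $\gamma_i,\gamma'_i$ are $\mathfrak{P}$-equivalent for all $i$; $\overline{\mathcal{I}}^{\mathfrak{P}}$ is the ideal generated by all $f$ that are $\mathfrak{P}$-equivalent to some $g\in\mathcal{I}$; $\overline{\mathcal{A}}^{\mathfrak{P}}=\mathcal{C}/\overline{\mathcal{I}}^{\mathfrak{P}}$. A pixel is pre-dead if it contains $\mathrm{im}(\rho)$ for some $\rho\in\Gamma$ with $[\rho]=0$ in $\mathcal{A}$. In $\overline{\mathcal{A}}^{\mathfrak{P}}$, $\Sigma_{\mathfrak{P}}$ consists of the $[\rho]\ne0$ with $\mathrm{im}(\rho)$ in a pixel and of the zero morphisms $x\to y$ with $x,y$ in a common pre-dead pixel. REPRESENTATIONS. For $\mathcal{D}=C$ or $\mathcal{A}$, $\mathrm{Rep}_{\mathcal{K}}(\mathcal{D})$ is the category of functors $\mathcal{D}\to\mathcal{K}$ ($\Bbbk$-linear and additive if $\mathcal{D}=\mathcal{A}$), and $\mathrm{rep}^{\mathrm{pwf}}_{\mathcal{K}}(\mathcal{D})$ is the full subcategory of those taking values in finite-length objects. $\mathfrak{P}$ pixelates $M$ if $M(\sigma)$ is an isomorphism for all $\sigma\in\Sigma_{\mathfrak{P}}$; explicitly for $\mathcal{D}=\mathcal{A}$: $M([\rho])$ is an isomorphism whenever $\mathrm{im}(\rho)$ lies in a pixel and $[\rho]\ne0$ in $\overline{\mathcal{A}}^{\mathfrak{P}}$, and $M(0:x\to y)$ is an isomorphism for $x,y$ in a common pre-dead pixel. $\mathrm{Rep}^{\mathscr{L}}_{\mathcal{K}}(\mathcal{D})$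 and $\mathrm{rep}^{\mathscr{L}}_{\mathcal{K}}(\mathcal{D})$ are the full subcategories of $\mathrm{Rep}_{\mathcal{K}}(\mathcal{D})$ and $\mathrm{rep}^{\mathrm{pwf}}_{\mathcal{K}}(\mathcal{D})$, respectively, of those $M$ pixelated by some screen in $\mathscr{L}$. *)

theory Defs
  imports "HOL-Analysis.Analysis" "HOL-Library.Disjoint_Sets" "HOL-Library.FuncSet"
    "HOL-Library.Poly_Mapping"
begin

section \<open>Categories, linear categories, abelian categories\<close>

text \<open>
  A category has a set of objects and, for each pair of objects, a set of morphisms.  Hom-sets of
  different pairs need not be disjoint, so all operations on morphisms carry the relevant objects:
  \<open>Cmp C x y z g f\<close> is the composite of \<open>f \<in> Hom C x y\<close> followed by \<open>g \<in> Hom C y z\<close>.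
  Values at arguments outside \<open>Obj C\<close> carry no meaning.
\<close>

record ('o, 'm) cat =
  Obj :: "'o set"
  Hom :: "'o \<Rightarrow> 'o \<Rightarrow> 'm set"
  Idn :: "'o \<Rightarrow> 'm"
  Cmp :: "'o \<Rightarrow> 'o \<Rightarrow> 'o \<Rightarrow> 'm \<Rightarrow> 'm \<Rightarrow> 'm"

record ('o, 'm, 'k) lcat = "('o, 'm) cat" +
  Zer :: "'o \<Rightarrow> 'o \<Rightarrow> 'm"
  Add :: "'o \<Rightarrow> 'o \<Rightarrow> 'm \<Rightarrow> 'm \<Rightarrow> 'm"
  Scl :: "'o \<Rightarrow> 'o \<Rightarrow> 'k \<Rightarrow> 'm \<Rightarrow> 'm"

locale category =
  fixes C :: "('o, 'm, 'z) cat_scheme"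
  assumes Idn_in_Hom: "x \<in> Obj C \<Longrightarrow> Idn C x \<in> Hom C x x"
    and Cmp_in_Hom: "\<lbrakk>x \<in> Obj C; y \<in> Obj C; z \<in> Obj C; f \<in> Hom C x y; g \<in> Hom C y z\<rbrakk>
      \<Longrightarrow> Cmp C x y z g f \<in> Hom C x z"
    and Cmp_Idn_right: "\<lbrakk>x \<in> Obj C; y \<in> Obj C; f \<in> Hom C x y\<rbrakk> \<Longrightarrow> Cmp C x x y f (Idn C x) = f"
    and Cmp_Idn_left: "\<lbrakk>x \<in> Obj C; y \<in> Obj C; f \<in> Hom C x y\<rbrakk> \<Longrightarrow> Cmp C x y y (Idn C y) f = f"
    and Cmp_assoc: "\<lbrakk>w \<in> Obj C; x \<in> Obj C; y \<in> Obj C; z \<in> Obj C;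
        f \<in> Hom C w x; g \<in> Hom C x y; h \<in> Hom C y z\<rbrakk>
      \<Longrightarrow> Cmp C w x z (Cmp C x y z h g) f = Cmp C w y z h (Cmp C w x y g f)"

locale preadditive_category = category C for C :: "('o, 'm, 'k, 'z) lcat_scheme" +
  assumes Zer_in_Hom: "\<lbrakk>x \<in> Obj C; y \<in> Obj C\<rbrakk> \<Longrightarrow> Zer C x y \<in> Hom C x y"
    and Add_in_Hom: "\<lbrakk>x \<in> Obj C; y \<in> Obj C; f \<in> Hom C x y; g \<in> Hom C x y\<rbrakk>
      \<Longrightarrow> Add C x y f g \<in> Hom C x y"
    and Add_assoc: "\<lbrakk>x \<in> Obj C; y \<in> Obj C; f \<in> Hom C x y; g \<in> Hom C x y; h \<in> Hom C x y\<rbrakk>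
      \<Longrightarrow> Add C x y (Add C x y f g) h = Add C x y f (Add C x y g h)"
    and Add_commute: "\<lbrakk>x \<in> Obj C; y \<in> Obj C; f \<in> Hom C x y; g \<in> Hom C x y\<rbrakk>
      \<Longrightarrow> Add C x y f g = Add C x y g f"
    and Add_Zer: "\<lbrakk>x \<in> Obj C; y \<in> Obj C; f \<in> Hom C x y\<rbrakk> \<Longrightarrow> Add C x y f (Zer C x y) = f"
    and Add_inverse: "\<lbrakk>x \<in> Obj C; y \<in> Obj C; f \<in> Hom C x y\<rbrakk>
      \<Longrightarrow> \<exists>g\<in>Hom C x y. Add C x y f g = Zer C x y"
    and Cmp_Add_left: "\<lbrakk>x \<in> Obj C; y \<in> Obj C; z \<in> Obj C;
        f \<in> Hom C x y; g \<in> Hom C y z; h \<in> Hom C y z\<rbrakk>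
      \<Longrightarrow> Cmp C x y z (Add C y z g h) f = Add C x z (Cmp C x y z g f) (Cmp C x y z h f)"
    and Cmp_Add_right: "\<lbrakk>x \<in> Obj C; y \<in> Obj C; z \<in> Obj C;
        f \<in> Hom C x y; g \<in> Hom C x y; h \<in> Hom C y z\<rbrakk>
      \<Longrightarrow> Cmp C x y z h (Add C x y f g) = Add C x z (Cmp C x y z h f) (Cmp C x y z h g)"

text \<open>
  The sort \<open>{comm_ring, comm_monoid_mult}\<close> is that of commutative rings with unit; unlike
  \<open>comm_ring_1\<close> it does not exclude the zero ring.
\<close>

locale linear_category = preadditive_category C
  for C :: "('o, 'm, 'k :: {comm_ring, comm_monoid_mult}, 'z) lcat_scheme" +
  assumes Scl_in_Hom: "\<lbrakk>x \<in> Obj C; y \<in> Obj C; f \<in> Hom C x y\<rbrakk> \<Longrightarrow> Scl C x y c f \<in> Hom C x y"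
    and Scl_one: "\<lbrakk>x \<in> Obj C; y \<in> Obj C; f \<in> Hom C x y\<rbrakk> \<Longrightarrow> Scl C x y 1 f = f"
    and Scl_mult: "\<lbrakk>x \<in> Obj C; y \<in> Obj C; f \<in> Hom C x y\<rbrakk>
      \<Longrightarrow> Scl C x y (c * d) f = Scl C x y c (Scl C x y d f)"
    and Scl_plus: "\<lbrakk>x \<in> Obj C; y \<in> Obj C; f \<in> Hom C x y\<rbrakk>
      \<Longrightarrow> Scl C x y (c + d) f = Add C x y (Scl C x y c f) (Scl C x y d f)"
    and Scl_Add: "\<lbrakk>x \<in> Obj C; y \<in> Obj C; f \<in> Hom C x y; g \<in> Hom C x y\<rbrakk>
      \<Longrightarrow> Scl C x y c (Add C x y f g) = Add C x y (Scl C x y c f) (Scl C x y c g)"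
    and Cmp_Scl_left: "\<lbrakk>x \<in> Obj C; y \<in> Obj C; z \<in> Obj C; f \<in> Hom C x y; g \<in> Hom C y z\<rbrakk>
      \<Longrightarrow> Cmp C x y z (Scl C y z c g) f = Scl C x z c (Cmp C x y z g f)"
    and Cmp_Scl_right: "\<lbrakk>x \<in> Obj C; y \<in> Obj C; z \<in> Obj C; f \<in> Hom C x y; g \<in> Hom C y z\<rbrakk>
      \<Longrightarrow> Cmp C x y z g (Scl C x y c f) = Scl C x z c (Cmp C x y z g f)"

definition is_iso :: "('o, 'm, 'z) cat_scheme \<Rightarrow> 'o \<Rightarrow> 'o \<Rightarrow> 'm \<Rightarrow> bool" where
  "is_iso C x y f \<longleftrightarrow> f \<in> Hom C x y \<and>
     (\<exists>g\<in>Hom C y x. Cmp C x y x g f = Idn C x \<and> Cmp C y x y f g = Idn C y)"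

definition is_mono :: "('o, 'm, 'z) cat_scheme \<Rightarrow> 'o \<Rightarrow> 'o \<Rightarrow> 'm \<Rightarrow> bool" where
  "is_mono C x y f \<longleftrightarrow> f \<in> Hom C x y \<and>
     (\<forall>w\<in>Obj C. \<forall>g\<in>Hom C w x. \<forall>h\<in>Hom C w x. Cmp C w x y f g = Cmp C w x y f h \<longrightarrow> g = h)"

definition is_epi :: "('o, 'm, 'z) cat_scheme \<Rightarrow> 'o \<Rightarrow> 'o \<Rightarrow> 'm \<Rightarrow> bool" where
  "is_epi C x y f \<longleftrightarrow> f \<in> Hom C x y \<and>
     (\<forall>z\<in>Obj C. \<forall>g\<in>Hom C y z. \<forall>h\<in>Hom C y z. Cmp C x y z g f = Cmp C x y z h f \<longrightarrow> g = h)"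

definition is_zero_object :: "('o, 'm, 'z) cat_scheme \<Rightarrow> 'o \<Rightarrow> bool" where
  "is_zero_object C z \<longleftrightarrow> z \<in> Obj C \<and>
     (\<forall>x\<in>Obj C. (\<exists>!f. f \<in> Hom C z x) \<and> (\<exists>!f. f \<in> Hom C x z))"

definition is_biproduct ::
  "('o, 'm, 'k, 'z) lcat_scheme \<Rightarrow> 'o \<Rightarrow> 'o \<Rightarrow> 'o \<Rightarrow> 'm \<Rightarrow> 'm \<Rightarrow> 'm \<Rightarrow> 'm \<Rightarrow> bool" where
  "is_biproduct C x y s i j p q \<longleftrightarrow> s \<in> Obj C \<and>
     i \<in> Hom C x s \<and> j \<in> Hom C y s \<and> p \<in> Hom C s x \<and> q \<in> Hom C s y \<and>
     Cmp C x s x p i = Idn C x \<and> Cmp C y s y q j = Idn C y \<and>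
     Cmp C x s y q i = Zer C x y \<and> Cmp C y s x p j = Zer C y x \<and>
     Add C s s (Cmp C s x s i p) (Cmp C s y s j q) = Idn C s"

text \<open>
  \<open>is_kernel C x y f k i\<close>: the morphism \<open>i : k \<rightarrow> x\<close> is a kernel of \<open>f : x \<rightarrow> y\<close>;
  \<open>is_cokernel C x y f c p\<close>: the morphism \<open>p : y \<rightarrow> c\<close> is a cokernel of \<open>f : x \<rightarrow> y\<close>.
\<close>

definition is_kernel ::
  "('o, 'm, 'k, 'z) lcat_scheme \<Rightarrow> 'o \<Rightarrow> 'o \<Rightarrow> 'm \<Rightarrow> 'o \<Rightarrow> 'm \<Rightarrow> bool" where
  "is_kernel C x y f k i \<longleftrightarrow> k \<in> Obj C \<and> i \<in> Hom C k x \<and> Cmp C k x y f i = Zer C k y \<and>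
     (\<forall>w\<in>Obj C. \<forall>h\<in>Hom C w x. Cmp C w x y f h = Zer C w y \<longrightarrow>
        (\<exists>!u. u \<in> Hom C w k \<and> Cmp C w k x i u = h))"

definition is_cokernel ::
  "('o, 'm, 'k, 'z) lcat_scheme \<Rightarrow> 'o \<Rightarrow> 'o \<Rightarrow> 'm \<Rightarrow> 'o \<Rightarrow> 'm \<Rightarrow> bool" where
  "is_cokernel C x y f c p \<longleftrightarrow> c \<in> Obj C \<and> p \<in> Hom C y c \<and> Cmp C x y c p f = Zer C x c \<and>
     (\<forall>w\<in>Obj C. \<forall>h\<in>Hom C y w. Cmp C x y w h f = Zer C x w \<longrightarrow>
        (\<exists>!u. u \<in> Hom C c w \<and> Cmp C y c w u p = h))"

locale abelian_category = preadditive_category C for C :: "('o, 'm, 'k, 'z) lcat_scheme" +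
  assumes ex_zero_object: "\<exists>z. is_zero_object C z"
    and ex_biproduct: "\<lbrakk>x \<in> Obj C; y \<in> Obj C\<rbrakk> \<Longrightarrow> \<exists>s i j p q. is_biproduct C x y s i j p q"
    and ex_kernel: "\<lbrakk>x \<in> Obj C; y \<in> Obj C; f \<in> Hom C x y\<rbrakk> \<Longrightarrow> \<exists>k i. is_kernel C x y f k i"
    and ex_cokernel: "\<lbrakk>x \<in> Obj C; y \<in> Obj C; f \<in> Hom C x y\<rbrakk> \<Longrightarrow> \<exists>c p. is_cokernel C x y f c p"
    and mono_normal: "\<lbrakk>x \<in> Obj C; y \<in> Obj C; is_mono C x y f\<rbrakk>
      \<Longrightarrow> \<exists>z\<in>Obj C. \<exists>g\<in>Hom C y z. is_kernel C y z g x f"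
    and epi_normal: "\<lbrakk>x \<in> Obj C; y \<in> Obj C; is_epi C x y f\<rbrakk>
      \<Longrightarrow> \<exists>w\<in>Obj C. \<exists>g\<in>Hom C w x. is_cokernel C w x g y f"

text \<open>\<open>short_exact C a b c f g\<close>: the sequence \<open>0 \<rightarrow> a \<rightarrow> b \<rightarrow> c \<rightarrow> 0\<close> with maps \<open>f, g\<close> is exact.\<close>

definition short_exact ::
  "('o, 'm, 'k, 'z) lcat_scheme \<Rightarrow> 'o \<Rightarrow> 'o \<Rightarrow> 'o \<Rightarrow> 'm \<Rightarrow> 'm \<Rightarrow> bool" where
  "short_exact C a b c f g \<longleftrightarrow> is_kernel C b c g a f \<and> is_cokernel C a b f c g"

definition is_simple :: "('o, 'm, 'z) cat_scheme \<Rightarrow> 'o \<Rightarrow> bool" where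
  "is_simple C s \<longleftrightarrow> s \<in> Obj C \<and> \<not> is_zero_object C s \<and>
     (\<forall>y\<in>Obj C. \<forall>f. is_mono C y s f \<longrightarrow> is_zero_object C y \<or> is_iso C y s f)"

text \<open>Objects with a finite composition series, built up from the bottom.\<close>

inductive finite_length :: "('o, 'm, 'k, 'z) lcat_scheme \<Rightarrow> 'o \<Rightarrow> bool"
  for C :: "('o, 'm, 'k, 'z) lcat_scheme" where
  zero: "is_zero_object C z \<Longrightarrow> finite_length C z"
| step: "\<lbrakk>finite_length C x; y \<in> Obj C; is_simple C s; short_exact C x y s i p\<rbrakk>
    \<Longrightarrow> finite_length C y"

definition full_subcategory :: "('o, 'm, 'z) cat_scheme \<Rightarrow> 'o set \<Rightarrow> ('o, 'm, 'z) cat_scheme" where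
  "full_subcategory C S = C\<lparr>Obj := Obj C \<inter> S\<rparr>"


section \<open>Functors and functor categories\<close>

record ('o, 'm, 'p, 'n) ftor =
  FOb :: "'o \<Rightarrow> 'p"
  FMor :: "'o \<Rightarrow> 'o \<Rightarrow> 'm \<Rightarrow> 'n"

text \<open>
  Functors and natural transformations are required to be \<open>undefined\<close> outside their domain, so
  that equality in HOL is equality of functors and of natural transformations.
\<close>

definition is_functor ::
  "('o, 'm, 'z) cat_scheme \<Rightarrow> ('p, 'n, 'y) cat_scheme \<Rightarrow> ('o, 'm, 'p, 'n) ftor \<Rightarrow> bool" where
  "is_functor C D F \<longleftrightarrow>
     FOb F \<in> Obj C \<rightarrow>\<^sub>E Obj D \<and>
     (\<forall>x\<in>Obj C. \<forall>y\<in>Obj C. FMor F x y \<in> Hom C x y \<rightarrow>\<^sub>E Hom D (FOb F x) (FOb F y)) \<and>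
     (\<forall>x y. \<not> (x \<in> Obj C \<and> y \<in> Obj C) \<longrightarrow> FMor F x y = (\<lambda>_. undefined)) \<and>
     (\<forall>x\<in>Obj C. FMor F x x (Idn C x) = Idn D (FOb F x)) \<and>
     (\<forall>x\<in>Obj C. \<forall>y\<in>Obj C. \<forall>z\<in>Obj C. \<forall>f\<in>Hom C x y. \<forall>g\<in>Hom C y z.
        FMor F x z (Cmp C x y z g f)
          = Cmp D (FOb F x) (FOb F y) (FOb F z) (FMor F y z g) (FMor F x y f))"

definition is_additive_functor ::
  "('o, 'm, 'k, 'z) lcat_scheme \<Rightarrow> ('p, 'n, 'l, 'y) lcat_scheme \<Rightarrow> ('o, 'm, 'p, 'n) ftor \<Rightarrow> bool"
where
  "is_additive_functor C D F \<longleftrightarrow> is_functor C D F \<and>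
     (\<forall>x\<in>Obj C. \<forall>y\<in>Obj C. \<forall>f\<in>Hom C x y. \<forall>g\<in>Hom C x y.
        FMor F x y (Add C x y f g)
          = Add D (FOb F x) (FOb F y) (FMor F x y f) (FMor F x y g))"

definition is_linear_functor ::
  "('o, 'm, 'k, 'z) lcat_scheme \<Rightarrow> ('p, 'n, 'k, 'y) lcat_scheme \<Rightarrow> ('o, 'm, 'p, 'n) ftor \<Rightarrow> bool"
where
  "is_linear_functor C D F \<longleftrightarrow> is_additive_functor C D F \<and>
     (\<forall>x\<in>Obj C. \<forall>y\<in>Obj C. \<forall>c. \<forall>f\<in>Hom C x y.
        FMor F x y (Scl C x y c f) = Scl D (FOb F x) (FOb F y) c (FMor F x y f))"

definition exact_functor ::
  "('o, 'm, 'k, 'z) lcat_scheme \<Rightarrow> ('p, 'n, 'l, 'y) lcat_scheme \<Rightarrow> ('o, 'm, 'p, 'n) ftor \<Rightarrow> bool"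
where
  "exact_functor C D F \<longleftrightarrow> is_additive_functor C D F \<and>
     (\<forall>a\<in>Obj C. \<forall>b\<in>Obj C. \<forall>c\<in>Obj C. \<forall>f\<in>Hom C a b. \<forall>g\<in>Hom C b c.
        short_exact C a b c f g \<longrightarrow>
        short_exact D (FOb F a) (FOb F b) (FOb F c) (FMor F a b f) (FMor F b c g))"

definition embedding :: "('o, 'm, 'z) cat_scheme \<Rightarrow> ('o, 'm, 'o, 'm) ftor" where
  "embedding S = \<lparr>FOb = (\<lambda>x\<in>Obj S. x),
     FMor = (\<lambda>x y. if x \<in> Obj S \<and> y \<in> Obj S then (\<lambda>f\<in>Hom S x y. f) else (\<lambda>_. undefined))\<rparr>"

definition nat_transf ::
  "('o, 'm, 'z) cat_scheme \<Rightarrow> ('p, 'n, 'y) cat_scheme \<Rightarrow>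
   ('o, 'm, 'p, 'n) ftor \<Rightarrow> ('o, 'm, 'p, 'n) ftor \<Rightarrow> ('o \<Rightarrow> 'n) set" where
  "nat_transf C D F G = {\<eta> \<in> (\<Pi>\<^sub>E x\<in>Obj C. Hom D (FOb F x) (FOb G x)).
     \<forall>x\<in>Obj C. \<forall>y\<in>Obj C. \<forall>f\<in>Hom C x y.
       Cmp D (FOb F x) (FOb F y) (FOb G y) (\<eta> y) (FMor F x y f)
         = Cmp D (FOb F x) (FOb G x) (FOb G y) (FMor G x y f) (\<eta> x)}"

definition functor_category ::
  "('o, 'm, 'z) cat_scheme \<Rightarrow> ('p, 'n, 'k, 'y) lcat_scheme \<Rightarrow>
   (('o, 'm, 'p, 'n) ftor, 'o \<Rightarrow> 'n, 'k) lcat" where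
  "functor_category C D = \<lparr>
     Obj = {F. is_functor C D F},
     Hom = nat_transf C D,
     Idn = (\<lambda>F. \<lambda>x\<in>Obj C. Idn D (FOb F x)),
     Cmp = (\<lambda>F G H \<theta> \<eta>. \<lambda>x\<in>Obj C. Cmp D (FOb F x) (FOb G x) (FOb H x) (\<theta> x) (\<eta> x)),
     Zer = (\<lambda>F G. \<lambda>x\<in>Obj C. Zer D (FOb F x) (FOb G x)),
     Add = (\<lambda>F G \<theta> \<eta>. \<lambda>x\<in>Obj C. Add D (FOb F x) (FOb G x) (\<theta> x) (\<eta> x)),
     Scl = (\<lambda>F G c \<eta>. \<lambda>x\<in>Obj C. Scl D (FOb F x) (FOb G x) c (\<eta> x))\<rparr>"


section \<open>Ideals and quotients of linear categories\<close>

definition cat_ideal :: "('o, 'm, 'k, 'z) lcat_scheme \<Rightarrow> ('o \<Rightarrow> 'o \<Rightarrow> 'm set) \<Rightarrow> bool" where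
  "cat_ideal C I \<longleftrightarrow>
     (\<forall>x\<in>Obj C. \<forall>y\<in>Obj C. I x y \<subseteq> Hom C x y \<and> Zer C x y \<in> I x y \<and>
        (\<forall>f\<in>I x y. \<forall>g\<in>I x y. Add C x y f g \<in> I x y) \<and>
        (\<forall>c. \<forall>f\<in>I x y. Scl C x y c f \<in> I x y)) \<and>
     (\<forall>x\<in>Obj C. \<forall>y\<in>Obj C. \<forall>z\<in>Obj C.
        (\<forall>f\<in>I x y. \<forall>g\<in>Hom C y z. Cmp C x y z g f \<in> I x z) \<and>
        (\<forall>f\<in>Hom C x y. \<forall>g\<in>I y z. Cmp C x y z g f \<in> I x z))"

definition generated_ideal ::
  "('o, 'm, 'k, 'z) lcat_scheme \<Rightarrow> ('o \<Rightarrow> 'o \<Rightarrow> 'm set) \<Rightarrow> 'o \<Rightarrow> 'o \<Rightarrow> 'm set" where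
  "generated_ideal C G x y =
     \<Inter>{I x y | I. cat_ideal C I \<and> (\<forall>u\<in>Obj C. \<forall>v\<in>Obj C. G u v \<subseteq> I u v)}"

definition coset ::
  "('o, 'm, 'k, 'z) lcat_scheme \<Rightarrow> ('o \<Rightarrow> 'o \<Rightarrow> 'm set) \<Rightarrow> 'o \<Rightarrow> 'o \<Rightarrow> 'm \<Rightarrow> 'm set" where
  "coset C I x y f = {Add C x y f i | i. i \<in> I x y}"

text \<open>
  The operations on cosets are the ones induced from \<open>C\<close>; the unions range over all
  representatives, each of which gives the same coset.
\<close>

definition quotient_category ::
  "('o, 'm, 'k, 'z) lcat_scheme \<Rightarrow> ('o \<Rightarrow> 'o \<Rightarrow> 'm set) \<Rightarrow> ('o, 'm set, 'k) lcat" where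
  "quotient_category C I = \<lparr>
     Obj = Obj C,
     Hom = (\<lambda>x y. coset C I x y ` Hom C x y),
     Idn = (\<lambda>x. coset C I x x (Idn C x)),
     Cmp = (\<lambda>x y z b a. \<Union>g\<in>b. \<Union>f\<in>a. coset C I x z (Cmp C x y z g f)),
     Zer = (\<lambda>x y. coset C I x y (Zer C x y)),
     Add = (\<lambda>x y a b. \<Union>f\<in>a. \<Union>g\<in>b. coset C I x y (Add C x y f g)),
     Scl = (\<lambda>x y c a. \<Union>f\<in>a. coset C I x y (Scl C x y c f))\<rparr>"


section \<open>Triples and screens\<close>

text \<open>
  Paths are functions on the reals that are \<open>undefined\<close> outside the unit interval.
  \<open>concat_path \<gamma> \<gamma>'\<close> is \<open>\<gamma>\<close> followed by \<open>\<gamma>'\<close>; it is only meaningful if \<open>\<gamma> 1 = \<gamma>' 0\<close>.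
\<close>

definition concat_path :: "(real \<Rightarrow> 'a) \<Rightarrow> (real \<Rightarrow> 'a) \<Rightarrow> real \<Rightarrow> 'a" where
  "concat_path \<gamma> \<gamma>' = (\<lambda>t\<in>{0..1}. if t \<le> 1/2 then \<gamma> (2 * t) else \<gamma>' (2 * t - 1))"

definition const_path :: "'a \<Rightarrow> real \<Rightarrow> 'a" where
  "const_path x = (\<lambda>t\<in>{0..1}. x)"

definition im :: "(real \<Rightarrow> 'a) \<Rightarrow> 'a set" where
  "im \<gamma> = \<gamma> ` {0..1}"

definition interval_map :: "(real \<Rightarrow> real) \<Rightarrow> bool" where
  "interval_map \<phi> \<longleftrightarrow> \<phi> \<in> {0..1} \<rightarrow> {0..1} \<and> mono_on {0..1} \<phi> \<and>
     (\<forall>J\<subseteq>{0..1}. is_interval J \<longrightarrow> is_interval (\<phi> ` J))"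

record 'a triple =
  Pts :: "'a set"
  Paths :: "(real \<Rightarrow> 'a) set"
  Eqv :: "((real \<Rightarrow> 'a) \<times> (real \<Rightarrow> 'a)) set"

locale path_triple =
  fixes T :: "'a triple"
  assumes Pts_nonempty: "Pts T \<noteq> {}"
    and Paths_subset: "Paths T \<subseteq> {0..1} \<rightarrow>\<^sub>E Pts T"
    and equiv_Eqv: "equiv (Paths T) (Eqv T)"
    and Eqv_endpoints: "(\<gamma>, \<gamma>') \<in> Eqv T \<Longrightarrow> \<gamma> 0 = \<gamma>' 0 \<and> \<gamma> 1 = \<gamma>' 1"
    and concat_in_Paths: "\<lbrakk>\<gamma> \<in> Paths T; \<gamma>' \<in> Paths T; \<gamma> 1 = \<gamma>' 0\<rbrakk> \<Longrightarrow> concat_path \<gamma> \<gamma>' \<in> Paths T"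
    and reparam_in_Paths: "\<lbrakk>\<gamma> \<in> Paths T; interval_map \<phi>\<rbrakk>
      \<Longrightarrow> restrict (\<gamma> \<circ> \<phi>) {0..1} \<in> Paths T"
    and const_in_Paths: "x \<in> Pts T \<Longrightarrow> const_path x \<in> Paths T"
    and Eqv_const: "\<lbrakk>x \<in> Pts T; (\<gamma>, const_path x) \<in> Eqv T\<rbrakk> \<Longrightarrow> \<exists>y\<in>Pts T. \<gamma> = const_path y"
    and Eqv_reparam: "\<lbrakk>\<gamma> \<in> Paths T; interval_map \<phi>; \<phi> 0 = 0; \<phi> 1 = 1\<rbrakk>
      \<Longrightarrow> (\<gamma>, restrict (\<gamma> \<circ> \<phi>) {0..1}) \<in> Eqv T"
    and Eqv_concat: "\<lbrakk>\<gamma> \<in> Paths T; \<gamma>' \<in> Paths T; \<rho> \<in> Paths T; \<rho>' \<in> Paths T;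
        \<rho> 1 = \<gamma> 0; \<gamma> 1 = \<rho>' 0; \<rho> 1 = \<gamma>' 0; \<gamma>' 1 = \<rho>' 0;
        concat_path (concat_path \<rho> \<gamma>) \<rho>' \<in> Paths T; concat_path (concat_path \<rho> \<gamma>') \<rho>' \<in> Paths T\<rbrakk>
      \<Longrightarrow> (\<gamma>, \<gamma>') \<in> Eqv T \<longleftrightarrow>
          (concat_path (concat_path \<rho> \<gamma>) \<rho>', concat_path (concat_path \<rho> \<gamma>') \<rho>') \<in> Eqv T"

definition in_pixel :: "'a set set \<Rightarrow> (real \<Rightarrow> 'a) \<Rightarrow> bool" where
  "in_pixel P \<rho> \<longleftrightarrow> (\<exists>X\<in>P. im \<rho> \<subseteq> X)"

text \<open>
  \<open>pixel_walk T X x y n \<gamma>\<close>: the walk \<open>\<gamma>\<^sub>0 \<gamma>\<^sub>1\<^sup>-\<^sup>1 \<gamma>\<^sub>2 \<dots> \<gamma>\<^sub>2\<^sub>n\<^sub>-\<^sub>1\<^sup>-\<^sup>1 \<gamma>\<^sub>2\<^sub>n\<close> inside \<open>X\<close> is defined and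
  leads from \<open>x\<close> to \<open>y\<close>; the paths with odd index are run backwards.
\<close>

definition pixel_walk ::
  "'a triple \<Rightarrow> 'a set \<Rightarrow> 'a \<Rightarrow> 'a \<Rightarrow> nat \<Rightarrow> (nat \<Rightarrow> real \<Rightarrow> 'a) \<Rightarrow> bool" where
  "pixel_walk T X x y n \<gamma> \<longleftrightarrow>
     (\<forall>i\<le>2 * n. \<gamma> i \<in> Paths T \<and> im (\<gamma> i) \<subseteq> X) \<and> \<gamma> 0 0 = x \<and> \<gamma> (2 * n) 1 = y \<and>
     (\<forall>i<2 * n. if even i then \<gamma> i 1 = \<gamma> (Suc i) 1 else \<gamma> i 0 = \<gamma> (Suc i) 0)"

definition interval_partition :: "real set list \<Rightarrow> bool" where
  "interval_partition Is \<longleftrightarrow> (\<forall>I\<in>set Is. is_interval I \<and> I \<noteq> {}) \<and> \<Union>(set Is) = {0..1} \<and>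
     sorted_wrt (\<lambda>I J. \<forall>s\<in>I. \<forall>t\<in>J. s < t) Is"

definition pixel_sequence ::
  "'a set set \<Rightarrow> (real \<Rightarrow> 'a) \<Rightarrow> real set list \<Rightarrow> 'a set list \<Rightarrow> bool" where
  "pixel_sequence P \<gamma> Is Xs \<longleftrightarrow> interval_partition Is \<and> length Xs = length Is \<and> set Xs \<subseteq> P \<and>
     (\<forall>i<length Is. \<gamma> ` (Is ! i) \<subseteq> Xs ! i) \<and>
     (\<forall>i<length Is. \<forall>j<length Is. i \<noteq> j \<longrightarrow> Xs ! i = Xs ! j \<longrightarrow> \<bar>int i - int j\<bar> > 1)"

locale screen = path_triple T for T :: "'a triple" +
  fixes P :: "'a set set"
  assumes partition: "partition_on (Pts T) P"
    and S1: "\<lbrakk>\<gamma> \<in> Paths T; \<gamma>' \<in> Paths T; \<gamma> 0 = \<gamma>' 0; \<gamma> 1 = \<gamma>' 1; X \<in> P; im \<gamma> \<subseteq> X\<rbrakk>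
      \<Longrightarrow> (\<gamma>, \<gamma>') \<in> Eqv T \<longleftrightarrow> im \<gamma>' \<subseteq> X"
    and S2: "\<lbrakk>X \<in> P; x \<in> X; y \<in> X\<rbrakk> \<Longrightarrow> \<exists>n \<gamma>. pixel_walk T X x y n \<gamma>"
    and S3: "\<lbrakk>\<rho> \<in> Paths T; \<gamma> \<in> Paths T; \<rho> 0 = \<gamma> 0; in_pixel P \<rho>\<rbrakk>
      \<Longrightarrow> \<exists>\<rho>'\<in>Paths T. \<exists>\<gamma>'\<in>Paths T. in_pixel P \<rho>' \<and> \<gamma> 1 = \<rho>' 0 \<and> \<rho> 1 = \<gamma>' 0 \<and>
            (concat_path \<gamma> \<rho>', concat_path \<rho> \<gamma>') \<in> Eqv T"
    and S3_dual: "\<lbrakk>\<rho>' \<in> Paths T; \<gamma>' \<in> Paths T; \<rho>' 1 = \<gamma>' 1; in_pixel P \<rho>'\<rbrakk>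
      \<Longrightarrow> \<exists>\<rho>\<in>Paths T. \<exists>\<gamma>\<in>Paths T. in_pixel P \<rho> \<and> \<gamma> 1 = \<rho>' 0 \<and> \<rho> 1 = \<gamma>' 0 \<and>
            (concat_path \<gamma> \<rho>', concat_path \<rho> \<gamma>') \<in> Eqv T"
    and S4: "\<gamma> \<in> Paths T \<Longrightarrow> \<exists>Is Xs. pixel_sequence P \<gamma> Is Xs"
    and S5: "\<lbrakk>\<gamma> \<in> Paths T; \<gamma>' \<in> Paths T; \<gamma> 0 = \<gamma>' 0; \<gamma> 1 = \<gamma>' 1;
        pixel_sequence P \<gamma> Is Xs; pixel_sequence P \<gamma>' Is Xs\<rbrakk> \<Longrightarrow> (\<gamma>, \<gamma>') \<in> Eqv T"

definition screens :: "'a triple \<Rightarrow> 'a set set set" where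
  "screens T = {P. screen T P}"

definition directed_screen_sets :: "'a triple \<Rightarrow> 'a set set set set" where
  "directed_screen_sets T = {L. L \<subseteq> screens T \<and> L \<noteq> {} \<and>
     (\<forall>F\<subseteq>L. finite F \<longrightarrow> (\<exists>P\<in>L. \<forall>Q\<in>F. refines (Pts T) P Q))}"


section \<open>Path categories\<close>

definition path_class :: "'a triple \<Rightarrow> (real \<Rightarrow> 'a) \<Rightarrow> (real \<Rightarrow> 'a) set" where
  "path_class T \<gamma> = Eqv T `` {\<gamma>}"

text \<open>Composition is concatenation of representatives, \<open>[\<gamma>'] \<circ> [\<gamma>] = [\<gamma> \<cdot> \<gamma>']\<close>.\<close>

definition path_category :: "'a triple \<Rightarrow> ('a, (real \<Rightarrow> 'a) set) cat" where
  "path_category T = \<lparr>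
     Obj = Pts T,
     Hom = (\<lambda>x y. {path_class T \<gamma> | \<gamma>. \<gamma> \<in> Paths T \<and> \<gamma> 0 = x \<and> \<gamma> 1 = y}),
     Idn = (\<lambda>x. path_class T (const_path x)),
     Cmp = (\<lambda>x y z b a. \<Union>\<gamma>'\<in>b. \<Union>\<gamma>\<in>a. path_class T (concat_path \<gamma> \<gamma>'))\<rparr>"

text \<open>
  In the linear path category the object \<open>Some x\<close> is the point \<open>x\<close> and \<open>None\<close> is the added zero
  object.  Elements of the free module on a set are finitely supported functions.
\<close>

definition linear_path_category ::
  "'a triple \<Rightarrow>
   ('a option, (real \<Rightarrow> 'a) set \<Rightarrow>\<^sub>0 'k :: {comm_ring, comm_monoid_mult}, 'k) lcat" where
  "linear_path_category T = \<lparr>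
     Obj = insert None (Some ` Pts T),
     Hom = (\<lambda>a b. case (a, b) of
         (Some x, Some y) \<Rightarrow> {f. Poly_Mapping.keys f \<subseteq> Hom (path_category T) x y}
       | _ \<Rightarrow> {0}),
     Idn = (\<lambda>a. case a of
         Some x \<Rightarrow> Poly_Mapping.single (Idn (path_category T) x) 1
       | None \<Rightarrow> 0),
     Cmp = (\<lambda>a b c g f. case (a, b, c) of
         (Some x, Some y, Some z) \<Rightarrow>
           (\<Sum>q\<in>Poly_Mapping.keys g. \<Sum>p\<in>Poly_Mapping.keys f.
              Poly_Mapping.single (Cmp (path_category T) x y z q p)
                (Poly_Mapping.lookup g q * Poly_Mapping.lookup f p))
       | _ \<Rightarrow> 0),
     Zer = (\<lambda>a b. 0),
     Add = (\<lambda>a b f g. f + g),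
     Scl = (\<lambda>a b c f. Poly_Mapping.map ((*) c) f)\<rparr>"

text \<open>
  A formal finite sum \<open>\<Sum>\<^sub>i \<lambda>\<^sub>i [\<gamma>\<^sub>i]\<close> is represented by the list of the pairs \<open>(\<lambda>\<^sub>i, \<gamma>\<^sub>i)\<close>.
\<close>

definition path_sum ::
  "'a triple \<Rightarrow> ('k \<times> (real \<Rightarrow> 'a)) list \<Rightarrow>
   (real \<Rightarrow> 'a) set \<Rightarrow>\<^sub>0 'k :: {comm_ring, comm_monoid_mult}" where
  "path_sum T ps = (\<Sum>(c, \<gamma>)\<leftarrow>ps. Poly_Mapping.single (path_class T \<gamma>) c)"

definition zero_divisor :: "'k :: {comm_ring, comm_monoid_mult} \<Rightarrow> bool" where
  "zero_divisor c \<longleftrightarrow> (\<exists>d. d \<noteq> 0 \<and> c * d = 0)"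

definition regular_path_sums ::
  "'a triple \<Rightarrow> 'a option \<Rightarrow> 'a option \<Rightarrow>
   ((real \<Rightarrow> 'a) set \<Rightarrow>\<^sub>0 'k :: {comm_ring, comm_monoid_mult}) set" where
  "regular_path_sums T a b =
     {path_sum T ps | ps. \<forall>(c, \<gamma>)\<in>set ps.
        \<not> zero_divisor c \<and> \<gamma> \<in> Paths T \<and> a = Some (\<gamma> 0) \<and> b = Some (\<gamma> 1)}"

definition path_based_ideal ::
  "'a triple \<Rightarrow>
   ('a option \<Rightarrow> 'a option \<Rightarrow> ((real \<Rightarrow> 'a) set \<Rightarrow>\<^sub>0 'k :: {comm_ring, comm_monoid_mult}) set)
   \<Rightarrow> bool" where
  "path_based_ideal T I \<longleftrightarrow> cat_ideal (linear_path_category T) I \<and>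
     (\<exists>G. (\<forall>a b. G a b \<subseteq> regular_path_sums T a b) \<and>
        (\<forall>a\<in>Obj (linear_path_category T :: ('a option, _, 'k) lcat).
         \<forall>b\<in>Obj (linear_path_category T :: ('a option, _, 'k) lcat).
           I a b = generated_ideal (linear_path_category T) G a b))"

definition quotient_path_class ::
  "'a triple \<Rightarrow>
   ('a option \<Rightarrow> 'a option \<Rightarrow> ((real \<Rightarrow> 'a) set \<Rightarrow>\<^sub>0 'k :: {comm_ring, comm_monoid_mult}) set) \<Rightarrow>
   (real \<Rightarrow> 'a) \<Rightarrow> ((real \<Rightarrow> 'a) set \<Rightarrow>\<^sub>0 'k) set" where
  "quotient_path_class T I \<rho> =
     coset (linear_path_category T) I (Some (\<rho> 0)) (Some (\<rho> 1))
       (Poly_Mapping.single (path_class T \<rho>) 1)"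


section \<open>Pixelation\<close>

definition pixel_morphisms :: "'a triple \<Rightarrow> 'a set set \<Rightarrow> 'a \<Rightarrow> 'a \<Rightarrow> (real \<Rightarrow> 'a) set set" where
  "pixel_morphisms T P x y =
     {path_class T \<rho> | \<rho>. \<rho> \<in> Paths T \<and> \<rho> 0 = x \<and> \<rho> 1 = y \<and> in_pixel P \<rho>}"

definition pixelates ::
  "'a triple \<Rightarrow> ('o, 'm, 'z) cat_scheme \<Rightarrow> 'a set set \<Rightarrow>
   ('a, (real \<Rightarrow> 'a) set, 'o, 'm) ftor \<Rightarrow> bool" where
  "pixelates T K P M \<longleftrightarrow>
     (\<forall>x\<in>Pts T. \<forall>y\<in>Pts T. \<forall>\<sigma>\<in>pixel_morphisms T P x y.
        is_iso K (FOb M x) (FOb M y) (FMor M x y \<sigma>))"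

definition pixel_equiv_paths ::
  "'a triple \<Rightarrow> 'a set set \<Rightarrow> (real \<Rightarrow> 'a) \<Rightarrow> (real \<Rightarrow> 'a) \<Rightarrow> bool" where
  "pixel_equiv_paths T P \<gamma> \<gamma>' \<longleftrightarrow>
     (\<exists>\<rho>1\<in>Paths T. \<exists>\<rho>2\<in>Paths T. \<exists>\<rho>3\<in>Paths T. \<exists>\<rho>4\<in>Paths T.
        (\<exists>X\<in>P. im \<rho>1 \<union> im \<rho>2 \<subseteq> X) \<and> (\<exists>Y\<in>P. im \<rho>3 \<union> im \<rho>4 \<subseteq> Y) \<and>
        \<rho>1 1 = \<gamma> 0 \<and> \<gamma> 1 = \<rho>3 0 \<and> \<rho>2 1 = \<gamma>' 0 \<and> \<gamma>' 1 = \<rho>4 0 \<and>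
        (concat_path (concat_path \<rho>1 \<gamma>) \<rho>3, concat_path (concat_path \<rho>2 \<gamma>') \<rho>4) \<in> Eqv T)"

text \<open>
  \<open>pixel_equiv_sums T P a b f a' b' g\<close>: the morphisms \<open>f : a \<rightarrow> b\<close> and \<open>g : a' \<rightarrow> b'\<close> can be written
  as sums over lists of terms with the same coefficients and pairwise equivalent paths.
  Permutations are absorbed by the choice of the lists.
\<close>

definition pixel_equiv_sums ::
  "'a triple \<Rightarrow> 'a set set \<Rightarrow>
   'a option \<Rightarrow> 'a option \<Rightarrow> ((real \<Rightarrow> 'a) set \<Rightarrow>\<^sub>0 'k :: {comm_ring, comm_monoid_mult}) \<Rightarrow>
   'a option \<Rightarrow> 'a option \<Rightarrow> ((real \<Rightarrow> 'a) set \<Rightarrow>\<^sub>0 'k) \<Rightarrow> bool" where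
  "pixel_equiv_sums T P a b f a' b' g \<longleftrightarrow>
     (\<exists>ps qs. f = path_sum T ps \<and> g = path_sum T qs \<and>
        (\<forall>(c, \<gamma>)\<in>set ps. \<gamma> \<in> Paths T \<and> a = Some (\<gamma> 0) \<and> b = Some (\<gamma> 1)) \<and>
        (\<forall>(c, \<gamma>)\<in>set qs. \<gamma> \<in> Paths T \<and> a' = Some (\<gamma> 0) \<and> b' = Some (\<gamma> 1)) \<and>
        list_all2 (\<lambda>(c, \<gamma>) (d, \<gamma>'). c = d \<and> pixel_equiv_paths T P \<gamma> \<gamma>') ps qs)"

definition pixel_closure ::
  "'a triple \<Rightarrow> 'a set set \<Rightarrow>
   ('a option \<Rightarrow> 'a option \<Rightarrow> ((real \<Rightarrow> 'a) set \<Rightarrow>\<^sub>0 'k :: {comm_ring, comm_monoid_mult}) set) \<Rightarrow>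
   'a option \<Rightarrow> 'a option \<Rightarrow> ((real \<Rightarrow> 'a) set \<Rightarrow>\<^sub>0 'k) set" where
  "pixel_closure T P I =
     generated_ideal (linear_path_category T)
       (\<lambda>a b. {f. \<exists>a'\<in>Obj (linear_path_category T :: ('a option, _, 'k) lcat).
                  \<exists>b'\<in>Obj (linear_path_category T :: ('a option, _, 'k) lcat).
                  \<exists>g\<in>I a' b'. pixel_equiv_sums T P a b f a' b' g})"

definition pre_dead ::
  "'a triple \<Rightarrow>
   ('a option \<Rightarrow> 'a option \<Rightarrow> ((real \<Rightarrow> 'a) set \<Rightarrow>\<^sub>0 'k :: {comm_ring, comm_monoid_mult}) set) \<Rightarrow>
   'a set \<Rightarrow> bool" where
  "pre_dead T I X \<longleftrightarrow>
     (\<exists>\<rho>\<in>Paths T. im \<rho> \<subseteq> X \<and>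
        quotient_path_class T I \<rho>
          = Zer (quotient_category (linear_path_category T) I) (Some (\<rho> 0)) (Some (\<rho> 1)))"

text \<open>
  Here \<open>M\<close> is a functor on the quotient by \<open>I\<close>, whereas the class of pixel morphisms to be inverted
  lives in the quotient by \<open>pixel_closure T P I\<close>.  A path in a pixel whose class is nonzero in the
  latter is therefore tested through its class in the former; the zero morphisms between points of
  a pre-dead pixel are tested separately (so \<open>M\<close> vanishes on such a pixel).
\<close>

definition linear_pixelates ::
  "'a triple \<Rightarrow>
   ('a option \<Rightarrow> 'a option \<Rightarrow> ((real \<Rightarrow> 'a) set \<Rightarrow>\<^sub>0 'k :: {comm_ring, comm_monoid_mult}) set) \<Rightarrow>
   ('o, 'm, 'z) cat_scheme \<Rightarrow> 'a set set \<Rightarrow>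
   ('a option, ((real \<Rightarrow> 'a) set \<Rightarrow>\<^sub>0 'k) set, 'o, 'm) ftor \<Rightarrow> bool" where
  "linear_pixelates T I K P M \<longleftrightarrow>
     (\<forall>\<rho>\<in>Paths T. in_pixel P \<rho> \<longrightarrow>
        quotient_path_class T (pixel_closure T P I) \<rho>
          \<noteq> Zer (quotient_category (linear_path_category T) (pixel_closure T P I))
              (Some (\<rho> 0)) (Some (\<rho> 1)) \<longrightarrow>
        is_iso K (FOb M (Some (\<rho> 0))) (FOb M (Some (\<rho> 1)))
          (FMor M (Some (\<rho> 0)) (Some (\<rho> 1)) (quotient_path_class T I \<rho>))) \<and>
     (\<forall>X\<in>P. pre_dead T I X \<longrightarrow> (\<forall>x\<in>X. \<forall>y\<in>X.
        is_iso K (FOb M (Some x)) (FOb M (Some y))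
          (FMor M (Some x) (Some y)
             (Zer (quotient_category (linear_path_category T) I) (Some x) (Some y)))))"


section \<open>Categories of representations\<close>

definition Rep ::
  "('o, 'm, 'k, 'z) lcat_scheme \<Rightarrow> ('p, 'n, 'y) cat_scheme \<Rightarrow>
   (('p, 'n, 'o, 'm) ftor, 'p \<Rightarrow> 'm, 'k) lcat" where
  "Rep K D = functor_category D K"

text \<open>
  Linearity on Hom-modules already forces the zero object, and any biproducts present, to be
  preserved, so no separate additivity condition is needed.
\<close>

definition Rep_lin ::
  "('o, 'm, 'k, 'z) lcat_scheme \<Rightarrow> ('p, 'n, 'k, 'y) lcat_scheme \<Rightarrow>
   (('p, 'n, 'o, 'm) ftor, 'p \<Rightarrow> 'm, 'k) lcat" where
  "Rep_lin K D = full_subcategory (functor_category D K) {M. is_linear_functor D K M}"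

definition pointwise_finite_length ::
  "('o, 'm, 'k, 'z) lcat_scheme \<Rightarrow> ('p, 'n, 'y) cat_scheme \<Rightarrow> ('p, 'n, 'o, 'm) ftor set" where
  "pointwise_finite_length K D = {M. \<forall>x\<in>Obj D. finite_length K (FOb M x)}"

definition rep_pwf ::
  "('o, 'm, 'k, 'z) lcat_scheme \<Rightarrow> ('p, 'n, 'y) cat_scheme \<Rightarrow>
   (('p, 'n, 'o, 'm) ftor, 'p \<Rightarrow> 'm, 'k) lcat" where
  "rep_pwf K D = full_subcategory (Rep K D) (pointwise_finite_length K D)"

definition rep_lin_pwf ::
  "('o, 'm, 'k, 'z) lcat_scheme \<Rightarrow> ('p, 'n, 'k, 'y) lcat_scheme \<Rightarrow>
   (('p, 'n, 'o, 'm) ftor, 'p \<Rightarrow> 'm, 'k) lcat" where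
  "rep_lin_pwf K D = full_subcategory (Rep_lin K D) (pointwise_finite_length K D)"

definition pixelated_by ::
  "'a triple \<Rightarrow> ('o, 'm, 'z) cat_scheme \<Rightarrow> 'a set set set \<Rightarrow>
   ('a, (real \<Rightarrow> 'a) set, 'o, 'm) ftor set" where
  "pixelated_by T K L = {M. \<exists>P\<in>L. pixelates T K P M}"

definition linear_pixelated_by ::
  "'a triple \<Rightarrow>
   ('a option \<Rightarrow> 'a option \<Rightarrow> ((real \<Rightarrow> 'a) set \<Rightarrow>\<^sub>0 'k :: {comm_ring, comm_monoid_mult}) set) \<Rightarrow>
   ('o, 'm, 'z) cat_scheme \<Rightarrow> 'a set set set \<Rightarrow>
   ('a option, ((real \<Rightarrow> 'a) set \<Rightarrow>\<^sub>0 'k) set, 'o, 'm) ftor set" where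
  "linear_pixelated_by T I K L = {M. \<exists>P\<in>L. linear_pixelates T I K P M}"

end

theory Submission
  imports Defs
begin

text \<open>
  Limits and colimits in a functor category are computed pointwise.  Hence a full subcategory whose
  objects are closed under pointwise zero objects, biproducts, kernels and cokernels is abelian,
  and its embedding into a larger such subcategory is exact.  Functors that invert a fixed set of
  morphisms are closed in this sense, and so are linear and pointwise finite length functors.
  For functors pixelated by some screen in a directed set, the only question is whether a
  functor pixelated by a screen \<open>P\<close> is pixelated by every refinement \<open>R\<close> of \<open>P\<close>.  In the linear
  case the closure of \<open>I\<close> with respect to \<open>R\<close> is smaller, so more paths must be inverted.
  By the Ore conditions (S3), a path in a pixel \<open>X\<close> whose class lies in the closure of
  \<open>I\<close> with respect to \<open>P\<close> extends inside \<open>X\<close> to a path with class in \<open>I\<close>; so \<open>X\<close> is pre-dead, the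
  functor vanishes on \<open>X\<close>, and the path is inverted anyway.
\<close>

section \<open>Linear abelian categories\<close>

text \<open>The closure of \<open>I\<close> is an intersection of ideals, so membership in it yields
  no explicit expression to work with. The way out is an upper bound: \<open>saturation\<close> is
  an explicit set of morphisms that contains the generators of the closure and is an ideal, so it
  contains the closure. That it is an ideal is a calculus of fractions with the paths inside pixels
  as denominators: (S3) moves a denominator past a composition, and (S1), which makes parallel paths
  inside a pixel equivalent, lets the denominators of two summands be made equal. For a single path
  inside a pixel the fraction is just a longer path in that pixel.

  On the categorical side, the closure conditions speak of every pointwise kernel, not of a chosen
  one. Kernels in such a subcategory are exactly the pointwise kernels, a condition in which the
  subcategory does not occur; this makes the embeddings exact. Finite length as defined is not
  visibly self-dual, so subobjects, quotients and biproducts get separate inductions.\<close>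

declare (in category) Idn_in_Hom [simp] Cmp_in_Hom [simp]
  Cmp_Idn_left [simp] Cmp_Idn_right [simp] Cmp_assoc [simp]

declare (in preadditive_category) Zer_in_Hom [simp] Add_in_Hom [simp] Add_Zer [simp]

declare (in linear_category) Scl_in_Hom [simp] Scl_one [simp]

section \<open>Isomorphisms, monomorphisms and kernels\<close>

context category
begin

text \<open>As a simp rule \<open>Cmp_assoc\<close> nests composites to the right, which hides a
  known equation between twofold composites as soon as a further morphism \<open>e\<close> is
  composed first. This is the equation with \<open>e\<close> attached; the primed variant below has
  a single morphism on the right-hand side.\<close>

lemma Cmp_reassoc:
  assumes "Cmp C x y z g f = Cmp C x y' z g' f'"
    and "w \<in> Obj C" "x \<in> Obj C" "y \<in> Obj C" "y' \<in> Obj C" "z \<in> Obj C"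
    and "e \<in> Hom C w x" "f \<in> Hom C x y" "g \<in> Hom C y z" "f' \<in> Hom C x y'" "g' \<in> Hom C y' z"
  shows "Cmp C w y z g (Cmp C w x y f e) = Cmp C w y' z g' (Cmp C w x y' f' e)"
  using assms by (metis Cmp_assoc)

lemma Cmp_reassoc':
  assumes "Cmp C x y z g f = h"
    and "w \<in> Obj C" "x \<in> Obj C" "y \<in> Obj C" "z \<in> Obj C"
    and "e \<in> Hom C w x" "f \<in> Hom C x y" "g \<in> Hom C y z"
  shows "Cmp C w y z g (Cmp C w x y f e) = Cmp C w x z h e"
  using assms by (metis Cmp_assoc)

lemma is_isoI:
  assumes "f \<in> Hom C x y" "g \<in> Hom C y x"
    and "Cmp C x y x g f = Idn C x" "Cmp C y x y f g = Idn C y"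
  shows "is_iso C x y f"
  using assms by (auto simp: is_iso_def)

lemma is_isoE:
  assumes "is_iso C x y f"
  obtains g where "f \<in> Hom C x y" "g \<in> Hom C y x"
    "Cmp C x y x g f = Idn C x" "Cmp C y x y f g = Idn C y" "is_iso C y x g"
  using assms by (auto simp: is_iso_def)

text \<open>The inverse of \<open>f\<close> is the inverse \<open>k\<close> of the composite,
  preceded by \<open>g\<close>.\<close>

lemma is_iso_cancel_left:
  assumes "x \<in> Obj C" "y \<in> Obj C" "z \<in> Obj C" "f \<in> Hom C x y"
    and g: "is_iso C y z g" and gf: "is_iso C x z (Cmp C x y z g f)"
  shows "is_iso C x y f"
proof -
  obtain g' where g': "g \<in> Hom C y z" "g' \<in> Hom C z y"
    "Cmp C y z y g' g = Idn C y" "Cmp C z y z g g' = Idn C z"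
    using g by (rule is_isoE)
  obtain k where k: "k \<in> Hom C z x" "Cmp C x z x k (Cmp C x y z g f) = Idn C x"
    "Cmp C z x z (Cmp C x y z g f) k = Idn C z"
    using gf by (rule is_isoE)
  show ?thesis
  proof (rule is_isoI)
    show "Cmp C y x y f (Cmp C y z x k g) = Idn C y"
    proof -
      \<comment> \<open>Composing this expression for \<open>f\<close> with \<open>k\<close> leaves
        \<open>g'\<close>, so the composite to be computed is \<open>g'\<close> after
        \<open>g\<close>.\<close>
      have "f = Cmp C x z y g' (Cmp C x y z g f)"
        using assms(1-4) g' Cmp_reassoc'[OF g'(3)] by simp
      then have "Cmp C z x y f k = g'"
        using assms(1-4) g' k by (metis Cmp_Idn_right Cmp_assoc Cmp_in_Hom)
      then show ?thesis
        using assms(1-4) g' k by (metis Cmp_assoc)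
    qed
  qed (use assms(1-4) g' k in auto)
qed

lemma is_iso_imp_mono:
  assumes "x \<in> Obj C" "y \<in> Obj C" "is_iso C x y f"
  shows "is_mono C x y f"
proof -
  obtain g where g: "f \<in> Hom C x y" "g \<in> Hom C y x" "Cmp C x y x g f = Idn C x"
    using assms(3) by (rule is_isoE)
  show ?thesis
    unfolding is_mono_def
    using assms(1,2) g by (metis Cmp_Idn_left Cmp_assoc)
qed

lemma is_mono_Cmp:
  assumes "x \<in> Obj C" "y \<in> Obj C" "z \<in> Obj C" "is_mono C x y f" "is_mono C y z g"
  shows "is_mono C x z (Cmp C x y z g f)"
  using assms unfolding is_mono_def by (metis Cmp_assoc Cmp_in_Hom)

lemma is_mono_cancel:
  assumes "x \<in> Obj C" "y \<in> Obj C" "z \<in> Obj C" "f \<in> Hom C x y" "g \<in> Hom C y z"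
    and "is_mono C x z (Cmp C x y z g f)"
  shows "is_mono C x y f"
  using assms unfolding is_mono_def by (metis Cmp_assoc)

lemma is_monoD:
  "\<lbrakk>is_mono C x y f; w \<in> Obj C; g \<in> Hom C w x; h \<in> Hom C w x;
    Cmp C w x y f g = Cmp C w x y f h\<rbrakk> \<Longrightarrow> g = h"
  by (auto simp: is_mono_def)

lemma is_epiD:
  "\<lbrakk>is_epi C x y f; z \<in> Obj C; g \<in> Hom C y z; h \<in> Hom C y z;
    Cmp C x y z g f = Cmp C x y z h f\<rbrakk> \<Longrightarrow> g = h"
  by (auto simp: is_epi_def)

end

context preadditive_category
begin

lemma Add_Zer_left [simp]:
  "\<lbrakk>x \<in> Obj C; y \<in> Obj C; f \<in> Hom C x y\<rbrakk> \<Longrightarrow> Add C x y (Zer C x y) f = f"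
  by (metis Add_commute Add_Zer Zer_in_Hom)

lemma Add_right_cancel:
  assumes "x \<in> Obj C" "y \<in> Obj C" "f \<in> Hom C x y" "g \<in> Hom C x y" "h \<in> Hom C x y"
    and "Add C x y f h = Add C x y g h"
  shows "f = g"
  using assms by (metis Add_Zer Add_assoc Add_inverse)

lemma Cmp_Zer_left [simp]:
  assumes "x \<in> Obj C" "y \<in> Obj C" "z \<in> Obj C" "f \<in> Hom C x y"
  shows "Cmp C x y z (Zer C y z) f = Zer C x z"
proof (rule Add_right_cancel)
  show "Add C x z (Cmp C x y z (Zer C y z) f) (Cmp C x y z (Zer C y z) f)
    = Add C x z (Zer C x z) (Cmp C x y z (Zer C y z) f)"
    using assms by (simp add: Cmp_Add_left[symmetric])
qed (use assms in auto)

lemma Cmp_Zer_right [simp]: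
  assumes "x \<in> Obj C" "y \<in> Obj C" "z \<in> Obj C" "f \<in> Hom C y z"
  shows "Cmp C x y z f (Zer C x y) = Zer C x z"
proof (rule Add_right_cancel)
  show "Add C x z (Cmp C x y z f (Zer C x y)) (Cmp C x y z f (Zer C x y))
    = Add C x z (Zer C x z) (Cmp C x y z f (Zer C x y))"
    using assms by (simp add: Cmp_Add_right[symmetric])
qed (use assms in auto)

lemma is_mono_iff:
  assumes "x \<in> Obj C" "y \<in> Obj C"
  shows "is_mono C x y f \<longleftrightarrow> f \<in> Hom C x y \<and>
    (\<forall>w\<in>Obj C. \<forall>h\<in>Hom C w x. Cmp C w x y f h = Zer C w y \<longrightarrow> h = Zer C w x)"
    (is "_ \<longleftrightarrow> ?R")
proof
  assume m: "is_mono C x y f"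
  then have "f \<in> Hom C x y" by (simp add: is_mono_def)
  then show ?R using assms is_monoD[OF m] by fastforce
next
  assume R: ?R
  show "is_mono C x y f"
    unfolding is_mono_def
  proof (intro conjI ballI impI)
    show f: "f \<in> Hom C x y" using R by simp
    fix w g h assume w: "w \<in> Obj C" and g: "g \<in> Hom C w x" and h: "h \<in> Hom C w x"
      and eq: "Cmp C w x y f g = Cmp C w x y f h"
    \<comment> \<open>The record has no negation; \<open>n\<close> plays the role of -h, and the
      hypothesis is applied to g - h.\<close>
    obtain n where n: "n \<in> Hom C w x" "Add C w x h n = Zer C w x"
      using Add_inverse assms w h by blast
    have "Cmp C w x y f (Add C w x g n) = Cmp C w x y f (Add C w x h n)"
      using assms w f g h n(1) eq by (simp add: Cmp_Add_right)
    then have "Cmp C w x y f (Add C w x g n) = Zer C w y"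
      using assms w f n(2) by simp
    then have "Add C w x g n = Zer C w x"
      using R w g n(1) assms by simp
    then show "g = h"
      using Add_right_cancel[of w x g h n] n w assms g h by simp
  qed
qed

text \<open>Every morphism into or out of \<open>z\<close> factors through the identity of
  \<open>z\<close>, hence vanishes with it. Being an equation, the criterion can be checked object
  by object in a functor category.\<close>

lemma is_zero_object_iff: "is_zero_object C z \<longleftrightarrow> z \<in> Obj C \<and> Idn C z = Zer C z z"
proof
  assume z: "is_zero_object C z"
  then show "z \<in> Obj C \<and> Idn C z = Zer C z z"
    unfolding is_zero_object_def by (metis Idn_in_Hom Zer_in_Hom)
next
  assume z: "z \<in> Obj C \<and> Idn C z = Zer C z z"
  have "f = Zer C z x" if "x \<in> Obj C" "f \<in> Hom C z x" for x f
    using z that by (metis Cmp_Idn_right Cmp_Zer_right)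
  moreover have "f = Zer C x z" if "x \<in> Obj C" "f \<in> Hom C x z" for x f
    using z that by (metis Cmp_Idn_left Cmp_Zer_left)
  ultimately show "is_zero_object C z"
    using z unfolding is_zero_object_def by (metis Zer_in_Hom)
qed

lemma zero_object_Hom_eq:
  assumes "is_zero_object C z" "x \<in> Obj C"
  shows "\<lbrakk>f \<in> Hom C z x; g \<in> Hom C z x\<rbrakk> \<Longrightarrow> f = g"
    and "\<lbrakk>f \<in> Hom C x z; g \<in> Hom C x z\<rbrakk> \<Longrightarrow> f = g"
  using assms by (auto simp: is_zero_object_def)

lemma zero_object_is_iso:
  assumes "is_zero_object C x" "is_zero_object C y" "f \<in> Hom C x y"
  shows "is_iso C x y f"
proof (rule is_isoI[OF assms(3)])
  have xy: "x \<in> Obj C" "y \<in> Obj C" using assms(1,2) by (auto simp: is_zero_object_def)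
  show "Zer C y x \<in> Hom C y x" using xy by simp
  show "Cmp C x y x (Zer C y x) f = Idn C x" "Cmp C y x y f (Zer C y x) = Idn C y"
    using xy assms(3) is_zero_object_iff assms(1,2) by auto
qed

lemma zero_object_iso:
  assumes "x \<in> Obj C" "y \<in> Obj C" "is_zero_object C x" "is_iso C x y f"
  shows "is_zero_object C y"
proof -
  obtain g where g: "f \<in> Hom C x y" "g \<in> Hom C y x" "Cmp C y x y f g = Idn C y"
    using assms(4) by (rule is_isoE)
  have "f = Zer C x y" using zero_object_Hom_eq(1)[OF assms(3,2) g(1)] assms(1,2) by simp
  then show ?thesis using assms(1,2) g by (simp add: is_zero_object_iff)
qed

lemma is_kernelD:
  assumes "is_kernel C x y f k i"
  shows "k \<in> Obj C" "i \<in> Hom C k x" "Cmp C k x y f i = Zer C k y"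
  using assms by (auto simp: is_kernel_def)

lemma is_kernel_factor:
  assumes "is_kernel C x y f k i" "w \<in> Obj C" "h \<in> Hom C w x" "Cmp C w x y f h = Zer C w y"
  obtains u where "u \<in> Hom C w k" "Cmp C w k x i u = h"
  using assms unfolding is_kernel_def by blast

lemma is_kernel_mono:
  assumes "x \<in> Obj C" "y \<in> Obj C" "f \<in> Hom C x y" "is_kernel C x y f k i"
  shows "is_mono C k x i"
  unfolding is_mono_def
proof (intro conjI ballI impI)
  note k = is_kernelD[OF assms(4)]
  show "i \<in> Hom C k x" by (rule k)
  fix w g h assume "w \<in> Obj C" "g \<in> Hom C w k" "h \<in> Hom C w k"
    and "Cmp C w k x i g = Cmp C w k x i h"
  moreover have "Cmp C w x y f (Cmp C w k x i h) = Zer C w y"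
    if "w \<in> Obj C" "h \<in> Hom C w k"
    using that k assms by (simp add: Cmp_reassoc'[OF k(3)])
  moreover have "Cmp C w k x i h \<in> Hom C w x" if "w \<in> Obj C" "h \<in> Hom C w k"
    using that k assms by simp
  ultimately show "g = h"
    using assms(4) unfolding is_kernel_def by metis
qed

text \<open>Uniqueness of the factorization is exactly what the mono \<open>i\<close> provides, so
  only existence is left to check.\<close>

lemma is_kernelI:
  assumes "x \<in> Obj C" "y \<in> Obj C" "f \<in> Hom C x y" "k \<in> Obj C" "is_mono C k x i"
    and "Cmp C k x y f i = Zer C k y"
    and "\<And>w h. \<lbrakk>w \<in> Obj C; h \<in> Hom C w x; Cmp C w x y f h = Zer C w y\<rbrakk>
      \<Longrightarrow> \<exists>u. u \<in> Hom C w k \<and> Cmp C w k x i u = h"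
  shows "is_kernel C x y f k i"
  using assms unfolding is_kernel_def is_mono_def by metis

text \<open>Used to carry a pointwise description from one well-understood kernel to an arbitrary
  kernel of the same morphism.\<close>

lemma kernel_unique_iso:
  assumes xy: "x \<in> Obj C" "y \<in> Obj C" "f \<in> Hom C x y"
    and k: "is_kernel C x y f k i" and k': "is_kernel C x y f k' i'"
  obtains \<phi> where "is_iso C k k' \<phi>" "Cmp C k k' x i' \<phi> = i"
proof -
  note d = is_kernelD[OF k] and d' = is_kernelD[OF k']
  obtain u where u: "u \<in> Hom C k k'" "Cmp C k k' x i' u = i"
    using is_kernel_factor[OF k' d] by blast
  obtain v where v: "v \<in> Hom C k' k" "Cmp C k' k x i v = i'"
    using is_kernel_factor[OF k d'] by blast
  have "is_iso C k k' u"
  proof (rule is_isoI[OF u(1) v(1)])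
    show "Cmp C k k' k v u = Idn C k"
      by (rule is_monoD[OF is_kernel_mono[OF xy k] d(1)])
        (use xy d d' u v in \<open>simp_all add: Cmp_reassoc'[OF v(2)]\<close>)
    show "Cmp C k' k k' u v = Idn C k'"
      by (rule is_monoD[OF is_kernel_mono[OF xy k'] d'(1)])
        (use xy d d' u v in \<open>simp_all add: Cmp_reassoc'[OF u(2)]\<close>)
  qed
  then show thesis using u that by blast
qed

lemma kernel_precomp_iso:
  assumes xy: "x \<in> Obj C" "y \<in> Obj C" "f \<in> Hom C x y"
    and k: "is_kernel C x y f k i" and k': "k' \<in> Obj C" and \<phi>: "is_iso C k' k \<phi>"
  shows "is_kernel C x y f k' (Cmp C k' k x i \<phi>)"
proof (rule is_kernelI[OF xy k'])
  note d = is_kernelD[OF k]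
  obtain \<psi> where \<psi>: "\<phi> \<in> Hom C k' k" "\<psi> \<in> Hom C k k'" "Cmp C k k' k \<phi> \<psi> = Idn C k"
    using \<phi> by (rule is_isoE)
  show "is_mono C k' x (Cmp C k' k x i \<phi>)"
    using is_mono_Cmp[OF k' d(1) xy(1) is_iso_imp_mono[OF k' d(1) \<phi>] is_kernel_mono[OF xy k]] .
  show "Cmp C k' x y f (Cmp C k' k x i \<phi>) = Zer C k' y"
    using xy d k' \<psi> by (simp add: Cmp_reassoc'[OF d(3)])
  fix w h assume w: "w \<in> Obj C" "h \<in> Hom C w x" "Cmp C w x y f h = Zer C w y"
  obtain u where u: "u \<in> Hom C w k" "Cmp C w k x i u = h"
    using is_kernel_factor[OF k w] .
  have "Cmp C w k' x (Cmp C k' k x i \<phi>) (Cmp C w k k' \<psi> u) = h"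
    using xy d k' \<psi> w u by (simp add: Cmp_reassoc'[OF \<psi>(3)])
  then show "\<exists>u. u \<in> Hom C w k' \<and> Cmp C w k' x (Cmp C k' k x i \<phi>) u = h"
    using d k' \<psi> w u by (metis Cmp_in_Hom)
qed

text \<open>A kernel depends only on which morphisms are annihilated, and a mono after
  \<open>f\<close> does not change that.\<close>

lemma kernel_mono_comp_iff:
  assumes xy: "x \<in> Obj C" "y \<in> Obj C" "f \<in> Hom C x y" and z: "z \<in> Obj C" and m: "is_mono C y z m"
  shows "is_kernel C x z (Cmp C x y z m f) k i \<longleftrightarrow> is_kernel C x y f k i"
proof -
  have m': "m \<in> Hom C y z" using m by (simp add: is_mono_def)
  have eq: "Cmp C w x z (Cmp C x y z m f) h = Zer C w z \<longleftrightarrow> Cmp C w x y f h = Zer C w y"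
    if "w \<in> Obj C" "h \<in> Hom C w x" for w h
    using m that xy z m' by (auto simp: is_mono_iff)
  show ?thesis
    unfolding is_kernel_def by (simp add: eq del: Cmp_assoc cong: conj_cong ball_cong)
qed

lemma kernel_iso_domain:
  assumes xy: "x \<in> Obj C" "y \<in> Obj C" "f \<in> Hom C x y" and x': "x' \<in> Obj C"
    and \<psi>: "\<phi> \<in> Hom C x x'" "\<psi> \<in> Hom C x' x" "Cmp C x x' x \<psi> \<phi> = Idn C x" "Cmp C x' x x' \<phi> \<psi> = Idn C x'"
    and k: "is_kernel C x y f k i"
  shows "is_kernel C x' y (Cmp C x' x y f \<psi>) k (Cmp C k x x' \<phi> i)"
proof (rule is_kernelI)
  note d = is_kernelD[OF k]
  have "is_iso C x x' \<phi>" using \<psi> by (rule is_isoI)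
  then show "is_mono C k x' (Cmp C k x x' \<phi> i)"
    using is_mono_Cmp[OF d(1) xy(1) x' is_kernel_mono[OF xy k]] is_iso_imp_mono xy(1) x' by blast
  show "Cmp C k x' y (Cmp C x' x y f \<psi>) (Cmp C k x x' \<phi> i) = Zer C k y"
    using xy d x' \<psi> by (simp add: Cmp_reassoc'[OF \<psi>(3)])
  fix w h assume w: "w \<in> Obj C" "h \<in> Hom C w x'" "Cmp C w x' y (Cmp C x' x y f \<psi>) h = Zer C w y"
  obtain u where u: "u \<in> Hom C w k" "Cmp C w k x i u = Cmp C w x' x \<psi> h"
    using is_kernel_factor[OF k w(1), of "Cmp C w x' x \<psi> h"] w xy x' \<psi> by auto
  have "Cmp C w k x' (Cmp C k x x' \<phi> i) u = h"
    using xy d x' \<psi> w u by (simp add: Cmp_reassoc'[OF \<psi>(4)])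
  then show "\<exists>u. u \<in> Hom C w k \<and> Cmp C w k x' (Cmp C k x x' \<phi> i) u = h" using u by blast
qed (use assms is_kernelD[OF k] in auto)

text \<open>The identity of \<open>x\<close> is annihilated by the zero morphism, hence factors
  through \<open>i\<close> and splits it; \<open>i\<close> is also mono.\<close>

lemma kernel_Zer_is_iso:
  assumes xy: "x \<in> Obj C" "y \<in> Obj C" and k: "is_kernel C x y (Zer C x y) k i"
  shows "is_iso C k x i"
proof -
  note d = is_kernelD[OF k]
  obtain u where u: "u \<in> Hom C x k" "Cmp C x k x i u = Idn C x"
    using is_kernel_factor[OF k xy(1), of "Idn C x"] xy by auto
  show ?thesis
  proof (rule is_isoI[OF d(2) u(1) _ u(2)])
    show "Cmp C k x k u i = Idn C k"
      by (rule is_monoD[OF is_kernel_mono[OF xy _ k] d(1)])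
        (use xy d u in \<open>simp_all add: Cmp_reassoc'[OF u(2)]\<close>)
  qed
qed

end

text \<open>This gives an additive inverse by a formula. Applied at every object of a functor
  category it is visibly natural, and an ideal, being closed under scalars, contains it.\<close>

lemma (in linear_category) Add_Scl_minus_one:
  assumes "x \<in> Obj C" "y \<in> Obj C" "f \<in> Hom C x y"
  shows "Scl C x y 0 f = Zer C x y" "Add C x y f (Scl C x y (- 1) f) = Zer C x y"
proof -
  show 0: "Scl C x y 0 f = Zer C x y"
    by (rule Add_right_cancel[of x y _ _ "Scl C x y 0 f"])
      (use assms Scl_plus[of x y f 0 0] in simp_all)
  show "Add C x y f (Scl C x y (- 1) f) = Zer C x y"
    using assms Scl_plus[of x y f 1 "- 1"] 0 by simp
qed

section \<open>The opposite category and duality\<close>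

definition op_lcat :: "('o, 'm, 'k, 'z) lcat_scheme \<Rightarrow> ('o, 'm, 'k) lcat" where
  "op_lcat C = \<lparr>Obj = Obj C, Hom = (\<lambda>x y. Hom C y x), Idn = Idn C,
     Cmp = (\<lambda>x y z g f. Cmp C z y x f g), Zer = (\<lambda>x y. Zer C y x), Add = (\<lambda>x y. Add C y x),
     Scl = (\<lambda>x y. Scl C y x)\<rparr>"

lemma op_lcat_simps [simp]:
  "Obj (op_lcat C) = Obj C" "Hom (op_lcat C) x y = Hom C y x" "Idn (op_lcat C) = Idn C"
  "Cmp (op_lcat C) x y z g f = Cmp C z y x f g" "Zer (op_lcat C) x y = Zer C y x"
  "Add (op_lcat C) x y = Add C y x" "Scl (op_lcat C) x y = Scl C y x"
  by (simp_all add: op_lcat_def)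

lemma op_lcat_duals:
  "is_iso (op_lcat C) x y f \<longleftrightarrow> is_iso C y x f"
  "is_mono (op_lcat C) x y f \<longleftrightarrow> is_epi C y x f"
  "is_epi (op_lcat C) x y f \<longleftrightarrow> is_mono C y x f"
  "is_kernel (op_lcat C) x y f k i \<longleftrightarrow> is_cokernel C y x f k i"
  "is_cokernel (op_lcat C) x y f k i \<longleftrightarrow> is_kernel C y x f k i"
  "is_zero_object (op_lcat C) x \<longleftrightarrow> is_zero_object C x"
  by (auto simp: is_iso_def is_mono_def is_epi_def is_kernel_def is_cokernel_def is_zero_object_def)

lemma (in preadditive_category) preadditive_op_lcat: "preadditive_category (op_lcat C)"
  by unfold_locales
    (auto simp: Add_assoc Cmp_Add_left Cmp_Add_right Add_inverse intro: Add_commute)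

lemma (in abelian_category) abelian_op_lcat: "abelian_category (op_lcat C)"
proof -
  interpret op: preadditive_category "op_lcat C" by (rule preadditive_op_lcat)
  show ?thesis
  proof
    show "\<exists>z. is_zero_object (op_lcat C) z" using ex_zero_object by (simp add: op_lcat_duals)
    fix x y assume xy: "x \<in> Obj (op_lcat C)" "y \<in> Obj (op_lcat C)"
    obtain s i j p q where b: "is_biproduct C x y s i j p q"
      using ex_biproduct[of x y] xy by auto
    then have "is_biproduct (op_lcat C) x y s p q i j" by (simp add: is_biproduct_def)
    then show "\<exists>s i j p q. is_biproduct (op_lcat C) x y s i j p q" by blast
  qed (use ex_kernel ex_cokernel mono_normal epi_normal in \<open>auto simp: op_lcat_duals\<close>)
qed

context preadditive_category
begin

interpretation op: preadditive_category "op_lcat C" by (rule preadditive_op_lcat)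

text \<open>The facts above, read in \<open>op_lcat C\<close>. The premises on objects keep the
  order they have in the opposite category, so the target of a morphism comes before its
  source.\<close>

lemmas is_iso_imp_epi = op.is_iso_imp_mono[simplified, unfolded op_lcat_duals]
  and is_epi_Cmp = op.is_mono_Cmp[simplified, unfolded op_lcat_duals]
  and is_epi_cancel = op.is_mono_cancel[simplified, unfolded op_lcat_duals]
  and is_epi_iff = op.is_mono_iff[simplified, unfolded op_lcat_duals]
  and is_cokernelD = op.is_kernelD[simplified, unfolded op_lcat_duals]
  and is_cokernel_factor = op.is_kernel_factor[simplified, unfolded op_lcat_duals]
  and is_cokernel_epi = op.is_kernel_mono[simplified, unfolded op_lcat_duals]
  and is_cokernelI = op.is_kernelI[simplified, unfolded op_lcat_duals]
  and cokernel_unique_iso = op.kernel_unique_iso[simplified, unfolded op_lcat_duals]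
  and cokernel_postcomp_iso = op.kernel_precomp_iso[simplified, unfolded op_lcat_duals]
  and cokernel_iso_codomain = op.kernel_iso_domain[simplified, unfolded op_lcat_duals]
  and cokernel_Zer_is_iso = op.kernel_Zer_is_iso[simplified, unfolded op_lcat_duals]

end

section \<open>Normal monomorphisms and image factorization\<close>

context abelian_category
begin

text \<open>By normality \<open>f\<close> is the kernel of some \<open>g\<close>, and
  \<open>g\<close> factors through the cokernel \<open>p\<close>. So whatever \<open>p\<close> kills
  is killed by \<open>g\<close> and therefore factors through \<open>f\<close>.\<close>

lemma mono_kernel_of_cokernel:
  assumes xy: "x \<in> Obj C" "y \<in> Obj C" and f: "is_mono C x y f" and c: "is_cokernel C x y f c p"
  shows "is_kernel C y c p x f"
proof -
  have f': "f \<in> Hom C x y" using f by (simp add: is_mono_def)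
  obtain z g where z: "z \<in> Obj C" "g \<in> Hom C y z" and ker: "is_kernel C y z g x f"
    using mono_normal[OF xy f] by blast
  note d = is_cokernelD[OF c]
  obtain v where v: "v \<in> Hom C c z" "Cmp C y c z v p = g"
    using is_cokernel_factor[OF c z] is_kernelD[OF ker] by blast
  show ?thesis
  proof (rule is_kernelI[OF xy(2) d(1) d(2) xy(1) f d(3)])
    fix w h assume w: "w \<in> Obj C" "h \<in> Hom C w y" "Cmp C w y c p h = Zer C w c"
    have "Cmp C w y z g h = Zer C w z"
      using v w xy d z by (metis Cmp_assoc Cmp_Zer_right)
    then show "\<exists>u. u \<in> Hom C w x \<and> Cmp C w x y f u = h"
      using is_kernel_factor[OF ker w(1,2)] by blast
  qed
qed

text \<open>The image is the kernel of the cokernel. What needs work is that \<open>e\<close> is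
  epi: this holds because \<open>n\<close> is the smallest subobject of \<open>y\<close> through
  which \<open>f\<close> factors.\<close>

lemma image_factorization:
  assumes xy: "x \<in> Obj C" "y \<in> Obj C" "f \<in> Hom C x y"
  obtains j e n where "j \<in> Obj C" "is_epi C x j e" "is_mono C j y n" "Cmp C x j y n e = f"
proof -
  obtain c p where c: "is_cokernel C x y f c p" using ex_cokernel[OF xy] by blast
  note dc = is_cokernelD[OF c]
  obtain j n where j: "is_kernel C y c p j n" using ex_kernel[OF xy(2) dc(1,2)] by blast
  note dj = is_kernelD[OF j]
  have n: "is_mono C j y n" using is_kernel_mono[OF xy(2) dc(1,2) j] .
  obtain e where e: "e \<in> Hom C x j" "Cmp C x j y n e = f"
    using is_kernel_factor[OF j xy(1,3)] dc by blast
  have "is_epi C x j e"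
    unfolding is_epi_iff[OF dj(1) xy(1)]
  proof (intro conjI ballI impI)
    show "e \<in> Hom C x j" by fact
    fix r h assume r: "r \<in> Obj C" and h: "h \<in> Hom C j r" and he: "Cmp C x j r h e = Zer C x r"
    \<comment> \<open>Since \<open>h\<close> kills \<open>e\<close>, the morphism \<open>f\<close>
      already factors through the smaller subobject \<open>n\<close> after \<open>m\<close>.
      Minimality of \<open>n\<close> will split \<open>m\<close>, and \<open>h\<close> vanishes on
      \<open>m\<close>.\<close>
    obtain l m where l: "is_kernel C j r h l m" using ex_kernel[OF dj(1) r h] by blast
    note dl = is_kernelD[OF l]
    have m: "is_mono C l j m" using is_kernel_mono[OF dj(1) r h l] .
    obtain e' where e': "e' \<in> Hom C x l" "Cmp C x l j m e' = e"
      using is_kernel_factor[OF l xy(1) e(1) he] .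
    have nm: "is_mono C l y (Cmp C l j y n m)" using is_mono_Cmp[OF dl(1) dj(1) xy(2) m n] .
    have nm': "Cmp C l j y n m \<in> Hom C l y" using dl dj xy by simp
    obtain b d where b: "is_cokernel C l y (Cmp C l j y n m) b d"
      using ex_cokernel[OF dl(1) xy(2) nm'] by blast
    note db = is_cokernelD[OF b]
    have ker: "is_kernel C y b d l (Cmp C l j y n m)"
      using mono_kernel_of_cokernel[OF dl(1) xy(2) nm b] .
    have "f = Cmp C x l y (Cmp C l j y n m) e'" using dl dj xy e e' by simp
    then have "Cmp C x y b d f = Zer C x b"
      using db dl xy e' nm' by (metis Cmp_Zer_left Cmp_assoc)
    \<comment> \<open>The cokernel \<open>d\<close> of the smaller subobject kills \<open>f\<close>,
      so it factors through \<open>p\<close>, and \<open>p\<close> kills \<open>n\<close>; hence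
      \<open>n\<close> lies in the kernel of \<open>d\<close>, which is that smaller
      subobject.\<close>
    then obtain d' where d': "d' \<in> Hom C c b" "Cmp C y c b d' p = d"
      using is_cokernel_factor[OF c db(1,2)] by blast
    have "Cmp C j y b d n = Zer C j b"
      using d' dj dc db xy by (metis Cmp_Zer_right Cmp_assoc)
    then obtain w where w: "w \<in> Hom C j l" "Cmp C j l y (Cmp C l j y n m) w = n"
      using is_kernel_factor[OF ker dj(1,2)] by blast
    have "Cmp C j l j m w = Idn C j"
      by (rule is_monoD[OF n dj(1)]) (use w dj dl xy in simp_all)
    then show "h = Zer C j r"
      using dl dj r h w(1) by (metis Cmp_Idn_right Cmp_assoc Cmp_Zer_left)
  qed
  then show thesis using that dj n e by blast
qed

end

section \<open>Objects of finite length\<close>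

context abelian_category
begin

interpretation op: abelian_category "op_lcat C" by (rule abelian_op_lcat)

lemmas epi_cokernel_of_kernel = op.mono_kernel_of_cokernel[simplified, unfolded op_lcat_duals]

lemma short_exact_middle_iso:
  assumes "x \<in> Obj C" "y \<in> Obj C" "s \<in> Obj C" "y' \<in> Obj C"
    and e: "short_exact C x y s i p"
    and \<phi>: "is_iso C y y' \<phi>"
  obtains i' p' where "short_exact C x y' s i' p'"
proof -
  obtain \<psi> where \<psi>: "\<phi> \<in> Hom C y y'" "\<psi> \<in> Hom C y' y"
    "Cmp C y y' y \<psi> \<phi> = Idn C y" "Cmp C y' y y' \<phi> \<psi> = Idn C y'"
    using \<phi> by (rule is_isoE)
  have ker: "is_kernel C y s p x i" and coker: "is_cokernel C x y i s p"
    using e by (auto simp: short_exact_def)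
  have "short_exact C x y' s (Cmp C x y y' \<phi> i) (Cmp C y' y s p \<psi>)"
    unfolding short_exact_def
    using kernel_iso_domain[OF assms(2,3) _ assms(4) \<psi> ker] is_cokernelD[OF coker]
      cokernel_iso_codomain[OF assms(2,1) _ assms(4) \<psi>(2,1,3,4) coker] is_kernelD[OF ker]
    by blast
  then show thesis by (rule that)
qed

lemma finite_length_in_Obj: "finite_length C x \<Longrightarrow> x \<in> Obj C"
  by (induction rule: finite_length.induct) (auto simp: is_zero_object_def)

text \<open>No induction is required: the isomorphism is absorbed into the middle term of the last
  exact sequence of the series.\<close>

lemma finite_length_iso:
  assumes "finite_length C x" "y \<in> Obj C" "is_iso C x y f"
  shows "finite_length C y"
  using assms(1)
proof cases
  case zero
  then show ?thesis
    using assms zero_object_iso finite_length_in_Obj by (blast intro: finite_length.zero)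
next
  case (step x\<^sub>0 s i p)
  obtain i' p' where "short_exact C x\<^sub>0 y s i' p'"
    using short_exact_middle_iso[OF _ _ _ assms(2) step(4) assms(3)] step
      finite_length_in_Obj by (metis is_simple_def)
  then show ?thesis using step assms(2) by (blast intro: finite_length.step)
qed

text \<open>The common last step for subobjects and quotients: the top factor \<open>j\<close> that
  such an object inherits from a simple \<open>s\<close> is either zero, and then \<open>y\<close>
  is isomorphic to \<open>x\<close>, or a copy of \<open>s\<close>.\<close>

lemma finite_length_extension:
  assumes x: "finite_length C x" and y: "y \<in> Obj C" and j: "j \<in> Obj C"
    and ex: "short_exact C x y j k e"
    and s: "is_simple C s"
    and js: "is_zero_object C j \<or> is_iso C j s n"
  shows "finite_length C y"
proof -
  have x': "x \<in> Obj C" using x by (rule finite_length_in_Obj)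
  have ker: "is_kernel C y j e x k" and coker: "is_cokernel C x y k j e"
    using ex by (auto simp: short_exact_def)
  note dk = is_kernelD[OF ker] and dc = is_cokernelD[OF coker]
  from js show ?thesis
  proof
    assume "is_zero_object C j"
    then have "e = Zer C y j" using zero_object_Hom_eq(2) y j dc(2) Zer_in_Hom by blast
    then have "is_iso C x y k" using kernel_Zer_is_iso[OF y j] ker by blast
    then show ?thesis using finite_length_iso x y by blast
  next
    assume n: "is_iso C j s n"
    have s': "s \<in> Obj C" using s by (simp add: is_simple_def)
    have "short_exact C x y s k (Cmp C y j s n e)"
      unfolding short_exact_def
      using kernel_mono_comp_iff[OF y j dc(2) s' is_iso_imp_mono[OF j s' n]] ker
        cokernel_postcomp_iso[OF y x' dk(2) coker s' n] by blast
    then show ?thesis by (rule finite_length.step[OF x y s])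
  qed
qed

lemma mono_zero_object:
  assumes "x \<in> Obj C" "is_zero_object C z" "is_mono C x z m"
  shows "is_zero_object C x"
proof -
  have z: "z \<in> Obj C" using assms(2) by (simp add: is_zero_object_def)
  have m: "m \<in> Hom C x z" using assms(3) by (simp add: is_mono_def)
  have "Cmp C x x z m (Idn C x) = Cmp C x x z m (Zer C x x)"
    using zero_object_Hom_eq(2)[OF assms(2,1)] m z assms(1) by simp
  then have "Idn C x = Zer C x x"
    using is_monoD[OF assms(3,1)] assms(1) by simp
  then show ?thesis using is_zero_object_iff assms(1) by simp
qed

end

context abelian_category
begin

interpretation op: abelian_category "op_lcat C" by (rule abelian_op_lcat)

lemmas epi_zero_object = op.mono_zero_object[simplified, unfolded op_lcat_duals]

text \<open>Induction along the series of \<open>y\<close>. The image of the subobject in the top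
  factor \<open>s\<close> is zero or all of \<open>s\<close>, and the kernel of the map onto that
  image is a subobject of \<open>x\<close>.\<close>

lemma finite_length_subobject:
  assumes "finite_length C y" "y' \<in> Obj C" "is_mono C y' y m"
  shows "finite_length C y'"
  using assms
proof (induction arbitrary: y' m rule: finite_length.induct)
  case (zero z)
  then show ?case using mono_zero_object by (blast intro: finite_length.zero)
next
  case (step x y s i p)
  note [simp] = finite_length_in_Obj[OF step(1)] step(2) step.prems(1)
  have s [simp]: "s \<in> Obj C" using step(3) by (simp add: is_simple_def)
  have ker: "is_kernel C y s p x i" and coker: "is_cokernel C x y i s p"
    using step(4) by (auto simp: short_exact_def)
  note dk = is_kernelD[OF ker] and dc = is_cokernelD[OF coker]
  have m: "m \<in> Hom C y' y" using step.prems by (simp add: is_mono_def)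
  have pm: "Cmp C y' y s p m \<in> Hom C y' s" using m dc by simp
  obtain j e n where j: "j \<in> Obj C" "is_epi C y' j e" "is_mono C j s n"
    "Cmp C y' j s n e = Cmp C y' y s p m"
    using image_factorization[OF _ _ pm] by auto
  have e: "e \<in> Hom C y' j" using j by (simp add: is_epi_def)
  obtain x' k where k: "is_kernel C y' j e x' k" using ex_kernel[OF _ j(1) e] by auto
  note d = is_kernelD[OF k]
  have "Cmp C x' y s p (Cmp C x' y' y m k) = Cmp C x' j s n (Cmp C x' y' j e k)"
    using Cmp_reassoc[OF j(4)[symmetric], of x' k] d m dc e j(1,3) by (simp add: is_mono_def)
  then have "Cmp C x' y s p (Cmp C x' y' y m k) = Zer C x' s"
    using d j(1,3) by (simp add: is_mono_def)
  \<comment> \<open>Here \<open>x'\<close> is the intersection of \<open>y'\<close> with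
    \<open>x\<close>; the morphism \<open>v\<close> embeds it into \<open>x\<close>, where the
    induction hypothesis applies.\<close>
  then obtain v where v: "v \<in> Hom C x' x" "Cmp C x' x y i v = Cmp C x' y' y m k"
    using is_kernel_factor[OF ker d(1), of "Cmp C x' y' y m k"] d m by auto
  have "is_mono C x' y (Cmp C x' y' y m k)"
    using is_mono_Cmp[OF d(1) _ _ _ step.prems(2)] is_kernel_mono[OF _ j(1) e k] by simp
  then have "is_mono C x' x v"
    using is_mono_cancel[OF d(1) _ _ v(1) dk(2)] v(2) by simp
  then have x': "finite_length C x'" using step.IH d(1) by blast
  have "is_zero_object C j \<or> is_iso C j s n" using step(3) j by (auto simp: is_simple_def)
  moreover have "short_exact C x' y' j k e"
    unfolding short_exact_def
    using k epi_cokernel_of_kernel[OF j(1) _ j(2) k] by simp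
  ultimately show ?case
    using finite_length_extension[OF x' step.prems(1) j(1) _ step(3)] by blast
qed

text \<open>\<open>is_simple\<close> speaks of subobjects only. The kernel of an epi out of
  \<open>s\<close> is zero or all of \<open>s\<close>, which makes the epi an isomorphism or its
  target zero.\<close>

lemma simple_quotient:
  assumes s: "is_simple C s" and t: "t \<in> Obj C" and u: "is_epi C s t u"
  shows "is_zero_object C t \<or> is_iso C s t u"
proof -
  have s': "s \<in> Obj C" using s by (simp add: is_simple_def)
  have u': "u \<in> Hom C s t" using u by (simp add: is_epi_def)
  obtain l m where l: "is_kernel C s t u l m" using ex_kernel[OF s' t u'] by blast
  note d = is_kernelD[OF l]
  have coker: "is_cokernel C l s m t u"
    using epi_cokernel_of_kernel[OF t s' u l] .
  consider "is_zero_object C l" | "is_iso C l s m"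
    using s d(1) is_kernel_mono[OF s' t u' l] by (auto simp: is_simple_def)
  then show ?thesis
  proof cases
    case 1
    then have "m = Zer C l s" using zero_object_Hom_eq(1) s' d Zer_in_Hom by blast
    then show ?thesis using cokernel_Zer_is_iso[OF s' d(1)] coker by blast
  next
    case 2
    then obtain m' where m': "m' \<in> Hom C s l" "Cmp C s l s m m' = Idn C s" by (rule is_isoE)
    then have "u = Zer C s t"
      using d s' t u' by (metis Cmp_Idn_right Cmp_assoc Cmp_Zer_left)
    then have "Idn C t = Zer C t t"
      using is_epiD[OF u t, of "Idn C t" "Zer C t t"] s' t u' by simp
    then show ?thesis using t is_zero_object_iff by simp
  qed
qed

text \<open>The quotient is an extension of a quotient \<open>t\<close> of the simple top factor by
  the image \<open>q'\<close> of \<open>x\<close>, and \<open>q'\<close> has finite length by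
  induction.\<close>

lemma finite_length_quotient:
  assumes "finite_length C y" "q \<in> Obj C" "is_epi C y q e"
  shows "finite_length C q"
  using assms
proof (induction arbitrary: q e rule: finite_length.induct)
  case (zero z)
  then show ?case using epi_zero_object by (blast intro: finite_length.zero)
next
  case (step x y s i p)
  note [simp] = finite_length_in_Obj[OF step(1)] step(2) step.prems(1)
  have s [simp]: "s \<in> Obj C" using step(3) by (simp add: is_simple_def)
  have ker: "is_kernel C y s p x i" and coker: "is_cokernel C x y i s p"
    using step(4) by (auto simp: short_exact_def)
  note dk = is_kernelD[OF ker] and dc = is_cokernelD[OF coker]
  have e: "e \<in> Hom C y q" using step.prems by (simp add: is_epi_def)
  have ei: "Cmp C x y q e i \<in> Hom C x q" using e dk by simp
  obtain q' v k where q': "q' \<in> Obj C" "is_epi C x q' v" "is_mono C q' q k"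
    "Cmp C x q' q k v = Cmp C x y q e i"
    using image_factorization[OF _ _ ei] by auto
  have v: "v \<in> Hom C x q'" and k: "k \<in> Hom C q' q"
    using q' by (auto simp: is_epi_def is_mono_def)
  have flq': "finite_length C q'" using step.IH q'(1,2) by blast
  obtain t c where c: "is_cokernel C q' q k t c" using ex_cokernel[OF q'(1) _ k] by auto
  note d = is_cokernelD[OF c]
  have ex: "short_exact C q' q t k c"
    unfolding short_exact_def using c mono_kernel_of_cokernel[OF q'(1) _ q'(3) c] by simp
  have "Cmp C x y t (Cmp C y q t c e) i = Cmp C x q' t (Cmp C q' q t c k) v"
    using q'(1,4) v k d(1,2) e dk by simp
  then have "Cmp C x y t (Cmp C y q t c e) i = Zer C x t" using d q'(1) v by simp
  then obtain u where u: "u \<in> Hom C s t" "Cmp C y s t u p = Cmp C y q t c e"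
    using is_cokernel_factor[OF coker d(1), of "Cmp C y q t c e"] d e by auto
  have "is_epi C y t (Cmp C y q t c e)"
    using is_epi_Cmp[OF d(1) _ _ is_cokernel_epi[OF _ q'(1) k c] step.prems(2)] by simp
  then have "is_epi C s t u"
    using is_epi_cancel[OF d(1) _ _ u(1) dc(2)] u(2) by simp
  then consider "is_zero_object C t" | "is_iso C s t u"
    using simple_quotient[OF step(3) d(1)] by blast
  then show ?case
  proof cases
    case 1
    then show ?thesis using finite_length_extension[OF flq' _ d(1) ex step(3)] by simp
  next
    case 2
    then obtain u' where "is_iso C t s u'" by (rule is_isoE)
    then show ?thesis using finite_length_extension[OF flq' _ d(1) ex step(3), of u'] by simp
  qed
qed

lemma biproduct_decompose:
  assumes xy: "x \<in> Obj C" "y \<in> Obj C" and b: "is_biproduct C x y s i j p q"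
    and w: "w \<in> Obj C"
  shows "h \<in> Hom C w s \<Longrightarrow> Add C w s (Cmp C w x s i (Cmp C w s x p h))
      (Cmp C w y s j (Cmp C w s y q h)) = h"
    and "h \<in> Hom C s w \<Longrightarrow> Add C s w (Cmp C s x w (Cmp C x s w h i) p)
      (Cmp C s y w (Cmp C y s w h j) q) = h"
proof -
  note b' = b[unfolded is_biproduct_def]
  show "Add C w s (Cmp C w x s i (Cmp C w s x p h)) (Cmp C w y s j (Cmp C w s y q h)) = h"
    if h: "h \<in> Hom C w s"
    using Cmp_Add_left[of w s s h "Cmp C s x s i p" "Cmp C s y s j q"] b' xy w h by simp
  show "Add C s w (Cmp C s x w (Cmp C x s w h i) p) (Cmp C s y w (Cmp C y s w h j) q) = h"
    if h: "h \<in> Hom C s w"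
    using Cmp_Add_right[of s s w "Cmp C s x s i p" "Cmp C s y s j q" h] b' xy w h by simp
qed

lemma biproduct_proj_epi:
  assumes xy: "x \<in> Obj C" "y \<in> Obj C" and b: "is_biproduct C x y s i j p q"
  shows "is_epi C s y q"
  unfolding is_epi_def
proof (intro conjI ballI impI)
  note b' = b[unfolded is_biproduct_def]
  show "q \<in> Hom C s y" using b' by simp
  fix z g h assume "z \<in> Obj C" "g \<in> Hom C y z" "h \<in> Hom C y z"
    and "Cmp C s y z g q = Cmp C s y z h q"
  then show "g = h" using b' xy by (metis Cmp_Idn_right Cmp_assoc)
qed

text \<open>Induction on the length of \<open>y\<close>, with \<open>x\<close> fixed. If
  \<open>y\<close> is an extension of a simple \<open>t\<close> by \<open>y\<^sub>0\<close>, then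
  the biproduct of \<open>x\<close> and \<open>y\<close> is an extension of \<open>t\<close> by the
  biproduct \<open>w\<close> of \<open>x\<close> and \<open>y\<^sub>0\<close>.\<close>

lemma finite_length_biproduct:
  assumes "finite_length C y" "finite_length C x" "is_biproduct C x y s i j p q"
  shows "finite_length C s"
  using assms
proof (induction arbitrary: s i j p q rule: finite_length.induct)
  case (zero z)
  have z [simp]: "z \<in> Obj C" using zero(1) by (simp add: is_zero_object_def)
  have x [simp]: "x \<in> Obj C" using zero(2) by (rule finite_length_in_Obj)
  note b = zero(3)[unfolded is_biproduct_def]
  have "q = Zer C s z" using zero_object_Hom_eq(2)[OF zero(1), of s q "Zer C s z"] b by simp
  then have "Cmp C s x s i p = Idn C s" using b by auto
  then have "is_iso C x s i" using b by (auto intro: is_isoI)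
  then show ?case using finite_length_iso zero(2) b by blast
next
  case (step y\<^sub>0 y t \<iota> \<pi>)
  note [simp] = finite_length_in_Obj[OF step(1)] step(2) finite_length_in_Obj[OF step.prems(1)]
  have t [simp]: "t \<in> Obj C" using step(3) by (simp add: is_simple_def)
  have ker: "is_kernel C y t \<pi> y\<^sub>0 \<iota>" and coker: "is_cokernel C y\<^sub>0 y \<iota> t \<pi>"
    using step(4) by (auto simp: short_exact_def)
  note dk = is_kernelD[OF ker] and dc = is_cokernelD[OF coker]
  note b = step.prems(2)
  note b' = b[unfolded is_biproduct_def]
  obtain w i0 j0 p0 q0 where w: "is_biproduct C x y\<^sub>0 w i0 j0 p0 q0"
    using ex_biproduct[of x y\<^sub>0] by auto
  note w' = w[unfolded is_biproduct_def]
  have flw: "finite_length C w" using step.IH step.prems(1) w by blast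
  have s [simp]: "s \<in> Obj C" "w \<in> Obj C" using b' w' by auto
  have [simp]: "i \<in> Hom C x s" "j \<in> Hom C y s" "p \<in> Hom C s x" "q \<in> Hom C s y"
    "i0 \<in> Hom C x w" "j0 \<in> Hom C y\<^sub>0 w" "p0 \<in> Hom C w x" "q0 \<in> Hom C w y\<^sub>0"
    "\<iota> \<in> Hom C y\<^sub>0 y" "\<pi> \<in> Hom C y t"
    using b' w' dk dc by auto
  have eqs: "Cmp C x s x p i = Idn C x" "Cmp C y s y q j = Idn C y"
     "Cmp C x s y q i = Zer C x y" "Cmp C y s x p j = Zer C y x"
     "Cmp C x w x p0 i0 = Idn C x" "Cmp C y\<^sub>0 w y\<^sub>0 q0 j0 = Idn C y\<^sub>0"
     "Cmp C x w y\<^sub>0 q0 i0 = Zer C x y\<^sub>0" "Cmp C y\<^sub>0 w x p0 j0 = Zer C y\<^sub>0 x"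
     "Cmp C y\<^sub>0 y t \<pi> \<iota> = Zer C y\<^sub>0 t"
    using b' w' dk by auto
  note eqs' = eqs eqs[THEN Cmp_reassoc']
  \<comment> \<open>The direct sum of the identity of \<open>x\<close> and \<iota>; it will be the
    kernel of \<pi> after \<open>q\<close>.\<close>
  define \<omega> where "\<omega> = Add C w s (Cmp C w x s i p0) (Cmp C w y s j (Cmp C w y\<^sub>0 y \<iota> q0))"
  have \<omega> [simp]: "\<omega> \<in> Hom C w s" by (simp add: \<omega>_def)
  have p\<omega>: "Cmp C w s x p \<omega> = p0" and q\<omega>: "Cmp C w s y q \<omega> = Cmp C w y\<^sub>0 y \<iota> q0"
    and \<omega>i: "Cmp C x w s \<omega> i0 = i" and \<omega>j: "Cmp C y\<^sub>0 w s \<omega> j0 = Cmp C y\<^sub>0 y s j \<iota>"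
    by (simp_all add: \<omega>_def Cmp_Add_left Cmp_Add_right eqs')
  have \<omega>0: "Cmp C w s t (Cmp C s y t \<pi> q) \<omega> = Zer C w t"
    by (simp add: q\<omega> eqs')
  have \<iota>: "is_mono C y\<^sub>0 y \<iota>" by (rule is_kernel_mono[OF _ _ _ ker]) auto
  have mono: "is_mono C w s \<omega>"
    unfolding is_mono_iff[OF s(2,1)]
  proof (intro conjI ballI impI)
    fix r h assume r: "r \<in> Obj C" "h \<in> Hom C r w" and 0: "Cmp C r w s \<omega> h = Zer C r s"
    have "Cmp C r w x p0 h = Cmp C r s x p (Cmp C r w s \<omega> h)"
      using r by (simp add: Cmp_reassoc'[OF p\<omega>])
    then have p: "Cmp C r w x p0 h = Zer C r x" using r 0 by simp
    have "Cmp C r y\<^sub>0 y \<iota> (Cmp C r w y\<^sub>0 q0 h) = Cmp C r s y q (Cmp C r w s \<omega> h)"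
      using r by (simp add: Cmp_reassoc'[OF q\<omega>])
    then have "Cmp C r y\<^sub>0 y \<iota> (Cmp C r w y\<^sub>0 q0 h) = Zer C r y" using r 0 by simp
    then have "Cmp C r w y\<^sub>0 q0 h = Zer C r y\<^sub>0" using \<iota> r by (simp add: is_mono_iff)
    then show "h = Zer C r w"
      using biproduct_decompose(1)[OF _ _ w r] p r(1) by simp
  qed simp
  have kernel: "is_kernel C s t (Cmp C s y t \<pi> q) w \<omega>"
  proof (rule is_kernelI[OF s(1) t _ s(2) mono \<omega>0])
    fix r h assume r: "r \<in> Obj C" "h \<in> Hom C r s" "Cmp C r s t (Cmp C s y t \<pi> q) h = Zer C r t"
    obtain v where v: "v \<in> Hom C r y\<^sub>0" "Cmp C r y\<^sub>0 y \<iota> v = Cmp C r s y q h"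
      using is_kernel_factor[OF ker r(1), of "Cmp C r s y q h"] r by auto
    \<comment> \<open>The lift is assembled from the first coordinate of \<open>h\<close> and the
      lift \<open>v\<close> of its second coordinate along \<iota>.\<close>
    let ?u = "Add C r w (Cmp C r x w i0 (Cmp C r s x p h)) (Cmp C r y\<^sub>0 w j0 v)"
    have "Cmp C r w s \<omega> ?u = h"
      using r v biproduct_decompose(1)[OF _ _ b r(1,2)]
      by (simp add: Cmp_Add_right Cmp_reassoc'[OF \<omega>i] Cmp_reassoc'[OF \<omega>j])
    then show "\<exists>u. u \<in> Hom C r w \<and> Cmp C r w s \<omega> u = h"
      using r v by (intro exI[of _ ?u]) simp
  qed simp
  have "is_epi C s t (Cmp C s y t \<pi> q)"
    by (rule is_epi_Cmp) (use is_cokernel_epi[OF _ _ _ coker] biproduct_proj_epi[OF _ _ b] in auto)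
  then have "is_cokernel C w s \<omega> t (Cmp C s y t \<pi> q)"
  proof (rule is_cokernelI[OF s \<omega> t _ \<omega>0])
    fix r h assume r: "r \<in> Obj C" "h \<in> Hom C s r" "Cmp C w s r h \<omega> = Zer C w r"
    have "Cmp C x s r h i = Cmp C x w r (Cmp C w s r h \<omega>) i0"
      using r(1,2) by (simp add: \<omega>i)
    then have hi: "Cmp C x s r h i = Zer C x r" using r by simp
    have "Cmp C y\<^sub>0 y r (Cmp C y s r h j) \<iota> = Cmp C y\<^sub>0 w r (Cmp C w s r h \<omega>) j0"
      using r(1,2) by (simp add: \<omega>j)
    \<comment> \<open>The restriction of \<open>h\<close> to \<open>y\<close> kills \<iota> and so
      descends to \<open>t\<close>; its restriction to \<open>x\<close> is zero, so this determines
      \<open>h\<close>.\<close>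
    then obtain u where u: "u \<in> Hom C t r" "Cmp C y t r u \<pi> = Cmp C y s r h j"
      using is_cokernel_factor[OF coker r(1), of "Cmp C y s r h j"] r by auto
    have "Cmp C s t r u (Cmp C s y t \<pi> q) = Cmp C s y r (Cmp C y s r h j) q"
      using u(1) r(1,2) by (simp add: Cmp_reassoc'[OF u(2)])
    also have "\<dots> = h"
      using biproduct_decompose(2)[OF _ _ b r(1,2)] hi r(1,2) by simp
    finally show "\<exists>u. u \<in> Hom C t r \<and> Cmp C s t r u (Cmp C s y t \<pi> q) = h" using u by blast
  qed
  with kernel have "short_exact C w s t \<omega> (Cmp C s y t \<pi> q)" by (simp add: short_exact_def)
  then show ?case using finite_length.step[OF flw s(1) step(3)] by blast
qed

end

section \<open>Functor categories\<close>

lemma full_subcategory_simps [simp]: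
  "Obj (full_subcategory C S) = Obj C \<inter> S" "Hom (full_subcategory C S) = Hom C"
  "Idn (full_subcategory C S) = Idn C" "Cmp (full_subcategory C S) = Cmp C"
  by (simp_all add: full_subcategory_def)

lemma full_subcategory_linear_simps [simp]:
  "Zer (full_subcategory C S) = Zer C" "Add (full_subcategory C S) = Add C"
  "Scl (full_subcategory C S) = Scl C"
  by (simp_all add: full_subcategory_def)

lemma full_subcategory_Int:
  "full_subcategory (full_subcategory C S) T = full_subcategory C (S \<inter> T)"
  by (simp add: full_subcategory_def Int_assoc)

lemma full_subcategory_UNIV: "full_subcategory C UNIV = C"
  by (simp add: full_subcategory_def)

lemma functor_category_simps [simp]:
  "Obj (functor_category D K) = {F. is_functor D K F}"
  "Hom (functor_category D K) = nat_transf D K"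
  "Idn (functor_category D K) F = (\<lambda>x\<in>Obj D. Idn K (FOb F x))"
  "Cmp (functor_category D K) F G H \<theta> \<eta> =
    (\<lambda>x\<in>Obj D. Cmp K (FOb F x) (FOb G x) (FOb H x) (\<theta> x) (\<eta> x))"
  "Zer (functor_category D K) F G = (\<lambda>x\<in>Obj D. Zer K (FOb F x) (FOb G x))"
  "Add (functor_category D K) F G \<theta> \<eta> = (\<lambda>x\<in>Obj D. Add K (FOb F x) (FOb G x) (\<theta> x) (\<eta> x))"
  "Scl (functor_category D K) F G c \<eta> = (\<lambda>x\<in>Obj D. Scl K (FOb F x) (FOb G x) c (\<eta> x))"
  by (simp_all add: functor_category_def)

lemma is_functorD:
  assumes "is_functor D K F"
  shows "x \<in> Obj D \<Longrightarrow> FOb F x \<in> Obj K"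
    and "\<lbrakk>x \<in> Obj D; y \<in> Obj D; f \<in> Hom D x y\<rbrakk> \<Longrightarrow> FMor F x y f \<in> Hom K (FOb F x) (FOb F y)"
    and "x \<in> Obj D \<Longrightarrow> FMor F x x (Idn D x) = Idn K (FOb F x)"
    and "\<lbrakk>x \<in> Obj D; y \<in> Obj D; z \<in> Obj D; f \<in> Hom D x y; g \<in> Hom D y z\<rbrakk> \<Longrightarrow>
      FMor F x z (Cmp D x y z g f)
        = Cmp K (FOb F x) (FOb F y) (FOb F z) (FMor F y z g) (FMor F x y f)"
  using assms unfolding is_functor_def by (auto simp: PiE_iff)

lemma nat_transfD:
  assumes "\<eta> \<in> nat_transf D K F G"
  shows "x \<in> Obj D \<Longrightarrow> \<eta> x \<in> Hom K (FOb F x) (FOb G x)"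
    and "\<lbrakk>x \<in> Obj D; y \<in> Obj D; f \<in> Hom D x y\<rbrakk> \<Longrightarrow>
      Cmp K (FOb F x) (FOb F y) (FOb G y) (\<eta> y) (FMor F x y f)
        = Cmp K (FOb F x) (FOb G x) (FOb G y) (FMor G x y f) (\<eta> x)"
    and "x \<notin> Obj D \<Longrightarrow> \<eta> x = undefined"
  using assms unfolding nat_transf_def by (auto simp: PiE_iff extensional_def)

lemma restrict_eq_nat_transf:
  assumes "\<theta> \<in> nat_transf D K F G" "\<And>x. x \<in> Obj D \<Longrightarrow> h x = \<theta> x"
  shows "restrict h (Obj D) = \<theta>"
proof
  show "restrict h (Obj D) x = \<theta> x" for x
    using assms(2) nat_transfD(3)[OF assms(1)] by (cases "x \<in> Obj D") auto
qed

lemma restrict_nat_transfI: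
  assumes "\<And>x. x \<in> Obj D \<Longrightarrow> h x \<in> Hom K (FOb F x) (FOb G x)"
    and "\<And>x y f. \<lbrakk>x \<in> Obj D; y \<in> Obj D; f \<in> Hom D x y\<rbrakk> \<Longrightarrow>
      Cmp K (FOb F x) (FOb F y) (FOb G y) (h y) (FMor F x y f)
        = Cmp K (FOb F x) (FOb G x) (FOb G y) (FMor G x y f) (h x)"
  shows "restrict h (Obj D) \<in> nat_transf D K F G"
  using assms unfolding nat_transf_def by auto

text \<open>Builds functors in the normal form demanded by \<open>is_functor\<close>, which fixes
  the values outside the domain.\<close>

definition make_functor ::
  "('p, 'n, 'y) cat_scheme \<Rightarrow> ('p \<Rightarrow> 'o) \<Rightarrow> ('p \<Rightarrow> 'p \<Rightarrow> 'n \<Rightarrow> 'm) \<Rightarrow> ('p, 'n, 'o, 'm) ftor" where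
  "make_functor D ob mor = \<lparr>FOb = restrict ob (Obj D),
     FMor = (\<lambda>x y. if x \<in> Obj D \<and> y \<in> Obj D then restrict (mor x y) (Hom D x y) else (\<lambda>_. undefined))\<rparr>"

lemma make_functor_simps [simp]:
  "x \<in> Obj D \<Longrightarrow> FOb (make_functor D ob mor) x = ob x"
  "\<lbrakk>x \<in> Obj D; y \<in> Obj D; f \<in> Hom D x y\<rbrakk> \<Longrightarrow> FMor (make_functor D ob mor) x y f = mor x y f"
  by (simp_all add: make_functor_def)

lemma (in category) is_functor_make_functor:
  assumes "\<And>x. x \<in> Obj C \<Longrightarrow> ob x \<in> Obj K"
    and "\<And>x y f. \<lbrakk>x \<in> Obj C; y \<in> Obj C; f \<in> Hom C x y\<rbrakk> \<Longrightarrow> mor x y f \<in> Hom K (ob x) (ob y)"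
    and "\<And>x. x \<in> Obj C \<Longrightarrow> mor x x (Idn C x) = Idn K (ob x)"
    and "\<And>x y z f g. \<lbrakk>x \<in> Obj C; y \<in> Obj C; z \<in> Obj C; f \<in> Hom C x y; g \<in> Hom C y z\<rbrakk> \<Longrightarrow>
      mor x z (Cmp C x y z g f) = Cmp K (ob x) (ob y) (ob z) (mor y z g) (mor x y f)"
  shows "is_functor C K (make_functor C ob mor)"
  using assms unfolding is_functor_def by (auto simp: make_functor_def)

locale diagram_category = linear_category K + abelian_category K + D: category D
  for K :: "('o, 'm, 'k :: {comm_ring, comm_monoid_mult}, 'z) lcat_scheme"
    and D :: "('p, 'n, 'y) cat_scheme"
begin


lemmas functor_simps [simp] = is_functorD[where D = D and K = K]

lemmas nat_transf_in_Hom [simp] = nat_transfD(1)[where D = D and K = K]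

lemmas naturality = nat_transfD(2)[where D = D and K = K]

text \<open>Naturality in the right-nested form produced by \<open>Cmp_assoc\<close>.\<close>

lemma Cmp_naturality:
  assumes "\<eta> \<in> nat_transf D K F G" "is_functor D K F" "is_functor D K G"
    and "x \<in> Obj D" "y \<in> Obj D" "f \<in> Hom D x y" "w \<in> Obj K" "h \<in> Hom K w (FOb F x)"
  shows "Cmp K w (FOb F y) (FOb G y) (\<eta> y) (Cmp K w (FOb F x) (FOb F y) (FMor F x y f) h)
    = Cmp K w (FOb G x) (FOb G y) (FMor G x y f) (Cmp K w (FOb F x) (FOb G x) (\<eta> x) h)"
  using Cmp_reassoc[OF naturality[OF assms(1,4,5,6)] assms(7) _ _ _ _ assms(8)] assms by simp

lemma Idn_nat_transf [simp]:
  "is_functor D K F \<Longrightarrow> (\<lambda>x\<in>Obj D. Idn K (FOb F x)) \<in> nat_transf D K F F"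
  by (rule restrict_nat_transfI) simp_all

lemma Cmp_nat_transf [simp]:
  assumes "is_functor D K F" "is_functor D K G" "is_functor D K H"
    and "\<eta> \<in> nat_transf D K F G" "\<theta> \<in> nat_transf D K G H"
  shows "(\<lambda>x\<in>Obj D. Cmp K (FOb F x) (FOb G x) (FOb H x) (\<theta> x) (\<eta> x)) \<in> nat_transf D K F H"
  by (rule restrict_nat_transfI)
    (use assms in \<open>simp_all add: naturality Cmp_naturality\<close>)

lemma Zer_nat_transf [simp]:
  "\<lbrakk>is_functor D K F; is_functor D K G\<rbrakk>
    \<Longrightarrow> (\<lambda>x\<in>Obj D. Zer K (FOb F x) (FOb G x)) \<in> nat_transf D K F G"
  by (rule restrict_nat_transfI) simp_all

lemma Add_nat_transf [simp]:
  assumes "is_functor D K F" "is_functor D K G"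
    and "\<eta> \<in> nat_transf D K F G" "\<theta> \<in> nat_transf D K F G"
  shows "(\<lambda>x\<in>Obj D. Add K (FOb F x) (FOb G x) (\<eta> x) (\<theta> x)) \<in> nat_transf D K F G"
  by (rule restrict_nat_transfI)
    (use assms in \<open>simp_all add: naturality Cmp_Add_left Cmp_Add_right\<close>)

lemma Scl_nat_transf [simp]:
  assumes "is_functor D K F" "is_functor D K G" "\<eta> \<in> nat_transf D K F G"
  shows "(\<lambda>x\<in>Obj D. Scl K (FOb F x) (FOb G x) c (\<eta> x)) \<in> nat_transf D K F G"
  by (rule restrict_nat_transfI)
    (use assms in \<open>simp_all add: naturality Cmp_Scl_left Cmp_Scl_right\<close>)

lemma preadditive_functor_category: "preadditive_category (functor_category D K)"
proof
  show "\<exists>g\<in>Hom (functor_category D K) F G. Add (functor_category D K) F G f g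
      = Zer (functor_category D K) F G"
    if "F \<in> Obj (functor_category D K)" "G \<in> Obj (functor_category D K)"
      "f \<in> Hom (functor_category D K) F G" for F G f
    using that
    by (intro bexI[of _ "Scl (functor_category D K) F G (- 1) f"])
      (auto simp: Add_Scl_minus_one intro!: restrict_ext)
qed (auto simp: Add_assoc Cmp_Add_left Cmp_Add_right intro: Add_commute
      intro!: restrict_ext restrict_eq_nat_transf)

end

definition pointwise_kernel ::
  "('p, 'n, 'y) cat_scheme \<Rightarrow> ('o, 'm, 'k, 'z) lcat_scheme \<Rightarrow> ('p, 'n, 'o, 'm) ftor \<Rightarrow>
   ('p, 'n, 'o, 'm) ftor \<Rightarrow> ('p \<Rightarrow> 'm) \<Rightarrow> ('p, 'n, 'o, 'm) ftor \<Rightarrow> ('p \<Rightarrow> 'm) \<Rightarrow> bool" where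
  "pointwise_kernel D K F G \<eta> k \<iota> \<longleftrightarrow> is_functor D K k \<and> \<iota> \<in> nat_transf D K k F \<and>
     (\<forall>x\<in>Obj D. is_kernel K (FOb F x) (FOb G x) (\<eta> x) (FOb k x) (\<iota> x))"

definition pointwise_cokernel ::
  "('p, 'n, 'y) cat_scheme \<Rightarrow> ('o, 'm, 'k, 'z) lcat_scheme \<Rightarrow> ('p, 'n, 'o, 'm) ftor \<Rightarrow>
   ('p, 'n, 'o, 'm) ftor \<Rightarrow> ('p \<Rightarrow> 'm) \<Rightarrow> ('p, 'n, 'o, 'm) ftor \<Rightarrow> ('p \<Rightarrow> 'm) \<Rightarrow> bool" where
  "pointwise_cokernel D K F G \<eta> c \<pi> \<longleftrightarrow> is_functor D K c \<and> \<pi> \<in> nat_transf D K G c \<and>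
     (\<forall>x\<in>Obj D. is_cokernel K (FOb F x) (FOb G x) (\<eta> x) (FOb c x) (\<pi> x))"

definition pointwise_biproduct ::
  "('p, 'n, 'y) cat_scheme \<Rightarrow> ('o, 'm, 'k, 'z) lcat_scheme \<Rightarrow> ('p, 'n, 'o, 'm) ftor \<Rightarrow>
   ('p, 'n, 'o, 'm) ftor \<Rightarrow> ('p, 'n, 'o, 'm) ftor \<Rightarrow>
   ('p \<Rightarrow> 'm) \<Rightarrow> ('p \<Rightarrow> 'm) \<Rightarrow> ('p \<Rightarrow> 'm) \<Rightarrow> ('p \<Rightarrow> 'm) \<Rightarrow> bool" where
  "pointwise_biproduct D K F G B i j p q \<longleftrightarrow> is_functor D K B \<and>
     i \<in> nat_transf D K F B \<and> j \<in> nat_transf D K G B \<and>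
     p \<in> nat_transf D K B F \<and> q \<in> nat_transf D K B G \<and>
     (\<forall>x\<in>Obj D. is_biproduct K (FOb F x) (FOb G x) (FOb B x) (i x) (j x) (p x) (q x))"

context diagram_category
begin

text \<open>The action of \<open>F\<close> restricts along the monos in at most one way. Cancelling
  them yields the functor laws, so pointwise restrictions can be picked arbitrarily and still fit
  together.\<close>

lemma ex_subfunctor:
  assumes F [simp]: "is_functor D K F"
    and k [simp]: "\<And>x. x \<in> Obj D \<Longrightarrow> k x \<in> Obj K"
    and \<iota>: "\<And>x. x \<in> Obj D \<Longrightarrow> is_mono K (k x) (FOb F x) (\<iota> x)"
    and ex: "\<And>x y f. \<lbrakk>x \<in> Obj D; y \<in> Obj D; f \<in> Hom D x y\<rbrakk> \<Longrightarrow> \<exists>u. u \<in> Hom K (k x) (k y) \<and>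
      Cmp K (k x) (k y) (FOb F y) (\<iota> y) u = Cmp K (k x) (FOb F x) (FOb F y) (FMor F x y f) (\<iota> x)"
  obtains S \<iota>' where "is_functor D K S" "\<iota>' \<in> nat_transf D K S F"
    "\<And>x. x \<in> Obj D \<Longrightarrow> FOb S x = k x" "\<And>x. x \<in> Obj D \<Longrightarrow> \<iota>' x = \<iota> x"
proof -
  define u where "u x y f = (SOME u. u \<in> Hom K (k x) (k y) \<and>
      Cmp K (k x) (k y) (FOb F y) (\<iota> y) u = Cmp K (k x) (FOb F x) (FOb F y) (FMor F x y f) (\<iota> x))"
    for x y f
  have u: "u x y f \<in> Hom K (k x) (k y)"
    "Cmp K (k x) (k y) (FOb F y) (\<iota> y) (u x y f) = Cmp K (k x) (FOb F x) (FOb F y) (FMor F x y f) (\<iota> x)"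
    if "x \<in> Obj D" "y \<in> Obj D" "f \<in> Hom D x y" for x y f
    using someI_ex[OF ex[OF that]] by (auto simp: u_def)
  note [simp] = u(1)
  have [simp]: "\<iota> x \<in> Hom K (k x) (FOb F x)" if "x \<in> Obj D" for x
    using \<iota>[OF that] by (simp add: is_mono_def)
  define S where "S = make_functor D k u"
  have "is_functor D K S"
    unfolding S_def
  proof (rule D.is_functor_make_functor)
    fix x assume [simp]: "x \<in> Obj D"
    show "u x x (Idn D x) = Idn K (k x)"
      by (rule is_monoD[OF \<iota>[of x], of "k x"]) (simp_all add: u)
  next
    fix x y z f g
    assume [simp]: "x \<in> Obj D" "y \<in> Obj D" "z \<in> Obj D" "f \<in> Hom D x y" "g \<in> Hom D y z"
    show "u x z (Cmp D x y z g f) = Cmp K (k x) (k y) (k z) (u y z g) (u x y f)"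
      by (rule is_monoD[OF \<iota>[of z], of "k x"]) (simp_all add: u Cmp_reassoc[OF u(2)])
  qed simp_all
  moreover have "restrict \<iota> (Obj D) \<in> nat_transf D K S F"
    by (rule restrict_nat_transfI) (simp_all add: S_def u)
  ultimately show thesis by (rule that) (simp_all add: S_def)
qed

text \<open>The mirror image: the action of \<open>F\<close> descends along epis in at most one way,
  and cancelling them yields the functor laws.\<close>

lemma ex_quotient_functor:
  assumes F [simp]: "is_functor D K F"
    and c [simp]: "\<And>x. x \<in> Obj D \<Longrightarrow> c x \<in> Obj K"
    and \<pi>: "\<And>x. x \<in> Obj D \<Longrightarrow> is_epi K (FOb F x) (c x) (\<pi> x)"
    and ex: "\<And>x y f. \<lbrakk>x \<in> Obj D; y \<in> Obj D; f \<in> Hom D x y\<rbrakk> \<Longrightarrow> \<exists>u. u \<in> Hom K (c x) (c y) \<and>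
      Cmp K (FOb F x) (c x) (c y) u (\<pi> x) = Cmp K (FOb F x) (FOb F y) (c y) (\<pi> y) (FMor F x y f)"
  obtains Q \<pi>' where "is_functor D K Q" "\<pi>' \<in> nat_transf D K F Q"
    "\<And>x. x \<in> Obj D \<Longrightarrow> FOb Q x = c x" "\<And>x. x \<in> Obj D \<Longrightarrow> \<pi>' x = \<pi> x"
proof -
  define u where "u x y f = (SOME u. u \<in> Hom K (c x) (c y) \<and>
      Cmp K (FOb F x) (c x) (c y) u (\<pi> x) = Cmp K (FOb F x) (FOb F y) (c y) (\<pi> y) (FMor F x y f))"
    for x y f
  have u: "u x y f \<in> Hom K (c x) (c y)"
    "Cmp K (FOb F x) (c x) (c y) (u x y f) (\<pi> x) = Cmp K (FOb F x) (FOb F y) (c y) (\<pi> y) (FMor F x y f)"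
    if "x \<in> Obj D" "y \<in> Obj D" "f \<in> Hom D x y" for x y f
    using someI_ex[OF ex[OF that]] by (auto simp: u_def)
  note [simp] = u(1)
  have [simp]: "\<pi> x \<in> Hom K (FOb F x) (c x)" if "x \<in> Obj D" for x
    using \<pi>[OF that] by (simp add: is_epi_def)
  define Q where "Q = make_functor D c u"
  have "is_functor D K Q"
    unfolding Q_def
  proof (rule D.is_functor_make_functor)
    fix x assume [simp]: "x \<in> Obj D"
    show "u x x (Idn D x) = Idn K (c x)"
      by (rule is_epiD[OF \<pi>[of x], of "c x"]) (simp_all add: u)
  next
    fix x y z f g
    assume [simp]: "x \<in> Obj D" "y \<in> Obj D" "z \<in> Obj D" "f \<in> Hom D x y" "g \<in> Hom D y z"
    show "u x z (Cmp D x y z g f) = Cmp K (c x) (c y) (c z) (u y z g) (u x y f)"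
      by (rule is_epiD[OF \<pi>[of x], of "c z"]) (simp_all add: u Cmp_reassoc[OF u(2)])
  qed simp_all
  moreover have "restrict \<pi> (Obj D) \<in> nat_transf D K F Q"
    by (rule restrict_nat_transfI) (simp_all add: Q_def u)
  ultimately show thesis by (rule that) (simp_all add: Q_def)
qed

text \<open>Kernels are chosen independently at each object. Naturality of \<eta> shows that
  \<open>F\<close> maps the kernel at \<open>x\<close> into the kernel at \<open>y\<close>, which is
  what \<open>ex_subfunctor\<close> asks for.\<close>

lemma ex_pointwise_kernel:
  assumes F [simp]: "is_functor D K F" "is_functor D K G" and \<eta> [simp]: "\<eta> \<in> nat_transf D K F G"
  obtains k \<iota> where "pointwise_kernel D K F G \<eta> k \<iota>"
proof -
  have "\<forall>x\<in>Obj D. \<exists>k. \<exists>\<iota>. is_kernel K (FOb F x) (FOb G x) (\<eta> x) k \<iota>"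
    using ex_kernel by simp
  then obtain k where "\<forall>x\<in>Obj D. \<exists>\<iota>. is_kernel K (FOb F x) (FOb G x) (\<eta> x) (k x) \<iota>"
    by (rule bchoice[THEN exE])
  then obtain \<iota> where k: "\<forall>x\<in>Obj D. is_kernel K (FOb F x) (FOb G x) (\<eta> x) (k x) (\<iota> x)"
    by (rule bchoice[THEN exE])
  note d [simp] = is_kernelD[OF k[rule_format]]
  have mono: "is_mono K (k x) (FOb F x) (\<iota> x)" if "x \<in> Obj D" for x
    using is_kernel_mono[OF _ _ _ k[rule_format, OF that]] that by simp
  have "\<exists>u. u \<in> Hom K (k x) (k y) \<and>
      Cmp K (k x) (k y) (FOb F y) (\<iota> y) u = Cmp K (k x) (FOb F x) (FOb F y) (FMor F x y f) (\<iota> x)"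
    if [simp]: "x \<in> Obj D" "y \<in> Obj D" "f \<in> Hom D x y" for x y f
    by (rule is_kernel_factor[OF k[rule_format], of y "k x"
          "Cmp K (k x) (FOb F x) (FOb F y) (FMor F x y f) (\<iota> x)"])
      (auto simp: Cmp_naturality[OF \<eta>])
  then obtain S \<iota>' where "is_functor D K S" "\<iota>' \<in> nat_transf D K S F"
    "\<And>x. x \<in> Obj D \<Longrightarrow> FOb S x = k x" "\<And>x. x \<in> Obj D \<Longrightarrow> \<iota>' x = \<iota> x"
    using ex_subfunctor[of F k \<iota>] mono F d(1) by blast
  then show thesis using k that[of S \<iota>'] by (simp add: pointwise_kernel_def)
qed

lemma ex_pointwise_cokernel:
  assumes F [simp]: "is_functor D K F" "is_functor D K G" and \<eta> [simp]: "\<eta> \<in> nat_transf D K F G"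
  obtains c \<pi> where "pointwise_cokernel D K F G \<eta> c \<pi>"
proof -
  have "\<forall>x\<in>Obj D. \<exists>c. \<exists>\<pi>. is_cokernel K (FOb F x) (FOb G x) (\<eta> x) c \<pi>"
    using ex_cokernel by simp
  then obtain c where "\<forall>x\<in>Obj D. \<exists>\<pi>. is_cokernel K (FOb F x) (FOb G x) (\<eta> x) (c x) \<pi>"
    by (rule bchoice[THEN exE])
  then obtain \<pi> where c: "\<forall>x\<in>Obj D. is_cokernel K (FOb F x) (FOb G x) (\<eta> x) (c x) (\<pi> x)"
    by (rule bchoice[THEN exE])
  note d [simp] = is_cokernelD[OF c[rule_format]]
  have epi: "is_epi K (FOb G x) (c x) (\<pi> x)" if "x \<in> Obj D" for x
    using is_cokernel_epi[OF _ _ _ c[rule_format, OF that]] that by simp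
  have "\<exists>u. u \<in> Hom K (c x) (c y) \<and>
      Cmp K (FOb G x) (c x) (c y) u (\<pi> x) = Cmp K (FOb G x) (FOb G y) (c y) (\<pi> y) (FMor G x y f)"
    if [simp]: "x \<in> Obj D" "y \<in> Obj D" "f \<in> Hom D x y" for x y f
    by (rule is_cokernel_factor[OF c[rule_format], of x "c y"
          "Cmp K (FOb G x) (FOb G y) (c y) (\<pi> y) (FMor G x y f)"])
      (auto simp: naturality[OF \<eta>, symmetric] Cmp_reassoc'[OF d(3)])
  then obtain Q \<pi>' where "is_functor D K Q" "\<pi>' \<in> nat_transf D K G Q"
    "\<And>x. x \<in> Obj D \<Longrightarrow> FOb Q x = c x" "\<And>x. x \<in> Obj D \<Longrightarrow> \<pi>' x = \<pi> x"
    using ex_quotient_functor[of G c \<pi>] epi F d(1) by blast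
  then show thesis using c that[of Q \<pi>'] by (simp add: pointwise_cokernel_def)
qed

lemma biproduct_reassoc:
  assumes xy: "x \<in> Obj K" "y \<in> Obj K" and b: "is_biproduct K x y s i j p q"
    and w: "w \<in> Obj K"
  shows "h \<in> Hom K w x \<Longrightarrow> Cmp K w s x p (Cmp K w x s i h) = h"
    "h \<in> Hom K w y \<Longrightarrow> Cmp K w s y q (Cmp K w y s j h) = h"
    "h \<in> Hom K w x \<Longrightarrow> Cmp K w s y q (Cmp K w x s i h) = Zer K w y"
    "h \<in> Hom K w y \<Longrightarrow> Cmp K w s x p (Cmp K w y s j h) = Zer K w x"
  using assms unfolding is_biproduct_def
  by (auto simp: Cmp_reassoc'[of x s x] Cmp_reassoc'[of y s y]
      Cmp_reassoc'[of x s y] Cmp_reassoc'[of y s x])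

lemma ex_pointwise_biproduct:
  assumes F [simp]: "is_functor D K F" "is_functor D K G"
  obtains B i j p q where "pointwise_biproduct D K F G B i j p q"
proof -
  \<comment> \<open>The object and its four structure maps are packed into one tuple, so that they
    are chosen together at each \<open>x\<close>.\<close>
  define P where "P x b \<longleftrightarrow> (case b of (s, i, j, p, q) \<Rightarrow> is_biproduct K (FOb F x) (FOb G x) s i j p q)"
    for x b
  have "\<forall>x\<in>Obj D. \<exists>b. P x b"
    using ex_biproduct by (auto simp: P_def)
  then obtain b where Pb: "\<forall>x\<in>Obj D. P x (b x)"
    by (rule bchoice[THEN exE])
  define s where "s x = fst (b x)" for x
  define i where "i x = fst (snd (b x))" for x
  define j where "j x = fst (snd (snd (b x)))" for x
  define p where "p x = fst (snd (snd (snd (b x))))" for x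
  define q where "q x = snd (snd (snd (snd (b x))))" for x
  have b: "is_biproduct K (FOb F x) (FOb G x) (s x) (i x) (j x) (p x) (q x)" if "x \<in> Obj D" for x
    using Pb that by (auto simp: P_def s_def i_def j_def p_def q_def split: prod.splits)
  have [simp]: "s x \<in> Obj K" "i x \<in> Hom K (FOb F x) (s x)" "j x \<in> Hom K (FOb G x) (s x)"
    "p x \<in> Hom K (s x) (FOb F x)" "q x \<in> Hom K (s x) (FOb G x)"
    "Cmp K (FOb F x) (s x) (FOb F x) (p x) (i x) = Idn K (FOb F x)"
    "Cmp K (FOb G x) (s x) (FOb G x) (q x) (j x) = Idn K (FOb G x)"
    "Cmp K (FOb F x) (s x) (FOb G x) (q x) (i x) = Zer K (FOb F x) (FOb G x)"
    "Cmp K (FOb G x) (s x) (FOb F x) (p x) (j x) = Zer K (FOb G x) (FOb F x)"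
    "Add K (s x) (s x) (Cmp K (s x) (FOb F x) (s x) (i x) (p x))
      (Cmp K (s x) (FOb G x) (s x) (j x) (q x)) = Idn K (s x)"
    if "x \<in> Obj D" for x
    using b[OF that] by (auto simp: is_biproduct_def)
  note [simp] = biproduct_reassoc[OF _ _ b]
  \<comment> \<open>The diagonal matrix with entries \<open>FMor F x y f\<close> and
    \<open>FMor G x y f\<close>.\<close>
  define m where "m x y f = Add K (s x) (s y)
      (Cmp K (s x) (FOb F y) (s y) (i y) (Cmp K (s x) (FOb F x) (FOb F y) (FMor F x y f) (p x)))
      (Cmp K (s x) (FOb G y) (s y) (j y) (Cmp K (s x) (FOb G x) (FOb G y) (FMor G x y f) (q x)))"
    for x y f
  define B where "B = make_functor D s m"
  have "is_functor D K B"
    unfolding B_def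
    by (rule D.is_functor_make_functor) (simp_all add: m_def Cmp_Add_left Cmp_Add_right)
  moreover have "restrict i (Obj D) \<in> nat_transf D K F B" "restrict j (Obj D) \<in> nat_transf D K G B"
     "restrict p (Obj D) \<in> nat_transf D K B F" "restrict q (Obj D) \<in> nat_transf D K B G"
    by (rule restrict_nat_transfI; simp add: B_def m_def Cmp_Add_left Cmp_Add_right)+
  moreover have "\<forall>x\<in>Obj D. is_biproduct K (FOb F x) (FOb G x) (FOb B x)
      (restrict i (Obj D) x) (restrict j (Obj D) x) (restrict p (Obj D) x) (restrict q (Obj D) x)"
    by (simp add: b B_def)
  ultimately show thesis using that unfolding pointwise_biproduct_def by blast
qed

lemma ex_pointwise_zero:
  obtains Z where "is_functor D K Z" "\<And>x. x \<in> Obj D \<Longrightarrow> is_zero_object K (FOb Z x)"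
proof -
  obtain z where z: "is_zero_object K z" using ex_zero_object by blast
  then have "z \<in> Obj K" by (simp add: is_zero_object_def)
  then have "is_functor D K (make_functor D (\<lambda>x. z) (\<lambda>x y f. Idn K z))"
    by (intro D.is_functor_make_functor) simp_all
  then show thesis by (rule that) (simp add: z)
qed

end

section \<open>Classes of functors closed under pointwise constructions\<close>

text \<open>Each closure condition quantifies over all pointwise constructions rather than over
  chosen ones. The condition is therefore independent of choices and stable under intersections of
  classes.\<close>

locale pointwise_abelian = diagram_category K D
  for K :: "('o, 'm, 'k :: {comm_ring, comm_monoid_mult}, 'z) lcat_scheme"
    and D :: "('p, 'n, 'y) cat_scheme" +
  fixes S :: "('p, 'n, 'o, 'm) ftor set"
  assumes zero_mem: "\<lbrakk>is_functor D K Z; \<And>x. x \<in> Obj D \<Longrightarrow> is_zero_object K (FOb Z x)\<rbrakk> \<Longrightarrow> Z \<in> S"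
    and biproduct_mem: "\<lbrakk>F \<in> S; G \<in> S; is_functor D K F; is_functor D K G;
        pointwise_biproduct D K F G B i j p q\<rbrakk> \<Longrightarrow> B \<in> S"
    and kernel_mem: "\<lbrakk>F \<in> S; G \<in> S; is_functor D K F; is_functor D K G; \<eta> \<in> nat_transf D K F G;
        pointwise_kernel D K F G \<eta> k \<iota>\<rbrakk> \<Longrightarrow> k \<in> S"
    and cokernel_mem: "\<lbrakk>F \<in> S; G \<in> S; is_functor D K F; is_functor D K G; \<eta> \<in> nat_transf D K F G;
        pointwise_cokernel D K F G \<eta> c \<pi>\<rbrakk> \<Longrightarrow> c \<in> S"
begin

abbreviation FS where "FS \<equiv> full_subcategory (functor_category D K) S"

lemma preadditive_FS: "preadditive_category FS"
proof -
  interpret F: preadditive_category "functor_category D K" by (rule preadditive_functor_category)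
  show ?thesis
    using F.Add_inverse
    by unfold_locales (auto simp: F.Add_assoc F.Cmp_Add_left F.Cmp_Add_right
        simp del: functor_category_simps intro: F.Add_commute)
qed

sublocale FS: preadditive_category FS by (rule preadditive_FS)

text \<open>Factorizations exist and are unique at each object. They are natural because naturality
  may be tested after composing with \<iota>, which is mono at each object.\<close>

lemma pointwise_kernel_is_kernel:
  assumes S: "F \<in> S" "G \<in> S" and F [simp]: "is_functor D K F" "is_functor D K G"
    and \<eta> [simp]: "\<eta> \<in> nat_transf D K F G"
    and k: "pointwise_kernel D K F G \<eta> k \<iota>"
  shows "is_kernel FS F G \<eta> k \<iota>"
proof -
  have ker: "is_kernel K (FOb F x) (FOb G x) (\<eta> x) (FOb k x) (\<iota> x)" if "x \<in> Obj D" for x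
    using k that by (auto simp: pointwise_kernel_def)
  have [simp]: "is_functor D K k" "\<iota> \<in> nat_transf D K k F"
    using k by (auto simp: pointwise_kernel_def)
  have mono: "is_mono K (FOb k x) (FOb F x) (\<iota> x)" if "x \<in> Obj D" for x
    using is_kernel_mono[OF _ _ _ ker[OF that]] that by simp
  show ?thesis
    unfolding is_kernel_def
  proof (intro conjI ballI impI)
    show "k \<in> Obj FS" using kernel_mem[OF S F \<eta> k] by simp
    show "\<iota> \<in> Hom FS k F" by simp
    show "Cmp FS k F G \<eta> \<iota> = Zer FS k G"
      using is_kernelD(3)[OF ker] by (auto intro!: restrict_ext)
    fix W \<theta> assume "W \<in> Obj FS" "\<theta> \<in> Hom FS W F" and 0: "Cmp FS W F G \<eta> \<theta> = Zer FS W G"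
    then have [simp]: "is_functor D K W" "\<theta> \<in> nat_transf D K W F" by auto
    have 0: "Cmp K (FOb W x) (FOb F x) (FOb G x) (\<eta> x) (\<theta> x) = Zer K (FOb W x) (FOb G x)"
      if "x \<in> Obj D" for x
      using fun_cong[OF 0, of x] that by simp
    have "\<forall>x\<in>Obj D. \<exists>u. u \<in> Hom K (FOb W x) (FOb k x) \<and>
        Cmp K (FOb W x) (FOb k x) (FOb F x) (\<iota> x) u = \<theta> x"
      using is_kernel_factor[OF ker _ _ 0] by (metis functor_simps(1) nat_transf_in_Hom
          \<open>is_functor D K W\<close> \<open>\<theta> \<in> nat_transf D K W F\<close>)
    then obtain u where u: "\<And>x. x \<in> Obj D \<Longrightarrow> u x \<in> Hom K (FOb W x) (FOb k x)"
      "\<And>x. x \<in> Obj D \<Longrightarrow> Cmp K (FOb W x) (FOb k x) (FOb F x) (\<iota> x) (u x) = \<theta> x"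
      by (metis bchoice)
    note [simp] = u
    have "restrict u (Obj D) \<in> nat_transf D K W k"
    proof (rule restrict_nat_transfI)
      fix x y f assume [simp]: "x \<in> Obj D" "y \<in> Obj D" "f \<in> Hom D x y"
      show "Cmp K (FOb W x) (FOb W y) (FOb k y) (u y) (FMor W x y f) =
        Cmp K (FOb W x) (FOb k x) (FOb k y) (FMor k x y f) (u x)"
        by (rule is_monoD[OF mono[of y], of "FOb W x"])
          (simp_all add: Cmp_reassoc'[OF u(2)] naturality Cmp_naturality[of \<iota> k F])
    qed simp
    then show "\<exists>!u. u \<in> Hom FS W k \<and> Cmp FS W k F \<iota> u = \<theta>"
    proof (intro ex1I[of _ "restrict u (Obj D)"] conjI)
      show "Cmp FS W k F \<iota> (restrict u (Obj D)) = \<theta>"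
        unfolding full_subcategory_simps functor_category_simps
        by (rule restrict_eq_nat_transf[of \<theta> D K W F]) simp_all
      fix v assume asm: "v \<in> Hom FS W k \<and> Cmp FS W k F \<iota> v = \<theta>"
      then have [simp]: "v \<in> nat_transf D K W k" by simp
      have v: "Cmp K (FOb W x) (FOb k x) (FOb F x) (\<iota> x) (v x) = \<theta> x" if "x \<in> Obj D" for x
        using fun_cong[OF asm[THEN conjunct2], of x] that by simp
      show "v = restrict u (Obj D)"
      proof (rule restrict_eq_nat_transf[of v D K W k, symmetric])
        fix x assume [simp]: "x \<in> Obj D"
        show "u x = v x"
          by (rule is_monoD[OF mono[of x], of "FOb W x"]) (simp_all add: v)
      qed simp
    qed simp
  qed
qed

text \<open>Here naturality of the induced maps is tested after composing first with \<pi>, which is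
  epi at each object.\<close>

lemma pointwise_cokernel_is_cokernel:
  assumes S: "F \<in> S" "G \<in> S" and F [simp]: "is_functor D K F" "is_functor D K G"
    and \<eta> [simp]: "\<eta> \<in> nat_transf D K F G"
    and c: "pointwise_cokernel D K F G \<eta> c \<pi>"
  shows "is_cokernel FS F G \<eta> c \<pi>"
proof -
  have coker: "is_cokernel K (FOb F x) (FOb G x) (\<eta> x) (FOb c x) (\<pi> x)" if "x \<in> Obj D" for x
    using c that by (auto simp: pointwise_cokernel_def)
  have [simp]: "is_functor D K c" "\<pi> \<in> nat_transf D K G c"
    using c by (auto simp: pointwise_cokernel_def)
  have epi: "is_epi K (FOb G x) (FOb c x) (\<pi> x)" if "x \<in> Obj D" for x
    using is_cokernel_epi[OF _ _ _ coker[OF that]] that by simp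
  show ?thesis
    unfolding is_cokernel_def
  proof (intro conjI ballI impI)
    show "c \<in> Obj FS" using cokernel_mem[OF S F \<eta> c] by simp
    show "\<pi> \<in> Hom FS G c" by simp
    show "Cmp FS F G c \<pi> \<eta> = Zer FS F c"
      using is_cokernelD(3)[OF coker] by (auto intro!: restrict_ext)
    fix W \<theta> assume "W \<in> Obj FS" "\<theta> \<in> Hom FS G W" and 0: "Cmp FS F G W \<theta> \<eta> = Zer FS F W"
    then have [simp]: "is_functor D K W" "\<theta> \<in> nat_transf D K G W" by auto
    have 0: "Cmp K (FOb F x) (FOb G x) (FOb W x) (\<theta> x) (\<eta> x) = Zer K (FOb F x) (FOb W x)"
      if "x \<in> Obj D" for x
      using fun_cong[OF 0, of x] that by simp
    have "\<forall>x\<in>Obj D. \<exists>u. u \<in> Hom K (FOb c x) (FOb W x) \<and>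
        Cmp K (FOb G x) (FOb c x) (FOb W x) u (\<pi> x) = \<theta> x"
      using is_cokernel_factor[OF coker _ _ 0] by (metis functor_simps(1) nat_transf_in_Hom
          \<open>is_functor D K W\<close> \<open>\<theta> \<in> nat_transf D K G W\<close>)
    then obtain u where u: "\<And>x. x \<in> Obj D \<Longrightarrow> u x \<in> Hom K (FOb c x) (FOb W x)"
      "\<And>x. x \<in> Obj D \<Longrightarrow> Cmp K (FOb G x) (FOb c x) (FOb W x) (u x) (\<pi> x) = \<theta> x"
      by (metis bchoice)
    note [simp] = u
    have "restrict u (Obj D) \<in> nat_transf D K c W"
    proof (rule restrict_nat_transfI)
      fix x y f assume [simp]: "x \<in> Obj D" "y \<in> Obj D" "f \<in> Hom D x y"
      show "Cmp K (FOb c x) (FOb c y) (FOb W y) (u y) (FMor c x y f) =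
        Cmp K (FOb c x) (FOb W x) (FOb W y) (FMor W x y f) (u x)"
        by (rule is_epiD[OF epi[of x], of "FOb W y"])
          (simp_all add: naturality[of \<pi> G c, symmetric] naturality[of \<theta> G W, symmetric]
            Cmp_reassoc'[OF u(2)])
    qed simp
    then show "\<exists>!u. u \<in> Hom FS c W \<and> Cmp FS G c W u \<pi> = \<theta>"
    proof (intro ex1I[of _ "restrict u (Obj D)"] conjI)
      show "Cmp FS G c W (restrict u (Obj D)) \<pi> = \<theta>"
        unfolding full_subcategory_simps functor_category_simps
        by (rule restrict_eq_nat_transf[of \<theta> D K G W]) simp_all
      fix v assume asm: "v \<in> Hom FS c W \<and> Cmp FS G c W v \<pi> = \<theta>"
      then have [simp]: "v \<in> nat_transf D K c W" by simp
      have v: "Cmp K (FOb G x) (FOb c x) (FOb W x) (v x) (\<pi> x) = \<theta> x" if "x \<in> Obj D" for x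
        using fun_cong[OF asm[THEN conjunct2], of x] that by simp
      show "v = restrict u (Obj D)"
      proof (rule restrict_eq_nat_transf[of v D K c W, symmetric])
        fix x assume [simp]: "x \<in> Obj D"
        show "u x = v x"
          by (rule is_epiD[OF epi[of x], of "FOb W x"]) (simp_all add: v)
      qed simp
    qed simp
  qed
qed

lemma FS_is_iso_pointwise:
  assumes "is_iso FS F G \<phi>" "x \<in> Obj D"
  shows "is_iso K (FOb F x) (FOb G x) (\<phi> x)"
proof -
  obtain \<psi> where \<psi>: "\<phi> \<in> nat_transf D K F G" "\<psi> \<in> nat_transf D K G F"
    "Cmp FS F G F \<psi> \<phi> = Idn FS F" "Cmp FS G F G \<phi> \<psi> = Idn FS G"
    using assms(1) by (auto simp: is_iso_def)
  show ?thesis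
    using assms(2) \<psi>(1,2) fun_cong[OF \<psi>(3), of x] fun_cong[OF \<psi>(4), of x]
    by (intro is_isoI[of _ _ _ "\<psi> x"]) simp_all
qed

text \<open>An arbitrary kernel in \<open>FS\<close> is isomorphic to a pointwise one, and an
  isomorphism in \<open>FS\<close> is one at each object. The right-hand side does not mention
  \<open>S\<close>, so kernels are the same in every such subcategory containing the data.\<close>

lemma is_kernel_FS_iff:
  assumes S: "F \<in> S" "G \<in> S" and F: "is_functor D K F" "is_functor D K G"
    and \<eta>: "\<eta> \<in> nat_transf D K F G"
  shows "is_kernel FS F G \<eta> k \<iota> \<longleftrightarrow> pointwise_kernel D K F G \<eta> k \<iota>"
proof
  assume ker: "is_kernel FS F G \<eta> k \<iota>"
  then have k: "is_functor D K k" "\<iota> \<in> nat_transf D K k F"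
    by (auto simp: is_kernel_def)
  obtain k' \<iota>' where k': "pointwise_kernel D K F G \<eta> k' \<iota>'"
    using ex_pointwise_kernel[OF F \<eta>] .
  obtain \<phi> where \<phi>: "is_iso FS k k' \<phi>" "Cmp FS k k' F \<iota>' \<phi> = \<iota>"
    using FS.kernel_unique_iso[OF _ _ _ ker pointwise_kernel_is_kernel[OF S F \<eta> k']] S F \<eta> by auto
  have "is_kernel K (FOb F x) (FOb G x) (\<eta> x) (FOb k x) (\<iota> x)" if x: "x \<in> Obj D" for x
  proof -
    have "\<iota> x = Cmp K (FOb k x) (FOb k' x) (FOb F x) (\<iota>' x) (\<phi> x)"
      using \<phi>(2) x by auto
    then show ?thesis
      using k' kernel_precomp_iso[OF _ _ _ _ _ FS_is_iso_pointwise[OF \<phi>(1) x]] x F k \<eta>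
      by (simp add: pointwise_kernel_def)
  qed
  then show "pointwise_kernel D K F G \<eta> k \<iota>" using k by (simp add: pointwise_kernel_def)
qed (rule pointwise_kernel_is_kernel[OF assms])

lemma is_cokernel_FS_iff:
  assumes S: "F \<in> S" "G \<in> S" and F: "is_functor D K F" "is_functor D K G"
    and \<eta>: "\<eta> \<in> nat_transf D K F G"
  shows "is_cokernel FS F G \<eta> c \<pi> \<longleftrightarrow> pointwise_cokernel D K F G \<eta> c \<pi>"
proof
  assume coker: "is_cokernel FS F G \<eta> c \<pi>"
  then have c: "is_functor D K c" "\<pi> \<in> nat_transf D K G c"
    by (auto simp: is_cokernel_def)
  obtain c' \<pi>' where c': "pointwise_cokernel D K F G \<eta> c' \<pi>'"
    using ex_pointwise_cokernel[OF F \<eta>] .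
  obtain \<phi> where \<phi>: "is_iso FS c' c \<phi>" "Cmp FS G c' c \<phi> \<pi>' = \<pi>"
    using FS.cokernel_unique_iso[OF _ _ _ coker pointwise_cokernel_is_cokernel[OF S F \<eta> c']] S F \<eta>
    by auto
  have "is_cokernel K (FOb F x) (FOb G x) (\<eta> x) (FOb c x) (\<pi> x)" if x: "x \<in> Obj D" for x
  proof -
    have "\<pi> x = Cmp K (FOb G x) (FOb c' x) (FOb c x) (\<phi> x) (\<pi>' x)"
      using \<phi>(2) x by auto
    then show ?thesis
      using c' cokernel_postcomp_iso[OF _ _ _ _ _ FS_is_iso_pointwise[OF \<phi>(1) x]] x F c \<eta>
      by (simp add: pointwise_cokernel_def)
  qed
  then show "pointwise_cokernel D K F G \<eta> c \<pi>" using c by (simp add: pointwise_cokernel_def)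
qed (rule pointwise_cokernel_is_cokernel[OF assms])

text \<open>A test morphism in \<open>K\<close> need not come from a natural transformation, so the
  mono property in \<open>FS\<close> cannot be evaluated at \<open>x\<close> directly. But the
  pointwise kernel of \<eta> is a kernel in \<open>FS\<close>, so its inclusion is zero, and any
  morphism killed by \<eta> at \<open>x\<close> factors through it.\<close>

lemma is_mono_FS_pointwise:
  assumes S: "F \<in> S" "G \<in> S" and F [simp]: "is_functor D K F" "is_functor D K G"
    and mono: "is_mono FS F G \<eta>" and x [simp]: "x \<in> Obj D"
  shows "is_mono K (FOb F x) (FOb G x) (\<eta> x)"
proof -
  have \<eta> [simp]: "\<eta> \<in> nat_transf D K F G" using mono by (simp add: is_mono_def)
  obtain k \<iota> where k: "pointwise_kernel D K F G \<eta> k \<iota>"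
    using ex_pointwise_kernel[OF F \<eta>] .
  then have ker: "is_kernel K (FOb F x) (FOb G x) (\<eta> x) (FOb k x) (\<iota> x)" and k' [simp]: "is_functor D K k"
    by (auto simp: pointwise_kernel_def)
  have "\<iota> = Zer FS k F"
    using mono FS.is_mono_iff[of F G \<eta>] FS.is_kernelD[OF pointwise_kernel_is_kernel[OF S F \<eta> k]] S
    by simp
  then have 0: "\<iota> x = Zer K (FOb k x) (FOb F x)" by simp
  show ?thesis
    unfolding is_mono_iff[OF functor_simps(1)[OF F(1) x] functor_simps(1)[OF F(2) x]]
  proof (intro conjI ballI impI)
    fix w h assume w: "w \<in> Obj K" "h \<in> Hom K w (FOb F x)"
      "Cmp K w (FOb F x) (FOb G x) (\<eta> x) h = Zer K w (FOb G x)"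
    obtain u where "u \<in> Hom K w (FOb k x)" "Cmp K w (FOb k x) (FOb F x) (\<iota> x) u = h"
      using is_kernel_factor[OF ker w] .
    then show "h = Zer K w (FOb F x)" using 0 w(1) by auto
  qed simp
qed

lemma is_epi_FS_pointwise:
  assumes S: "F \<in> S" "G \<in> S" and F [simp]: "is_functor D K F" "is_functor D K G"
    and epi: "is_epi FS F G \<eta>" and x [simp]: "x \<in> Obj D"
  shows "is_epi K (FOb F x) (FOb G x) (\<eta> x)"
proof -
  have \<eta> [simp]: "\<eta> \<in> nat_transf D K F G" using epi by (simp add: is_epi_def)
  obtain c \<pi> where c: "pointwise_cokernel D K F G \<eta> c \<pi>"
    using ex_pointwise_cokernel[OF F \<eta>] .
  then have coker: "is_cokernel K (FOb F x) (FOb G x) (\<eta> x) (FOb c x) (\<pi> x)"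
    and c' [simp]: "is_functor D K c"
    by (auto simp: pointwise_cokernel_def)
  have "\<pi> = Zer FS G c"
    using epi FS.is_epi_iff[of G F \<eta>] FS.is_cokernelD[OF pointwise_cokernel_is_cokernel[OF S F \<eta> c]] S
    by simp
  then have 0: "\<pi> x = Zer K (FOb G x) (FOb c x)" by simp
  show ?thesis
    unfolding is_epi_iff[OF functor_simps(1)[OF F(2) x] functor_simps(1)[OF F(1) x]]
  proof (intro conjI ballI impI)
    fix w h assume w: "w \<in> Obj K" "h \<in> Hom K (FOb G x) w"
      "Cmp K (FOb F x) (FOb G x) w h (\<eta> x) = Zer K (FOb F x) w"
    obtain u where "u \<in> Hom K (FOb c x) w" "Cmp K (FOb G x) (FOb c x) w u (\<pi> x) = h"
      using is_cokernel_factor[OF coker w] .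
    then show "h = Zer K (FOb G x) w" using 0 w(1) by auto
  qed simp
qed

theorem abelian_FS: "abelian_category FS"
proof
  obtain Z where Z: "is_functor D K Z" "\<And>x. x \<in> Obj D \<Longrightarrow> is_zero_object K (FOb Z x)"
    using ex_pointwise_zero by blast
  have "Idn K (FOb Z x) = Zer K (FOb Z x) (FOb Z x)" if "x \<in> Obj D" for x
    using Z(2)[OF that] by (simp add: is_zero_object_iff)
  then have "Idn FS Z = Zer FS Z Z" by (auto intro: restrict_ext)
  moreover have "Z \<in> Obj FS" using zero_mem[OF Z] Z(1) by simp
  ultimately have "is_zero_object FS Z" by (simp only: FS.is_zero_object_iff)
  then show "\<exists>Z. is_zero_object FS Z" ..
next
  fix F G assume "F \<in> Obj FS" "G \<in> Obj FS"
  then have F [simp]: "F \<in> S" "G \<in> S" "is_functor D K F" "is_functor D K G" by auto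
  show "\<exists>s i j p q. is_biproduct FS F G s i j p q"
  proof -
    obtain B i j p q where B: "pointwise_biproduct D K F G B i j p q"
      using ex_pointwise_biproduct[OF F(3,4)] .
    then have [simp]: "B \<in> S" "is_functor D K B" "i \<in> nat_transf D K F B" "j \<in> nat_transf D K G B"
      "p \<in> nat_transf D K B F" "q \<in> nat_transf D K B G"
      using biproduct_mem[OF F B] by (auto simp: pointwise_biproduct_def)
    have "is_biproduct K (FOb F x) (FOb G x) (FOb B x) (i x) (j x) (p x) (q x)" if "x \<in> Obj D" for x
      using B that by (simp add: pointwise_biproduct_def)
    note b = this[unfolded is_biproduct_def]
    have "is_biproduct FS F G B i j p q"
      unfolding is_biproduct_def
      by (intro conjI; (unfold full_subcategory_simps full_subcategory_linear_simps
            functor_category_simps, (rule restrict_ext)?, simp add: b))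
    then show ?thesis by blast
  qed
  fix \<eta>
  show "\<exists>k \<iota>. is_kernel FS F G \<eta> k \<iota>" if "\<eta> \<in> Hom FS F G"
  proof -
    have \<eta>: "\<eta> \<in> nat_transf D K F G" using that by simp
    obtain k \<iota> where "pointwise_kernel D K F G \<eta> k \<iota>"
      using ex_pointwise_kernel[OF F(3,4) \<eta>] .
    then show ?thesis using pointwise_kernel_is_kernel[OF F \<eta>] by blast
  qed
  show "\<exists>c \<pi>. is_cokernel FS F G \<eta> c \<pi>" if "\<eta> \<in> Hom FS F G"
  proof -
    have \<eta>: "\<eta> \<in> nat_transf D K F G" using that by simp
    obtain c \<pi> where "pointwise_cokernel D K F G \<eta> c \<pi>"
      using ex_pointwise_cokernel[OF F(3,4) \<eta>] .
    then show ?thesis using pointwise_cokernel_is_cokernel[OF F \<eta>] by blast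
  qed
  show "\<exists>H\<in>Obj FS. \<exists>\<theta>\<in>Hom FS G H. is_kernel FS G H \<theta> F \<eta>" if mono: "is_mono FS F G \<eta>"
  proof -
    have \<eta> [simp]: "\<eta> \<in> nat_transf D K F G" using mono by (simp add: is_mono_def)
    obtain c \<pi> where c: "pointwise_cokernel D K F G \<eta> c \<pi>"
      using ex_pointwise_cokernel[OF F(3,4) \<eta>] .
    \<comment> \<open>At each object \<eta> is mono, hence the kernel of its cokernel in
      \<open>K\<close>; so \<eta> itself is a pointwise kernel of \<pi>.\<close>
    then have "pointwise_kernel D K G c \<pi> F \<eta>"
      using mono_kernel_of_cokernel[OF _ _ is_mono_FS_pointwise[OF F mono]]
      by (auto simp: pointwise_kernel_def pointwise_cokernel_def)
    moreover have "c \<in> S" "is_functor D K c" "\<pi> \<in> nat_transf D K G c"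
      using cokernel_mem[OF F \<eta> c] c by (auto simp: pointwise_cokernel_def)
    ultimately show ?thesis using pointwise_kernel_is_kernel[of G c \<pi> F \<eta>] by auto
  qed
  show "\<exists>H\<in>Obj FS. \<exists>\<theta>\<in>Hom FS H F. is_cokernel FS H F \<theta> G \<eta>" if epi: "is_epi FS F G \<eta>"
  proof -
    have \<eta> [simp]: "\<eta> \<in> nat_transf D K F G" using epi by (simp add: is_epi_def)
    obtain k \<iota> where k: "pointwise_kernel D K F G \<eta> k \<iota>"
      using ex_pointwise_kernel[OF F(3,4) \<eta>] .
    then have "pointwise_cokernel D K k F \<iota> G \<eta>"
      using epi_cokernel_of_kernel[OF _ _ is_epi_FS_pointwise[OF F epi]]
      by (auto simp: pointwise_kernel_def pointwise_cokernel_def)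
    moreover have "k \<in> S" "is_functor D K k" "\<iota> \<in> nat_transf D K k F"
      using kernel_mem[OF F \<eta> k] k by (auto simp: pointwise_kernel_def)
    ultimately show ?thesis using pointwise_cokernel_is_cokernel[of k F \<iota> G \<eta>] by auto
  qed
qed

end

section \<open>Exactness of embeddings\<close>

lemma embedding_simps [simp]:
  "x \<in> Obj C \<Longrightarrow> FOb (embedding C) x = x"
  "\<lbrakk>x \<in> Obj C; y \<in> Obj C; f \<in> Hom C x y\<rbrakk> \<Longrightarrow> FMor (embedding C) x y f = f"
  by (simp_all add: embedding_def)

lemma (in preadditive_category) is_additive_functor_embedding:
  "is_additive_functor (full_subcategory C S) C (embedding (full_subcategory C S))"
  unfolding is_additive_functor_def is_functor_def
  by (auto simp: embedding_def)

text \<open>Short exactness is a condition on a kernel and a cokernel; in both subcategories it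
  means exactness at each object of \<open>D\<close>.\<close>

theorem exact_embedding:
  assumes S: "pointwise_abelian K D S" and T: "pointwise_abelian K D T" and ST: "S \<subseteq> T"
  shows "exact_functor (full_subcategory (functor_category D K) S)
    (full_subcategory (functor_category D K) T) (embedding (full_subcategory (functor_category D K) S))"
proof -
  interpret S: pointwise_abelian K D S by fact
  interpret T: pointwise_abelian K D T by fact
  have "S.FS = full_subcategory T.FS S" using ST by (simp add: full_subcategory_Int Int_absorb1)
  then have "is_additive_functor S.FS T.FS (embedding S.FS)"
    using T.FS.is_additive_functor_embedding[of S] by simp
  moreover have "short_exact T.FS F G H \<eta> \<theta>"
    if "F \<in> Obj S.FS" "G \<in> Obj S.FS" "H \<in> Obj S.FS" "\<eta> \<in> Hom S.FS F G" "\<theta> \<in> Hom S.FS G H"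
      "short_exact S.FS F G H \<eta> \<theta>" for F G H \<eta> \<theta>
    using that subsetD[OF ST, of F] subsetD[OF ST, of G] subsetD[OF ST, of H]
      S.is_kernel_FS_iff[of G H \<theta>] T.is_kernel_FS_iff[of G H \<theta>]
      S.is_cokernel_FS_iff[of F G \<eta>] T.is_cokernel_FS_iff[of F G \<eta>]
    by (auto simp: short_exact_def)
  ultimately show ?thesis unfolding exact_functor_def by simp
qed

section \<open>Closed classes: intersections, pointwise finite length functors, linear
  functors\<close>

lemma pointwise_abelian_Int:
  assumes "pointwise_abelian K D S" "pointwise_abelian K D T"
  shows "pointwise_abelian K D (S \<inter> T)"
proof -
  interpret S: pointwise_abelian K D S by fact
  interpret T: pointwise_abelian K D T by fact
  show ?thesis
  proof
    show "Z \<in> S \<inter> T" if "is_functor D K Z" "\<And>x. x \<in> Obj D \<Longrightarrow> is_zero_object K (FOb Z x)" for Z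
      using S.zero_mem T.zero_mem that by blast
    show "B \<in> S \<inter> T" if "F \<in> S \<inter> T" "G \<in> S \<inter> T" "is_functor D K F" "is_functor D K G"
      "pointwise_biproduct D K F G B i j p q" for F G B i j p q
      using S.biproduct_mem T.biproduct_mem that by blast
    show "k \<in> S \<inter> T" if "F \<in> S \<inter> T" "G \<in> S \<inter> T" "is_functor D K F" "is_functor D K G"
      "\<eta> \<in> nat_transf D K F G" "pointwise_kernel D K F G \<eta> k \<iota>" for F G \<eta> k \<iota>
      using S.kernel_mem T.kernel_mem that by blast
    show "c \<in> S \<inter> T" if "F \<in> S \<inter> T" "G \<in> S \<inter> T" "is_functor D K F" "is_functor D K G"
      "\<eta> \<in> nat_transf D K F G" "pointwise_cokernel D K F G \<eta> c \<pi>" for F G \<eta> c \<pi>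
      using S.cokernel_mem T.cokernel_mem that by blast
  qed
qed

context diagram_category
begin

lemma pointwise_abelian_UNIV: "pointwise_abelian K D UNIV"
  by unfold_locales auto

lemma pointwise_abelian_finite_length: "pointwise_abelian K D (pointwise_finite_length K D)"
proof
  show "Z \<in> pointwise_finite_length K D"
    if "\<And>x. x \<in> Obj D \<Longrightarrow> is_zero_object K (FOb Z x)" for Z
    using that by (auto simp: pointwise_finite_length_def intro: finite_length.zero)
next
  fix F G B i j p q
  assume "F \<in> pointwise_finite_length K D" "G \<in> pointwise_finite_length K D"
    and "pointwise_biproduct D K F G B i j p q"
  then have "finite_length K (FOb F x)" "finite_length K (FOb G x)"
    "is_biproduct K (FOb F x) (FOb G x) (FOb B x) (i x) (j x) (p x) (q x)" if "x \<in> Obj D" for x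
    using that by (simp_all add: pointwise_finite_length_def pointwise_biproduct_def)
  then show "B \<in> pointwise_finite_length K D"
    unfolding pointwise_finite_length_def by (blast intro: finite_length_biproduct)
next
  fix F G \<eta>
  assume F: "F \<in> pointwise_finite_length K D" "G \<in> pointwise_finite_length K D"
    "is_functor D K F" "is_functor D K G" "\<eta> \<in> nat_transf D K F G"
  fix k \<iota>
  show "k \<in> pointwise_finite_length K D" if k: "pointwise_kernel D K F G \<eta> k \<iota>"
    unfolding pointwise_finite_length_def
  proof (intro CollectI ballI)
    fix x assume x: "x \<in> Obj D"
    then have ker: "is_kernel K (FOb F x) (FOb G x) (\<eta> x) (FOb k x) (\<iota> x)"
      using k by (simp add: pointwise_kernel_def)
    show "finite_length K (FOb k x)"
      using F x finite_length_subobject[OF _ is_kernelD(1)[OF ker] is_kernel_mono[OF _ _ _ ker]]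
      by (simp add: pointwise_finite_length_def)
  qed
  show "k \<in> pointwise_finite_length K D" if k: "pointwise_cokernel D K F G \<eta> k \<iota>"
    unfolding pointwise_finite_length_def
  proof (intro CollectI ballI)
    fix x assume x: "x \<in> Obj D"
    then have coker: "is_cokernel K (FOb F x) (FOb G x) (\<eta> x) (FOb k x) (\<iota> x)"
      using k by (simp add: pointwise_cokernel_def)
    show "finite_length K (FOb k x)"
      using F x finite_length_quotient[OF _ is_cokernelD(1)[OF coker] is_cokernel_epi[OF _ _ _ coker]]
      by (simp add: pointwise_finite_length_def)
  qed
qed

end

text \<open>The two projections of a biproduct are jointly monic.\<close>

lemma (in abelian_category) biproduct_Hom_eqI:
  assumes xy: "x \<in> Obj C" "y \<in> Obj C" and b: "is_biproduct C x y s i j p q"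
    and w: "w \<in> Obj C" "h \<in> Hom C w s" "h' \<in> Hom C w s"
    and eq: "Cmp C w s x p h = Cmp C w s x p h'" "Cmp C w s y q h = Cmp C w s y q h'"
  shows "h = h'"
  using biproduct_decompose(1)[OF xy b w(1,2)] biproduct_decompose(1)[OF xy b w(1,3)] eq by metis

lemma is_linear_functor_iff:
  "is_linear_functor D K F \<longleftrightarrow> is_functor D K F \<and>
    (\<forall>x\<in>Obj D. \<forall>y\<in>Obj D. \<forall>f\<in>Hom D x y.
      (\<forall>g\<in>Hom D x y. FMor F x y (Add D x y f g) =
        Add K (FOb F x) (FOb F y) (FMor F x y f) (FMor F x y g)) \<and>
      (\<forall>c. FMor F x y (Scl D x y c f) = Scl K (FOb F x) (FOb F y) c (FMor F x y f)))"
  unfolding is_linear_functor_def is_additive_functor_def by blast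

lemma is_linear_functorI:
  assumes "is_functor D K F"
    and "\<And>x y f g. \<lbrakk>x \<in> Obj D; y \<in> Obj D; f \<in> Hom D x y; g \<in> Hom D x y\<rbrakk> \<Longrightarrow>
      FMor F x y (Add D x y f g) = Add K (FOb F x) (FOb F y) (FMor F x y f) (FMor F x y g)"
    and "\<And>x y f c. \<lbrakk>x \<in> Obj D; y \<in> Obj D; f \<in> Hom D x y\<rbrakk> \<Longrightarrow>
      FMor F x y (Scl D x y c f) = Scl K (FOb F x) (FOb F y) c (FMor F x y f)"
  shows "F \<in> {F. is_linear_functor D K F}"
  using assms by (simp add: is_linear_functor_iff)

text \<open>Linearity of a constructed functor is an equation between morphisms. It is tested after
  composing with the biproduct projections, the kernel inclusions or the cokernel projections, where
  naturality turns it into linearity of the given functors. Between zero objects all parallel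
  morphisms agree.\<close>

lemma pointwise_abelian_linear:
  assumes "linear_category K" "abelian_category K" "linear_category D"
  shows "pointwise_abelian K D {M. is_linear_functor D K M}"
proof -
  interpret linear_category K by fact
  interpret abelian_category K by fact
  interpret D: linear_category D by fact
  interpret diagram_category K D by unfold_locales
  note bilinear = Cmp_Add_left Cmp_Add_right Cmp_Scl_left Cmp_Scl_right
  show ?thesis
  proof
    fix Z assume Z [simp]: "is_functor D K Z" and z: "\<And>x. x \<in> Obj D \<Longrightarrow> is_zero_object K (FOb Z x)"
    have "f = g" if "x \<in> Obj D" "y \<in> Obj D" "f \<in> Hom K (FOb Z x) (FOb Z y)"
      "g \<in> Hom K (FOb Z x) (FOb Z y)" for x y f g
      using zero_object_Hom_eq(1)[OF z[OF that(1)] _ that(3,4)] that(2) by simp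
    then show "Z \<in> {M. is_linear_functor D K M}"
      by (simp add: is_linear_functor_iff)
  next
    fix F G B i j p q
    assume "F \<in> {M. is_linear_functor D K M}" "G \<in> {M. is_linear_functor D K M}"
      and "pointwise_biproduct D K F G B i j p q"
    then have [simp]: "is_functor D K F" "is_functor D K G" "is_functor D K B"
      "p \<in> nat_transf D K B F" "q \<in> nat_transf D K B G"
      and F: "is_linear_functor D K F" and G: "is_linear_functor D K G"
      and b: "\<And>x. x \<in> Obj D \<Longrightarrow> is_biproduct K (FOb F x) (FOb G x) (FOb B x) (i x) (j x) (p x) (q x)"
      by (auto simp: is_linear_functor_iff pointwise_biproduct_def)
    note lin = F[unfolded is_linear_functor_iff] G[unfolded is_linear_functor_iff]
    show "B \<in> {M. is_linear_functor D K M}"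
    proof (rule is_linear_functorI)
      fix x y f g d
      assume [simp]: "x \<in> Obj D" "y \<in> Obj D" "f \<in> Hom D x y"
      show "FMor B x y (Scl D x y d f) = Scl K (FOb B x) (FOb B y) d (FMor B x y f)"
        by (rule biproduct_Hom_eqI[OF _ _ b[of y], of "FOb B x"])
          (simp_all add: lin naturality[of p B F] naturality[of q B G] bilinear)
      assume [simp]: "g \<in> Hom D x y"
      show "FMor B x y (Add D x y f g) = Add K (FOb B x) (FOb B y) (FMor B x y f) (FMor B x y g)"
        by (rule biproduct_Hom_eqI[OF _ _ b[of y], of "FOb B x"])
          (simp_all add: lin naturality[of p B F] naturality[of q B G] bilinear)
    qed simp
  next
    fix F G \<eta> k \<iota>
    assume "F \<in> {M. is_linear_functor D K M}" "is_functor D K G" "\<eta> \<in> nat_transf D K F G"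
      and "pointwise_kernel D K F G \<eta> k \<iota>"
    then have [simp]: "is_functor D K F" "is_functor D K G" "is_functor D K k"
      "\<iota> \<in> nat_transf D K k F" "\<eta> \<in> nat_transf D K F G"
      and F: "is_linear_functor D K F"
      and ker: "\<And>x. x \<in> Obj D \<Longrightarrow> is_kernel K (FOb F x) (FOb G x) (\<eta> x) (FOb k x) (\<iota> x)"
      by (auto simp: is_linear_functor_iff pointwise_kernel_def)
    have mono: "is_mono K (FOb k x) (FOb F x) (\<iota> x)" if "x \<in> Obj D" for x
      using is_kernel_mono[OF _ _ _ ker[OF that]] that by simp
    show "k \<in> {M. is_linear_functor D K M}"
    proof (rule is_linear_functorI)
      fix x y f g d
      assume [simp]: "x \<in> Obj D" "y \<in> Obj D" "f \<in> Hom D x y"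
      show "FMor k x y (Scl D x y d f) = Scl K (FOb k x) (FOb k y) d (FMor k x y f)"
        by (rule is_monoD[OF mono[of y], of "FOb k x"])
          (simp_all add: F[unfolded is_linear_functor_iff] naturality[of \<iota> k F] bilinear)
      assume [simp]: "g \<in> Hom D x y"
      show "FMor k x y (Add D x y f g) = Add K (FOb k x) (FOb k y) (FMor k x y f) (FMor k x y g)"
        by (rule is_monoD[OF mono[of y], of "FOb k x"])
          (simp_all add: F[unfolded is_linear_functor_iff] naturality[of \<iota> k F] bilinear)
    qed simp
  next
    fix F G \<eta> c \<pi>
    assume "G \<in> {M. is_linear_functor D K M}" "is_functor D K F" "\<eta> \<in> nat_transf D K F G"
      and "pointwise_cokernel D K F G \<eta> c \<pi>"
    then have [simp]: "is_functor D K F" "is_functor D K G" "is_functor D K c"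
      "\<pi> \<in> nat_transf D K G c" "\<eta> \<in> nat_transf D K F G"
      and G: "is_linear_functor D K G"
      and coker: "\<And>x. x \<in> Obj D \<Longrightarrow> is_cokernel K (FOb F x) (FOb G x) (\<eta> x) (FOb c x) (\<pi> x)"
      by (auto simp: is_linear_functor_iff pointwise_cokernel_def)
    have epi: "is_epi K (FOb G x) (FOb c x) (\<pi> x)" if "x \<in> Obj D" for x
      using is_cokernel_epi[OF _ _ _ coker[OF that]] that by simp
    show "c \<in> {M. is_linear_functor D K M}"
    proof (rule is_linear_functorI)
      fix x y f g d
      assume [simp]: "x \<in> Obj D" "y \<in> Obj D" "f \<in> Hom D x y"
      show "FMor c x y (Scl D x y d f) = Scl K (FOb c x) (FOb c y) d (FMor c x y f)"
        by (rule is_epiD[OF epi[of x], of "FOb c y"])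
          (simp_all add: G[unfolded is_linear_functor_iff] naturality[of \<pi> G c, symmetric] bilinear)
      assume [simp]: "g \<in> Hom D x y"
      show "FMor c x y (Add D x y f g) = Add K (FOb c x) (FOb c y) (FMor c x y f) (FMor c x y g)"
        by (rule is_epiD[OF epi[of x], of "FOb c y"])
          (simp_all add: G[unfolded is_linear_functor_iff] naturality[of \<pi> G c, symmetric] bilinear)
    qed simp
  qed
qed

section \<open>Functors that invert a set of morphisms\<close>

definition inverts ::
  "('o, 'm, 'z) cat_scheme \<Rightarrow> ('p \<times> 'p \<times> 'n) set \<Rightarrow> ('p, 'n, 'o, 'm) ftor \<Rightarrow> bool" where
  "inverts K W M \<longleftrightarrow> (\<forall>(x, y, w)\<in>W. is_iso K (FOb M x) (FOb M y) (FMor M x y w))"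

lemma inverts_subset: "\<lbrakk>inverts K W M; W' \<subseteq> W\<rbrakk> \<Longrightarrow> inverts K W' M"
  by (auto simp: inverts_def)

text \<open>Source and target are recorded in the triple because hom-sets of different pairs may
  overlap.\<close>

definition arrows :: "('p, 'n, 'y) cat_scheme \<Rightarrow> ('p \<times> 'p \<times> 'n) set" where
  "arrows D = {(x, y, f). x \<in> Obj D \<and> y \<in> Obj D \<and> f \<in> Hom D x y}"

context diagram_category
begin

lemma inverts_zero:
  assumes "is_functor D K Z" "\<And>x. x \<in> Obj D \<Longrightarrow> is_zero_object K (FOb Z x)" "W \<subseteq> arrows D"
  shows "inverts K W Z"
  unfolding inverts_def
proof (clarify)
  fix x y w assume "(x, y, w) \<in> W"
  then have "x \<in> Obj D" "y \<in> Obj D" "w \<in> Hom D x y" using assms(3) by (auto simp: arrows_def)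
  then show "is_iso K (FOb Z x) (FOb Z y) (FMor Z x y w)"
    using assms by (intro zero_object_is_iso) simp_all
qed

lemma inverts_biproduct:
  assumes [simp]: "is_functor D K F" "is_functor D K G" and W: "W \<subseteq> arrows D"
    and inv: "inverts K W F" "inverts K W G" and B: "pointwise_biproduct D K F G B i j p q"
  shows "inverts K W B"
  unfolding inverts_def
proof (clarify)
  fix x y w assume w: "(x, y, w) \<in> W"
  then have [simp]: "x \<in> Obj D" "y \<in> Obj D" "w \<in> Hom D x y" using W by (auto simp: arrows_def)
  obtain f where [simp]: "f \<in> Hom K (FOb F y) (FOb F x)"
    and f: "Cmp K (FOb F x) (FOb F y) (FOb F x) f (FMor F x y w) = Idn K (FOb F x)"
      "Cmp K (FOb F y) (FOb F x) (FOb F y) (FMor F x y w) f = Idn K (FOb F y)"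
    using inv(1) w by (fastforce simp: inverts_def is_iso_def)
  obtain g where [simp]: "g \<in> Hom K (FOb G y) (FOb G x)"
    and g: "Cmp K (FOb G x) (FOb G y) (FOb G x) g (FMor G x y w) = Idn K (FOb G x)"
      "Cmp K (FOb G y) (FOb G x) (FOb G y) (FMor G x y w) g = Idn K (FOb G y)"
    using inv(2) w by (fastforce simp: inverts_def is_iso_def)
  have b: "is_biproduct K (FOb F x) (FOb G x) (FOb B x) (i x) (j x) (p x) (q x)" if "x \<in> Obj D" for x
    using B that by (simp add: pointwise_biproduct_def)
  have [simp]: "is_functor D K B" "i \<in> nat_transf D K F B" "j \<in> nat_transf D K G B"
    "p \<in> nat_transf D K B F" "q \<in> nat_transf D K B G"
    using B by (auto simp: pointwise_biproduct_def)
  have d: "Add K (FOb B x) (FOb B x) (Cmp K (FOb B x) (FOb F x) (FOb B x) (i x) (p x))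
      (Cmp K (FOb B x) (FOb G x) (FOb B x) (j x) (q x)) = Idn K (FOb B x)"
      "Cmp K (FOb F x) (FOb B x) (FOb F x) (p x) (i x) = Idn K (FOb F x)"
      "Cmp K (FOb G x) (FOb B x) (FOb G x) (q x) (j x) = Idn K (FOb G x)"
      "Cmp K (FOb F x) (FOb B x) (FOb G x) (q x) (i x) = Zer K (FOb F x) (FOb G x)"
      "Cmp K (FOb G x) (FOb B x) (FOb F x) (p x) (j x) = Zer K (FOb G x) (FOb F x)"
    if "x \<in> Obj D" for x
    using b[OF that] by (simp_all add: is_biproduct_def)
  \<comment> \<open>The diagonal matrix formed from the inverses \<open>f\<close> and
    \<open>g\<close>.\<close>
  let ?h = "Add K (FOb B y) (FOb B x)
    (Cmp K (FOb B y) (FOb F x) (FOb B x) (i x) (Cmp K (FOb B y) (FOb F y) (FOb F x) f (p y)))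
    (Cmp K (FOb B y) (FOb G x) (FOb B x) (j x) (Cmp K (FOb B y) (FOb G y) (FOb G x) g (q y)))"
  note simps = Cmp_Add_left Cmp_Add_right naturality[of p B F] naturality[of q B G]
    naturality[of i F B, symmetric] naturality[of j G B, symmetric]
    Cmp_naturality[of i F B, symmetric] Cmp_naturality[of j G B, symmetric]
    f[THEN Cmp_reassoc'] g[THEN Cmp_reassoc'] d
  show "is_iso K (FOb B x) (FOb B y) (FMor B x y w)"
    by (rule is_isoI[of _ _ _ ?h]) (simp_all add: simps)
qed

text \<open>The inverse on the kernel is the restriction of the inverse \<open>f\<close> of
  \<open>FMor F x y w\<close>. That \<open>f\<close> maps the kernel at \<open>y\<close> into the
  kernel at \<open>x\<close> is checked after applying \<open>FMor G x y w\<close>, which is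
  mono.\<close>

lemma inverts_kernel:
  assumes [simp]: "is_functor D K F" "is_functor D K G" "\<eta> \<in> nat_transf D K F G"
    and W: "W \<subseteq> arrows D" and inv: "inverts K W F" "inverts K W G"
    and k: "pointwise_kernel D K F G \<eta> k \<iota>"
  shows "inverts K W k"
  unfolding inverts_def
proof (clarify)
  fix x y w assume w: "(x, y, w) \<in> W"
  then have [simp]: "x \<in> Obj D" "y \<in> Obj D" "w \<in> Hom D x y" using W by (auto simp: arrows_def)
  obtain f where [simp]: "f \<in> Hom K (FOb F y) (FOb F x)"
    and f: "Cmp K (FOb F x) (FOb F y) (FOb F x) f (FMor F x y w) = Idn K (FOb F x)"
      "Cmp K (FOb F y) (FOb F x) (FOb F y) (FMor F x y w) f = Idn K (FOb F y)"
    using inv(1) w by (fastforce simp: inverts_def is_iso_def)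
  have Gw: "is_mono K (FOb G x) (FOb G y) (FMor G x y w)"
    using inv(2) w by (intro is_iso_imp_mono) (auto simp: inverts_def)
  have [simp]: "is_functor D K k" "\<iota> \<in> nat_transf D K k F"
    using k by (auto simp: pointwise_kernel_def)
  have ker: "is_kernel K (FOb F x) (FOb G x) (\<eta> x) (FOb k x) (\<iota> x)" if "x \<in> Obj D" for x
    using k that by (simp add: pointwise_kernel_def)
  have mono: "is_mono K (FOb k x) (FOb F x) (\<iota> x)" if "x \<in> Obj D" for x
    using is_kernel_mono[OF _ _ _ ker[OF that]] that by simp
  let ?h = "Cmp K (FOb k y) (FOb F y) (FOb F x) f (\<iota> y)"
  have "Cmp K (FOb k y) (FOb F x) (FOb G x) (\<eta> x) ?h = Zer K (FOb k y) (FOb G x)"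
    by (rule is_monoD[OF Gw, of "FOb k y"])
      (simp_all add: Cmp_naturality[of \<eta> F G, symmetric] f[THEN Cmp_reassoc'] is_kernelD(3)[OF ker])
  then obtain u where [simp]: "u \<in> Hom K (FOb k y) (FOb k x)"
    and u: "Cmp K (FOb k y) (FOb k x) (FOb F x) (\<iota> x) u = ?h"
    using is_kernel_factor[OF ker[of x], of "FOb k y" ?h] by auto
  show "is_iso K (FOb k x) (FOb k y) (FMor k x y w)"
  proof (rule is_isoI[of _ _ _ u])
    show "Cmp K (FOb k x) (FOb k y) (FOb k x) u (FMor k x y w) = Idn K (FOb k x)"
      by (rule is_monoD[OF mono[of x], of "FOb k x"])
        (simp_all add: Cmp_reassoc'[OF u] naturality[of \<iota> k F] f[THEN Cmp_reassoc'])
    show "Cmp K (FOb k y) (FOb k x) (FOb k y) (FMor k x y w) u = Idn K (FOb k y)"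
      by (rule is_monoD[OF mono[of y], of "FOb k y"])
        (simp_all add: Cmp_naturality[of \<iota> k F] u f[THEN Cmp_reassoc'])
  qed simp_all
qed

text \<open>The inverse is induced by the inverse \<open>g\<close> of \<open>FMor G x y w\<close>;
  that it descends to the cokernel at \<open>y\<close> is checked after precomposing with the epi
  \<open>FMor F x y w\<close>.\<close>

lemma inverts_cokernel:
  assumes [simp]: "is_functor D K F" "is_functor D K G" "\<eta> \<in> nat_transf D K F G"
    and W: "W \<subseteq> arrows D" and inv: "inverts K W F" "inverts K W G"
    and c: "pointwise_cokernel D K F G \<eta> c \<pi>"
  shows "inverts K W c"
  unfolding inverts_def
proof (clarify)
  fix x y w assume w: "(x, y, w) \<in> W"
  then have [simp]: "x \<in> Obj D" "y \<in> Obj D" "w \<in> Hom D x y" using W by (auto simp: arrows_def)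
  obtain g where [simp]: "g \<in> Hom K (FOb G y) (FOb G x)"
    and g: "Cmp K (FOb G x) (FOb G y) (FOb G x) g (FMor G x y w) = Idn K (FOb G x)"
      "Cmp K (FOb G y) (FOb G x) (FOb G y) (FMor G x y w) g = Idn K (FOb G y)"
    using inv(2) w by (fastforce simp: inverts_def is_iso_def)
  have Fw: "is_epi K (FOb F x) (FOb F y) (FMor F x y w)"
    using inv(1) w by (intro is_iso_imp_epi) (auto simp: inverts_def)
  have [simp]: "is_functor D K c" "\<pi> \<in> nat_transf D K G c"
    using c by (auto simp: pointwise_cokernel_def)
  have coker: "is_cokernel K (FOb F x) (FOb G x) (\<eta> x) (FOb c x) (\<pi> x)" if "x \<in> Obj D" for x
    using c that by (simp add: pointwise_cokernel_def)
  have epi: "is_epi K (FOb G x) (FOb c x) (\<pi> x)" if "x \<in> Obj D" for x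
    using is_cokernel_epi[OF _ _ _ coker[OF that]] that by simp
  let ?h = "Cmp K (FOb G y) (FOb G x) (FOb c x) (\<pi> x) g"
  have "Cmp K (FOb F y) (FOb G y) (FOb c x) ?h (\<eta> y) = Zer K (FOb F y) (FOb c x)"
    by (rule is_epiD[OF Fw, of "FOb c x"])
      (simp_all add: naturality[of \<eta> F G] g[THEN Cmp_reassoc'] is_cokernelD(3)[OF coker])
  then obtain u where [simp]: "u \<in> Hom K (FOb c y) (FOb c x)"
    and u: "Cmp K (FOb G y) (FOb c y) (FOb c x) u (\<pi> y) = ?h"
    using is_cokernel_factor[OF coker[of y], of "FOb c x" ?h] by auto
  show "is_iso K (FOb c x) (FOb c y) (FMor c x y w)"
  proof (rule is_isoI[of _ _ _ u])
    show "Cmp K (FOb c x) (FOb c y) (FOb c x) u (FMor c x y w) = Idn K (FOb c x)"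
      by (rule is_epiD[OF epi[of x], of "FOb c x"])
        (simp_all add: naturality[of \<pi> G c, symmetric] Cmp_reassoc'[OF u] g)
    show "Cmp K (FOb c y) (FOb c x) (FOb c y) (FMor c x y w) u = Idn K (FOb c y)"
      by (rule is_epiD[OF epi[of y], of "FOb c y"])
        (simp_all add: u Cmp_naturality[of \<pi> G c, symmetric] g)
  qed simp_all
qed

text \<open>Directedness is phrased through the functors that invert \<open>W P\<close>, not as an
  inclusion of \<open>W R\<close> in \<open>W P\<close>: in the linear case a refinement can add
  morphisms to be inverted.\<close>

lemma pointwise_abelian_inverts:
  assumes L: "L \<noteq> {}" and W: "\<And>P. P \<in> L \<Longrightarrow> W P \<subseteq> arrows D"
    and dir: "\<And>P Q. \<lbrakk>P \<in> L; Q \<in> L\<rbrakk> \<Longrightarrow> \<exists>R\<in>L. \<forall>M. is_functor D K M \<longrightarrow>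
      inverts K (W P) M \<or> inverts K (W Q) M \<longrightarrow> inverts K (W R) M"
  shows "pointwise_abelian K D {M. \<exists>P\<in>L. inverts K (W P) M}"
proof
  show "Z \<in> {M. \<exists>P\<in>L. inverts K (W P) M}"
    if "is_functor D K Z" "\<And>x. x \<in> Obj D \<Longrightarrow> is_zero_object K (FOb Z x)" for Z
    using inverts_zero[OF that] L W by blast
next
  fix F G assume F: "F \<in> {M. \<exists>P\<in>L. inverts K (W P) M}" "G \<in> {M. \<exists>P\<in>L. inverts K (W P) M}"
    "is_functor D K F" "is_functor D K G"
  then obtain P Q where PQ: "P \<in> L" "Q \<in> L" "inverts K (W P) F" "inverts K (W Q) G" by blast
  from dir[OF PQ(1,2)] obtain R where R: "R \<in> L" "inverts K (W R) F" "inverts K (W R) G"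
    using PQ F by blast
  show "B \<in> {M. \<exists>P\<in>L. inverts K (W P) M}" if "pointwise_biproduct D K F G B i j p q" for B i j p q
    using inverts_biproduct[OF F(3,4) W[OF R(1)] R(2,3) that] R(1) by blast
  fix \<eta> assume \<eta>: "\<eta> \<in> nat_transf D K F G"
  show "k \<in> {M. \<exists>P\<in>L. inverts K (W P) M}" if "pointwise_kernel D K F G \<eta> k \<iota>" for k \<iota>
    using inverts_kernel[OF F(3,4) \<eta> W[OF R(1)] R(2,3) that] R(1) by blast
  show "c \<in> {M. \<exists>P\<in>L. inverts K (W P) M}" if "pointwise_cokernel D K F G \<eta> c \<pi>" for c \<pi>
    using inverts_cokernel[OF F(3,4) \<eta> W[OF R(1)] R(2,3) that] R(1) by blast
qed

end

section \<open>Path categories\<close>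

lemma interval_mapI:
  assumes "continuous_on {0..1} \<phi>" "mono_on {0..1} \<phi>" "\<phi> \<in> {0..1} \<rightarrow> {0..1}"
  shows "interval_map \<phi>"
  unfolding interval_map_def
proof (intro conjI allI impI)
  fix J :: "real set" assume "J \<subseteq> {0..1}" "is_interval J"
  then have "connected (\<phi> ` J)"
    using assms(1) continuous_on_subset
    by (intro connected_continuous_image) (auto simp: is_interval_connected)
  then show "is_interval (\<phi> ` J)" by (simp add: is_interval_connected_1)
qed (use assms in auto)

lemma concat_path_endpoints [simp]:
  "concat_path \<gamma> \<delta> 0 = \<gamma> 0" "concat_path \<gamma> \<delta> 1 = \<delta> 1"
  by (simp_all add: concat_path_def)

lemma const_path_endpoints [simp]: "const_path x 0 = x" "const_path x 1 = x"
  by (simp_all add: const_path_def)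

lemma im_const_path [simp]: "im (const_path x) = {x}"
  by (simp add: im_def const_path_def image_constant_conv)

lemma im_concat_path: "im (concat_path \<gamma> \<delta>) \<subseteq> im \<gamma> \<union> im \<delta>"
  by (auto simp: im_def concat_path_def)

lemma endpoints_in_im: "\<gamma> 0 \<in> im \<gamma>" "\<gamma> 1 \<in> im \<gamma>"
  by (auto simp: im_def)

text \<open>The reparametrization rests at 0 for the first half and then runs through the interval
  at double speed.\<close>

lemma concat_const_left:
  "concat_path (const_path (\<gamma> 0)) \<gamma> = restrict (\<gamma> \<circ> (\<lambda>t. max 0 (2 * t - 1))) {0..1}"
proof
  fix t :: real
  show "concat_path (const_path (\<gamma> 0)) \<gamma> t = restrict (\<gamma> \<circ> (\<lambda>t. max 0 (2 * t - 1))) {0..1} t"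
  proof (cases "t \<le> 1/2")
    case True
    then have "max 0 (2 * t - 1) = 0" by simp
    then show ?thesis using True by (simp add: concat_path_def const_path_def)
  next
    case False
    then have "max 0 (2 * t - 1) = 2 * t - 1" by simp
    then show ?thesis using False by (simp add: concat_path_def)
  qed
qed

lemma concat_const_right:
  "concat_path \<gamma> (const_path (\<gamma> 1)) = restrict (\<gamma> \<circ> (\<lambda>t. min 1 (2 * t))) {0..1}"
proof
  fix t :: real
  show "concat_path \<gamma> (const_path (\<gamma> 1)) t = restrict (\<gamma> \<circ> (\<lambda>t. min 1 (2 * t))) {0..1} t"
  proof (cases "t \<le> 1/2")
    case True
    then have "min 1 (2 * t) = 2 * t" by simp
    then show ?thesis using True by (simp add: concat_path_def)
  next
    case False
    then have "min 1 (2 * t) = 1" by simp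
    then show ?thesis using False by (simp add: concat_path_def const_path_def)
  qed
qed

text \<open>The break points 1/4 and 1/2 of the left bracketing must go to the break points 1/2 and
  3/4 of the right one. The piecewise affine map doing this has slopes 2, 1 and 1/2, so it is
  concave and equals the minimum of its three affine pieces.\<close>

lemma concat_assoc_reparam:
  assumes "\<beta> 1 = \<gamma> 0" "\<alpha> 1 = \<beta> 0"
  shows "concat_path (concat_path \<alpha> \<beta>) \<gamma> =
    restrict (concat_path \<alpha> (concat_path \<beta> \<gamma>) \<circ> (\<lambda>t. min (2 * t) (min (t + 1/4) ((t + 1)/2)))) {0..1}"
proof
  fix t :: real
  consider "t < 0" | "0 \<le> t" "t \<le> 1/4" | "1/4 < t" "t \<le> 1/2" | "1/2 < t" "t \<le> 1" | "1 < t"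
    by linarith
  then show "concat_path (concat_path \<alpha> \<beta>) \<gamma> t = restrict (concat_path \<alpha> (concat_path \<beta> \<gamma>)
      \<circ> (\<lambda>t. min (2 * t) (min (t + 1/4) ((t + 1)/2)))) {0..1} t"
  proof cases
    case 2
    then have "min (2 * t) (min (t + 1/4) ((t + 1)/2)) = 2 * t" by (simp add: min_def)
    then show ?thesis using 2 by (simp add: concat_path_def)
  next
    case 3
    then have "min (2 * t) (min (t + 1/4) ((t + 1)/2)) = t + 1/4" by (simp add: min_def)
    then show ?thesis using 3 by (simp add: concat_path_def algebra_simps)
  next
    case 4
    then have "min (2 * t) (min (t + 1/4) ((t + 1)/2)) = (t + 1)/2" by (simp add: min_def)
    then show ?thesis using 4 by (simp add: concat_path_def field_simps)
  qed (simp_all add: concat_path_def)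
qed

context path_triple
begin

lemma Eqv_in_Paths: "(\<gamma>, \<delta>) \<in> Eqv T \<Longrightarrow> \<gamma> \<in> Paths T \<and> \<delta> \<in> Paths T"
  using equiv_Eqv by (auto simp: equiv_def refl_on_def)

lemma Eqv_refl: "\<gamma> \<in> Paths T \<Longrightarrow> (\<gamma>, \<gamma>) \<in> Eqv T"
  using equiv_Eqv by (auto simp: equiv_def refl_on_def)

lemma Eqv_sym: "(\<gamma>, \<delta>) \<in> Eqv T \<Longrightarrow> (\<delta>, \<gamma>) \<in> Eqv T"
  using equiv_Eqv by (auto simp: equiv_def sym_def)

lemma Eqv_trans: "\<lbrakk>(\<alpha>, \<beta>) \<in> Eqv T; (\<beta>, \<gamma>) \<in> Eqv T\<rbrakk> \<Longrightarrow> (\<alpha>, \<gamma>) \<in> Eqv T"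
  using equiv_Eqv by (auto simp: equiv_def trans_def)

lemma Paths_endpoints: "\<gamma> \<in> Paths T \<Longrightarrow> \<gamma> 0 \<in> Pts T \<and> \<gamma> 1 \<in> Pts T"
  using Paths_subset by (force simp: PiE_iff)

lemma Eqv_const_left:
  assumes "\<gamma> \<in> Paths T" shows "(\<gamma>, concat_path (const_path (\<gamma> 0)) \<gamma>) \<in> Eqv T"
  unfolding concat_const_left
  by (rule Eqv_reparam[OF assms interval_mapI])
    (auto intro!: continuous_intros mono_onI)

lemma Eqv_const_right:
  assumes "\<gamma> \<in> Paths T" shows "(\<gamma>, concat_path \<gamma> (const_path (\<gamma> 1))) \<in> Eqv T"
  unfolding concat_const_right
  by (rule Eqv_reparam[OF assms interval_mapI])
    (auto intro!: continuous_intros mono_onI)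

lemma Eqv_assoc:
  assumes "\<alpha> \<in> Paths T" "\<beta> \<in> Paths T" "\<gamma> \<in> Paths T" "\<alpha> 1 = \<beta> 0" "\<beta> 1 = \<gamma> 0"
  shows "(concat_path \<alpha> (concat_path \<beta> \<gamma>), concat_path (concat_path \<alpha> \<beta>) \<gamma>) \<in> Eqv T"
  unfolding concat_assoc_reparam[of \<beta> \<gamma> \<alpha>, OF assms(5,4)]
proof (rule Eqv_reparam[OF concat_in_Paths interval_mapI])
  let ?\<phi> = "\<lambda>t::real. min (2 * t) (min (t + 1/4) ((t + 1)/2))"
  show "continuous_on {0..1} ?\<phi>" by (intro continuous_intros) auto
  show "mono_on {0..1} ?\<phi>" by (rule mono_onI) (auto simp: min_def)
  show "?\<phi> \<in> {0..1} \<rightarrow> {0..1}" by (auto simp: min_def)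
qed (use assms in \<open>auto simp: concat_in_Paths\<close>)

text \<open>Axiom (f) concatenates on both sides at once. A constant path is put on the free side
  and removed again by reparametrization.\<close>

lemma Eqv_concat_left:
  assumes "(\<gamma>, \<gamma>') \<in> Eqv T" "\<delta> \<in> Paths T" "\<gamma> 1 = \<delta> 0"
  shows "(concat_path \<gamma> \<delta>, concat_path \<gamma>' \<delta>) \<in> Eqv T"
proof -
  let ?c = "const_path (\<gamma> 0)"
  have \<gamma>: "\<gamma> \<in> Paths T" "\<gamma>' \<in> Paths T" "\<gamma>' 0 = \<gamma> 0" "\<gamma>' 1 = \<gamma> 1"
    using assms Eqv_in_Paths Eqv_endpoints by metis+
  then have c: "?c \<in> Paths T" using Paths_endpoints const_in_Paths by blast
  have *: "(concat_path \<beta> \<delta>, concat_path (concat_path ?c \<beta>) \<delta>) \<in> Eqv T"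
    if "\<beta> \<in> Paths T" "\<beta> 0 = \<gamma> 0" "\<beta> 1 = \<delta> 0" for \<beta>
  proof -
    have "concat_path \<beta> \<delta> \<in> Paths T" using concat_in_Paths that assms(2) by blast
    from Eqv_const_left[OF this] have "(concat_path \<beta> \<delta>, concat_path ?c (concat_path \<beta> \<delta>)) \<in> Eqv T"
      using that by simp
    also have "(concat_path ?c (concat_path \<beta> \<delta>), concat_path (concat_path ?c \<beta>) \<delta>) \<in> Eqv T"
      using Eqv_assoc c that assms(2) by simp
    finally (Eqv_trans) show ?thesis .
  qed
  have "(concat_path (concat_path ?c \<gamma>) \<delta>, concat_path (concat_path ?c \<gamma>') \<delta>) \<in> Eqv T"
    using Eqv_concat[of \<gamma> \<gamma>' ?c \<delta>] \<gamma> c assms by (simp add: concat_in_Paths)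
  then show ?thesis
    using *[of \<gamma>] *[of \<gamma>'] \<gamma> assms(3) Eqv_trans Eqv_sym by metis
qed

lemma Eqv_concat_right:
  assumes "(\<gamma>, \<gamma>') \<in> Eqv T" "\<delta> \<in> Paths T" "\<delta> 1 = \<gamma> 0"
  shows "(concat_path \<delta> \<gamma>, concat_path \<delta> \<gamma>') \<in> Eqv T"
proof -
  let ?c = "const_path (\<gamma> 1)"
  have \<gamma>: "\<gamma> \<in> Paths T" "\<gamma>' \<in> Paths T" "\<gamma>' 0 = \<gamma> 0" "\<gamma>' 1 = \<gamma> 1"
    using assms Eqv_in_Paths Eqv_endpoints by metis+
  then have c: "?c \<in> Paths T" using Paths_endpoints const_in_Paths by blast
  have *: "(concat_path \<delta> \<beta>, concat_path (concat_path \<delta> \<beta>) ?c) \<in> Eqv T"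
    if "\<beta> \<in> Paths T" "\<beta> 1 = \<gamma> 1" "\<beta> 0 = \<delta> 1" for \<beta>
    using Eqv_const_right[of "concat_path \<delta> \<beta>"] concat_in_Paths that assms(2) by simp
  have "(concat_path (concat_path \<delta> \<gamma>) ?c, concat_path (concat_path \<delta> \<gamma>') ?c) \<in> Eqv T"
    using Eqv_concat[of \<gamma> \<gamma>' \<delta> ?c] \<gamma> c assms by (simp add: concat_in_Paths)
  then show ?thesis
    using *[of \<gamma>] *[of \<gamma>'] \<gamma> assms(3) Eqv_trans Eqv_sym by metis
qed

lemma Eqv_concat_cong:
  assumes "(\<gamma>, \<gamma>') \<in> Eqv T" "(\<delta>, \<delta>') \<in> Eqv T" "\<gamma> 1 = \<delta> 0"
  shows "(concat_path \<gamma> \<delta>, concat_path \<gamma>' \<delta>') \<in> Eqv T"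
  using Eqv_concat_left[OF assms(1), of \<delta>] Eqv_concat_right[OF assms(2), of \<gamma>'] assms
  by (metis Eqv_endpoints Eqv_in_Paths Eqv_trans)

lemma path_class_eq_iff:
  assumes "\<gamma> \<in> Paths T" "\<delta> \<in> Paths T"
  shows "path_class T \<gamma> = path_class T \<delta> \<longleftrightarrow> (\<gamma>, \<delta>) \<in> Eqv T"
  unfolding path_class_def using eq_equiv_class_iff[OF equiv_Eqv assms] .

lemma path_class_eqI: "(\<gamma>, \<delta>) \<in> Eqv T \<Longrightarrow> path_class T \<gamma> = path_class T \<delta>"
  using path_class_eq_iff Eqv_in_Paths by blast

lemma path_category_simps [simp]:
  "Obj (path_category T) = Pts T" "Idn (path_category T) x = path_class T (const_path x)"
  by (simp_all add: path_category_def)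

lemma path_category_Hom:
  "Hom (path_category T) x y = {path_class T \<gamma> | \<gamma>. \<gamma> \<in> Paths T \<and> \<gamma> 0 = x \<and> \<gamma> 1 = y}"
  by (simp add: path_category_def)

lemma path_class_in_Hom [simp]:
  "\<lbrakk>\<gamma> \<in> Paths T; \<gamma> 0 = x; \<gamma> 1 = y\<rbrakk> \<Longrightarrow> path_class T \<gamma> \<in> Hom (path_category T) x y"
  by (auto simp: path_category_Hom)

text \<open>All concatenations of representatives are equivalent, so the union defining the
  composite is a union of copies of one class.\<close>

lemma Cmp_path_class [simp]:
  assumes "\<gamma> \<in> Paths T" "\<delta> \<in> Paths T" "\<gamma> 1 = \<delta> 0"
  shows "Cmp (path_category T) x y z (path_class T \<delta>) (path_class T \<gamma>) = path_class T (concat_path \<gamma> \<delta>)"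
proof -
  have "path_class T (concat_path \<gamma>' \<delta>') = path_class T (concat_path \<gamma> \<delta>)"
    if "\<gamma>' \<in> path_class T \<gamma>" "\<delta>' \<in> path_class T \<delta>" for \<gamma>' \<delta>'
    using that assms(3) Eqv_concat_cong by (auto simp: path_class_def[of T \<gamma>] path_class_def[of T \<delta>]
        intro!: path_class_eqI[symmetric])
  moreover have "\<gamma> \<in> path_class T \<gamma>" "\<delta> \<in> path_class T \<delta>"
    using assms Eqv_refl by (auto simp: path_class_def)
  ultimately have "(\<Union>\<gamma>'\<in>path_class T \<delta>. \<Union>\<gamma>\<in>path_class T \<gamma>. path_class T (concat_path \<gamma> \<gamma>'))
    = path_class T (concat_path \<gamma> \<delta>)"
    by blast
  then show ?thesis by (simp add: path_category_def)
qed

lemma category_path_category: "category (path_category T)"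
proof
  fix w x y z f g h
  assume f: "f \<in> Hom (path_category T) w x" and g: "g \<in> Hom (path_category T) x y"
    and h: "h \<in> Hom (path_category T) y z"
  then obtain \<alpha> \<beta> \<gamma> where "\<alpha> \<in> Paths T" "\<beta> \<in> Paths T" "\<gamma> \<in> Paths T" "\<alpha> 1 = \<beta> 0" "\<beta> 1 = \<gamma> 0"
    "f = path_class T \<alpha>" "g = path_class T \<beta>" "h = path_class T \<gamma>"
    by (auto simp: path_category_Hom)
  then show "Cmp (path_category T) w x z (Cmp (path_category T) x y z h g) f =
    Cmp (path_category T) w y z h (Cmp (path_category T) w x y g f)"
    using path_class_eqI[OF Eqv_assoc, of \<alpha> \<beta> \<gamma>] by (simp add: concat_in_Paths)
next
  fix x y f assume "f \<in> Hom (path_category T) x y"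
  then obtain \<gamma> where \<gamma>: "\<gamma> \<in> Paths T" "\<gamma> 0 = x" "\<gamma> 1 = y" "f = path_class T \<gamma>"
    by (auto simp: path_category_Hom)
  then have "x \<in> Pts T" "y \<in> Pts T" using Paths_endpoints by auto
  then show "Cmp (path_category T) x x y f (Idn (path_category T) x) = f"
    "Cmp (path_category T) x y y (Idn (path_category T) y) f = f"
    using \<gamma> path_class_eqI[OF Eqv_const_left[OF \<gamma>(1)], symmetric]
      path_class_eqI[OF Eqv_const_right[OF \<gamma>(1)], symmetric]
    by (simp_all add: const_in_Paths)
next
  fix x y z f g
  assume "f \<in> Hom (path_category T) x y" "g \<in> Hom (path_category T) y z"
  then show "Cmp (path_category T) x y z g f \<in> Hom (path_category T) x z"
    by (auto simp: path_category_Hom[of x y] path_category_Hom[of y z] concat_in_Paths)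
next
  fix x assume "x \<in> Obj (path_category T)"
  then show "Idn (path_category T) x \<in> Hom (path_category T) x x"
    by (simp add: const_in_Paths)
qed

end

section \<open>Free modules and bilinear extension\<close>

abbreviation "keys \<equiv> Poly_Mapping.keys"

abbreviation "lookup \<equiv> Poly_Mapping.lookup"

abbreviation "single \<equiv> Poly_Mapping.single"

text \<open>The bound \<open>H\<close> on the support lets an induction assume that all basis
  elements lie in a given hom-set. It rests on writing \<open>f\<close> as the sum of its
  monomials.\<close>

lemma poly_mapping_induct_keys [consumes 1, case_names zero single add]:
  fixes f :: "'a \<Rightarrow>\<^sub>0 'b :: comm_monoid_add"
  assumes f: "keys f \<subseteq> H"
    and "P 0" "\<And>k c. k \<in> H \<Longrightarrow> P (single k c)"
    and add: "\<And>f g. \<lbrakk>keys f \<subseteq> H; keys g \<subseteq> H; P f; P g\<rbrakk> \<Longrightarrow> P (f + g)"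
  shows "P f"
proof -
  let ?s = "\<lambda>A. \<Sum>k\<in>A. single k (lookup f k)"
  have "P (?s A) \<and> keys (?s A) \<subseteq> H" if "finite A" "A \<subseteq> H" for A
    using that
  proof (induction A)
    case (insert a A)
    moreover have "keys (single a (lookup f a)) \<subseteq> H"
      using insert.prems by (simp add: keys_single)
    ultimately show ?case
      using assms(3) by (auto intro!: add dest!: subsetD[OF Poly_Mapping.keys_add])
  qed (use assms(2) in auto)
  moreover have "?s (keys f) = f"
  proof (rule poly_mapping_eqI)
    fix k
    have "lookup (?s (keys f)) k =
      (\<Sum>l\<in>keys f. if l = k then lookup f l else 0)"
      by (simp add: lookup_sum lookup_single when_def)
    also have "\<dots> = lookup f k"
      by (simp add: not_in_keys_iff_lookup_eq_zero)
    finally show "lookup (?s (keys f)) k = lookup f k" .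
  qed
  ultimately show ?thesis using f by (metis finite_keys)
qed

text \<open>The composition of the linear path category with the composition of basis elements left
  abstract as \<open>c\<close>, so that its algebra can be done without paths.\<close>

definition bilinear_ext ::
  "('b \<Rightarrow> 'a \<Rightarrow> 'c) \<Rightarrow> ('b \<Rightarrow>\<^sub>0 'k) \<Rightarrow> ('a \<Rightarrow>\<^sub>0 'k) \<Rightarrow> 'c \<Rightarrow>\<^sub>0 'k :: {comm_ring, comm_monoid_mult}" where
  "bilinear_ext c g f = (\<Sum>q\<in>keys g. \<Sum>p\<in>keys f.
     single (c q p) (lookup g q * lookup f p))"

text \<open>Terms outside the supports have coefficient 0. Enlarging the index sets gives sums such
  as \<open>g + h\<close> the same index set as their summands.\<close>

lemma bilinear_ext_superset:
  assumes "finite B" "keys g \<subseteq> B" "finite A" "keys f \<subseteq> A"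
  shows "bilinear_ext c g f = (\<Sum>q\<in>B. \<Sum>p\<in>A.
     single (c q p) (lookup g q * lookup f p))"
proof -
  have "bilinear_ext c g f = (\<Sum>q\<in>keys g. \<Sum>p\<in>A.
     single (c q p) (lookup g q * lookup f p))"
    unfolding bilinear_ext_def
    by (intro sum.cong sum.mono_neutral_left) (use assms in \<open>auto simp: in_keys_iff\<close>)
  also have "\<dots> = (\<Sum>q\<in>B. \<Sum>p\<in>A.
     single (c q p) (lookup g q * lookup f p))"
    by (intro sum.mono_neutral_left) (use assms in \<open>auto simp: in_keys_iff\<close>)
  finally show ?thesis .
qed

lemma bilinear_ext_0 [simp]: "bilinear_ext c 0 f = 0" "bilinear_ext c g 0 = 0"
  by (simp_all add: bilinear_ext_def)

lemma bilinear_ext_single [simp]: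
  "bilinear_ext c (single q b) (single p a) = single (c q p) (b * a)"
  by (subst bilinear_ext_superset[of "{q}" _ "{p}"]) auto

lemma bilinear_ext_add_left:
  "bilinear_ext c (g + h) f = bilinear_ext c g f + bilinear_ext c h f"
proof -
  let ?B = "keys g \<union> keys h"
  have *: "bilinear_ext c u f = (\<Sum>q\<in>?B. \<Sum>p\<in>keys f.
      single (c q p) (lookup u q * lookup f p))"
    if "keys u \<subseteq> ?B" for u
    using that by (intro bilinear_ext_superset) auto
  show ?thesis
    using Poly_Mapping.keys_add[of g h]
    by (simp add: * lookup_add distrib_right single_add sum.distrib)
qed

lemma bilinear_ext_add_right:
  "bilinear_ext c g (f + h) = bilinear_ext c g f + bilinear_ext c g h"
proof -
  let ?A = "keys f \<union> keys h"
  have *: "bilinear_ext c g u = (\<Sum>q\<in>keys g. \<Sum>p\<in>?A.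
      single (c q p) (lookup g q * lookup u p))"
    if "keys u \<subseteq> ?A" for u
    using that by (intro bilinear_ext_superset) auto
  show ?thesis
    using Poly_Mapping.keys_add[of f h]
    by (simp add: * lookup_add distrib_left single_add sum.distrib)
qed

lemma lookup_map_times [simp]:
  "lookup (Poly_Mapping.map ((*) c) f) k = c * lookup f k"
  for c :: "'k :: {comm_ring, comm_monoid_mult}"
  by (simp add: Poly_Mapping.map.rep_eq when_def)

lemma map_times_add:
  fixes c :: "'k :: {comm_ring, comm_monoid_mult}"
  shows "Poly_Mapping.map ((*) c) (f + g) = Poly_Mapping.map ((*) c) f + Poly_Mapping.map ((*) c) g"
  by (rule poly_mapping_eqI) (simp add: lookup_add distrib_left)

lemma map_times_0 [simp]: "Poly_Mapping.map ((*) (c :: 'k :: {comm_ring, comm_monoid_mult})) 0 = 0"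
  by (rule poly_mapping_eqI) simp

lemma map_times_single [simp]:
  fixes c :: "'k :: {comm_ring, comm_monoid_mult}"
  shows "Poly_Mapping.map ((*) c) (single k a) = single k (c * a)"
  by (rule poly_mapping_eqI) (simp add: lookup_single when_def)

lemma keys_map_times:
  "keys (Poly_Mapping.map ((*) (c :: 'k :: {comm_ring, comm_monoid_mult})) f)
    \<subseteq> keys f"
  by (auto simp: in_keys_iff)

lemma bilinear_ext_map_times:
  "bilinear_ext c (Poly_Mapping.map ((*) a) g) f = Poly_Mapping.map ((*) a) (bilinear_ext c g f)"
  "bilinear_ext c g (Poly_Mapping.map ((*) a) f) = Poly_Mapping.map ((*) a) (bilinear_ext c g f)"
proof -
  have 1: "bilinear_ext c (Poly_Mapping.map ((*) a) (single q b)) f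
      = Poly_Mapping.map ((*) a) (bilinear_ext c (single q b) f)" for q b
    by (induction f rule: poly_mapping_induct_keys[OF subset_UNIV])
      (simp_all add: bilinear_ext_add_right map_times_add mult.assoc)
  show "bilinear_ext c (Poly_Mapping.map ((*) a) g) f = Poly_Mapping.map ((*) a) (bilinear_ext c g f)"
    by (induction g rule: poly_mapping_induct_keys[OF subset_UNIV])
      (use 1 in \<open>simp_all add: bilinear_ext_add_left map_times_add\<close>)
  have 2: "bilinear_ext c (single q b) (Poly_Mapping.map ((*) a) f)
      = Poly_Mapping.map ((*) a) (bilinear_ext c (single q b) f)" for q b
    by (induction f rule: poly_mapping_induct_keys[OF subset_UNIV])
      (simp_all add: bilinear_ext_add_right map_times_add mult.left_commute)
  show "bilinear_ext c g (Poly_Mapping.map ((*) a) f) = Poly_Mapping.map ((*) a) (bilinear_ext c g f)"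
    by (induction g rule: poly_mapping_induct_keys[OF subset_UNIV])
      (use 2 in \<open>simp_all add: bilinear_ext_add_left map_times_add\<close>)
qed

lemma keys_bilinear_ext:
  assumes "keys g \<subseteq> B" "keys f \<subseteq> A" "\<And>q p. \<lbrakk>q \<in> B; p \<in> A\<rbrakk> \<Longrightarrow> c q p \<in> H"
  shows "keys (bilinear_ext c g f) \<subseteq> H"
proof
  fix k assume "k \<in> keys (bilinear_ext c g f)"
  then obtain q where q: "q \<in> keys g" "k \<in> keys (\<Sum>p\<in>keys f.
     single (c q p) (lookup g q * lookup f p))"
    unfolding bilinear_ext_def using keys_sum by fastforce
  then obtain p where "p \<in> keys f"
    "k \<in> keys (single (c q p) (lookup g q * lookup f p))"
    using keys_sum by fastforce
  then show "k \<in> H" using q assms by (auto split: if_splits)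
qed

text \<open>Four operations occur because composition in a category depends on the three objects
  involved. Both sides are additive in each argument, which reduces the claim to monomials.\<close>

lemma bilinear_ext_assoc:
  assumes "keys h \<subseteq> H" "keys g \<subseteq> G" "keys f \<subseteq> F"
    and "\<And>r q p. \<lbrakk>r \<in> H; q \<in> G; p \<in> F\<rbrakk> \<Longrightarrow> c\<^sub>1 (c\<^sub>2 r q) p = c\<^sub>3 r (c\<^sub>4 q p)"
  shows "bilinear_ext c\<^sub>1 (bilinear_ext c\<^sub>2 h g) f = bilinear_ext c\<^sub>3 h (bilinear_ext c\<^sub>4 g f)"
  using assms(1)
proof (induction h rule: poly_mapping_induct_keys)
  case (single r a)
  from assms(2) show ?case
  proof (induction g rule: poly_mapping_induct_keys)
    case (single q b)
    from assms(3) show ?case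
      by (induction f rule: poly_mapping_induct_keys)
        (use assms(4) \<open>r \<in> H\<close> \<open>q \<in> G\<close> in \<open>simp_all add: bilinear_ext_add_right mult.assoc\<close>)
  qed (simp_all add: bilinear_ext_add_left bilinear_ext_add_right)
qed (simp_all add: bilinear_ext_add_left)

lemma bilinear_ext_unit_left:
  assumes "keys f \<subseteq> H" "\<And>p. p \<in> H \<Longrightarrow> c q p = p"
  shows "bilinear_ext c (single q 1) f = f"
  using assms(1)
  by (induction f rule: poly_mapping_induct_keys) (use assms(2) in \<open>simp_all add: bilinear_ext_add_right\<close>)

lemma bilinear_ext_unit_right:
  assumes "keys f \<subseteq> H" "\<And>p. p \<in> H \<Longrightarrow> c p q = p"
  shows "bilinear_ext c f (single q 1) = f"
  using assms(1)
  by (induction f rule: poly_mapping_induct_keys) (use assms(2) in \<open>simp_all add: bilinear_ext_add_left\<close>)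

section \<open>The linear path category is a linear category\<close>

context path_triple
begin

lemma linear_path_category_simps [simp]:
  "Obj (linear_path_category T) = insert None (Some ` Pts T)"
  "Hom (linear_path_category T) (Some x) (Some y) = {f. keys f \<subseteq> Hom (path_category T) x y}"
  "Hom (linear_path_category T) None b = {0}"
  "Hom (linear_path_category T) a None = {0}"
  "Idn (linear_path_category T) (Some x) = single (path_class T (const_path x)) 1"
  "Idn (linear_path_category T) None = 0"
  "Cmp (linear_path_category T) (Some x) (Some y) (Some z) = bilinear_ext (Cmp (path_category T) x y z)"
  "Cmp (linear_path_category T) None b d = (\<lambda>g f. 0)"
  "Cmp (linear_path_category T) a None d = (\<lambda>g f. 0)"
  "Cmp (linear_path_category T) a b None = (\<lambda>g f. 0)"
  "Zer (linear_path_category T) a b = 0"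
  "Add (linear_path_category T) a b f g = f + g"
  "Scl (linear_path_category T) a b c f = Poly_Mapping.map ((*) c) f"
  by (simp_all add: linear_path_category_def bilinear_ext_def fun_eq_iff split: option.splits)

lemma linear_category_linear_path_category:
  "linear_category (linear_path_category T :: ('a option, _, 'k :: {comm_ring, comm_monoid_mult}) lcat)"
  (is "linear_category ?C")
proof -
  interpret P: category "path_category T" by (rule category_path_category)
  show ?thesis
  proof
    fix a assume "a \<in> Obj ?C"
    then show "Idn ?C a \<in> Hom ?C a a"
      by (cases a) (auto simp: const_in_Paths)
  next
    fix a b f assume "a \<in> Obj ?C" "b \<in> Obj ?C" "f \<in> Hom ?C a b"
    then show "Cmp ?C a a b f (Idn ?C a) = f" "Cmp ?C a b b (Idn ?C b) f = f"
      using P.Cmp_Idn_left P.Cmp_Idn_right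
      by (cases a; cases b; auto intro!: bilinear_ext_unit_left bilinear_ext_unit_right)+
  next
    fix a b d f g assume "a \<in> Obj ?C" "b \<in> Obj ?C" "d \<in> Obj ?C" "f \<in> Hom ?C a b" "g \<in> Hom ?C b d"
    moreover have "keys (bilinear_ext (Cmp (path_category T) x y z) g f) \<subseteq> Hom (path_category T) x z"
      if "keys f \<subseteq> Hom (path_category T) x y"
        "keys g \<subseteq> Hom (path_category T) y z" "x \<in> Pts T" "y \<in> Pts T" "z \<in> Pts T" for x y z
      using that P.Cmp_in_Hom by (intro keys_bilinear_ext[OF that(2,1)]) simp
    ultimately show "Cmp ?C a b d g f \<in> Hom ?C a d"
      by (cases a; cases b; cases d) (simp_all add: image_iff)
  next
    fix a b d e f g h
    assume "a \<in> Obj ?C" "b \<in> Obj ?C" "d \<in> Obj ?C" "e \<in> Obj ?C"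
      "f \<in> Hom ?C a b" "g \<in> Hom ?C b d" "h \<in> Hom ?C d e"
    moreover have "bilinear_ext (Cmp (path_category T) w x z) (bilinear_ext (Cmp (path_category T) x y z) h g) f
        = bilinear_ext (Cmp (path_category T) w y z) h (bilinear_ext (Cmp (path_category T) w x y) g f)"
      if "keys f \<subseteq> Hom (path_category T) w x" "keys g \<subseteq> Hom (path_category T) x y"
        "keys h \<subseteq> Hom (path_category T) y z" "w \<in> Pts T" "x \<in> Pts T" "y \<in> Pts T" "z \<in> Pts T"
      for w x y z
      by (rule bilinear_ext_assoc[OF that(3,2,1)]) (use that P.Cmp_assoc in simp)
    ultimately show "Cmp ?C a b e (Cmp ?C b d e h g) f = Cmp ?C a d e h (Cmp ?C a b d g f)"
      by (cases a; cases b; cases d; cases e) (simp_all add: image_iff)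
  next
    fix a b f g assume "a \<in> Obj ?C" "b \<in> Obj ?C" "f \<in> Hom ?C a b" "g \<in> Hom ?C a b"
    then show "Add ?C a b f g \<in> Hom ?C a b"
      by (cases a; cases b) (auto dest!: subsetD[OF Poly_Mapping.keys_add])
  next
    fix a b f assume "a \<in> Obj ?C" "b \<in> Obj ?C" "f \<in> Hom ?C a b"
    then show "\<exists>g\<in>Hom ?C a b. Add ?C a b f g = Zer ?C a b"
      by (intro bexI[of _ "- f"]; cases a; cases b) auto
    show "Scl ?C a b c f \<in> Hom ?C a b" for c
      using \<open>f \<in> Hom ?C a b\<close> keys_map_times[of c f] by (cases a; cases b) auto
    show "Scl ?C a b 1 f = f" by (simp add: poly_mapping_eq_iff fun_eq_iff)
    show "Scl ?C a b (c * d) f = Scl ?C a b c (Scl ?C a b d f)"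
      "Scl ?C a b (c + d) f = Add ?C a b (Scl ?C a b c f) (Scl ?C a b d f)" for c d
      by (rule poly_mapping_eqI; simp add: lookup_add algebra_simps)+
  next
    fix a b d f g h assume "a \<in> Obj ?C" "b \<in> Obj ?C" "d \<in> Obj ?C"
    show "Cmp ?C a b d (Add ?C b d g h) f = Add ?C a d (Cmp ?C a b d g f) (Cmp ?C a b d h f)"
      by (cases a; cases b; cases d) (simp_all add: bilinear_ext_add_left)
    show "Cmp ?C a b d h (Add ?C a b f g) = Add ?C a d (Cmp ?C a b d h f) (Cmp ?C a b d h g)"
      by (cases a; cases b; cases d) (simp_all add: bilinear_ext_add_right)
    show "Cmp ?C a b d (Scl ?C b d c g) f = Scl ?C a d c (Cmp ?C a b d g f)"
      "Cmp ?C a b d g (Scl ?C a b c f) = Scl ?C a d c (Cmp ?C a b d g f)" for c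
      by (cases a; cases b; cases d; simp add: bilinear_ext_map_times)+
  next
    fix a b f show "Zer ?C a b \<in> Hom ?C a b"
      by (cases a; cases b) auto
  qed (simp_all add: map_times_add add.assoc add.commute)
qed

end

section \<open>Ideals and quotients\<close>

locale category_ideal = linear_category C
  for C :: "('o, 'm, 'k :: {comm_ring, comm_monoid_mult}, 'z) lcat_scheme" +
  fixes I :: "'o \<Rightarrow> 'o \<Rightarrow> 'm set"
  assumes ideal: "cat_ideal C I"
begin

lemma ideal_simps [simp]:
  assumes "x \<in> Obj C" "y \<in> Obj C"
  shows "f \<in> I x y \<Longrightarrow> f \<in> Hom C x y" "Zer C x y \<in> I x y"
    "\<lbrakk>f \<in> I x y; g \<in> I x y\<rbrakk> \<Longrightarrow> Add C x y f g \<in> I x y" "f \<in> I x y \<Longrightarrow> Scl C x y c f \<in> I x y"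
  using ideal assms unfolding cat_ideal_def by blast+

lemma ideal_Cmp [simp]:
  assumes "x \<in> Obj C" "y \<in> Obj C" "z \<in> Obj C"
  shows "\<lbrakk>f \<in> I x y; g \<in> Hom C y z\<rbrakk> \<Longrightarrow> Cmp C x y z g f \<in> I x z"
    "\<lbrakk>f \<in> Hom C x y; g \<in> I y z\<rbrakk> \<Longrightarrow> Cmp C x y z g f \<in> I x z"
  using ideal assms unfolding cat_ideal_def by blast+

lemma Add_left_commute:
  assumes "x \<in> Obj C" "y \<in> Obj C" "f \<in> Hom C x y" "g \<in> Hom C x y" "h \<in> Hom C x y"
  shows "Add C x y f (Add C x y g h) = Add C x y g (Add C x y f h)"
  using assms by (metis Add_assoc Add_commute)

lemma coset_self: "\<lbrakk>x \<in> Obj C; y \<in> Obj C; f \<in> Hom C x y\<rbrakk> \<Longrightarrow> f \<in> coset C I x y f"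
  unfolding coset_def by (intro CollectI exI[of _ "Zer C x y"]) simp

text \<open>A change of representative is undone inside the ideal by adding the multiple of
  \<open>i\<close> by -1.\<close>

lemma coset_Add_ideal:
  assumes xy: "x \<in> Obj C" "y \<in> Obj C" and f: "f \<in> Hom C x y" and i: "i \<in> I x y"
  shows "coset C I x y (Add C x y f i) = coset C I x y f"
proof -
  have i' [simp]: "i \<in> Hom C x y" using i xy by simp
  have "\<exists>k\<in>I x y. Add C x y (Add C x y f i) j = Add C x y f k" if "j \<in> I x y" for j
    using xy f i that by (intro bexI[of _ "Add C x y i j"]) (simp_all add: Add_assoc)
  moreover have "\<exists>k\<in>I x y. Add C x y f j = Add C x y (Add C x y f i) k" if "j \<in> I x y" for j
  proof -
    let ?n = "Scl C x y (- 1) i"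
    have 0: "Add C x y i ?n = Zer C x y" using xy by (simp add: Add_Scl_minus_one)
    have "Add C x y i (Add C x y ?n j) = j"
      using xy that 0 by (simp add: Add_assoc[symmetric])
    then show ?thesis
      using xy f i that by (intro bexI[of _ "Add C x y ?n j"]) (simp_all add: Add_assoc)
  qed
  ultimately show ?thesis unfolding coset_def by blast
qed

lemma UN_coset_eq:
  assumes "x \<in> Obj C" "y \<in> Obj C" "f \<in> Hom C x y"
    and "\<And>i. i \<in> I x y \<Longrightarrow> B (Add C x y f i) = A"
  shows "(\<Union>f'\<in>coset C I x y f. B f') = A"
proof -
  have "B f' = A" if "f' \<in> coset C I x y f" for f'
    using that assms(4) unfolding coset_def by blast
  then show ?thesis using coset_self[OF assms(1-3)] by blast
qed

abbreviation Q where "Q \<equiv> quotient_category C I"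

lemma quotient_simps [simp]:
  "Obj Q = Obj C" "Hom Q x y = coset C I x y ` Hom C x y" "Idn Q x = coset C I x x (Idn C x)"
  "Zer Q x y = coset C I x y (Zer C x y)"
  by (simp_all add: quotient_category_def)

lemma quotient_Cmp [simp]:
  assumes [simp]: "x \<in> Obj C" "y \<in> Obj C" "z \<in> Obj C" "f \<in> Hom C x y" "g \<in> Hom C y z"
  shows "Cmp Q x y z (coset C I y z g) (coset C I x y f) = coset C I x z (Cmp C x y z g f)"
proof -
  have "coset C I x z (Cmp C x y z (Add C y z g j) (Add C x y f i)) = coset C I x z (Cmp C x y z g f)"
    if [simp]: "i \<in> I x y" "j \<in> I y z" for i j
  proof -
    have [simp]: "i \<in> Hom C x y" "j \<in> Hom C y z" by simp_all
    \<comment> \<open>The three terms involving \<open>i\<close> or \<open>j\<close> lie in the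
      ideal and are absorbed by the coset.\<close>
    have "Cmp C x y z (Add C y z g j) (Add C x y f i) =
        Add C x z (Cmp C x y z g f)
          (Add C x z (Cmp C x y z j f) (Add C x z (Cmp C x y z g i) (Cmp C x y z j i)))"
      by (simp add: Cmp_Add_left Cmp_Add_right Add_assoc)
    then show ?thesis by (simp add: coset_Add_ideal)
  qed
  then show ?thesis
    unfolding quotient_category_def by (simp add: UN_coset_eq)
qed

lemma quotient_Add [simp]:
  assumes [simp]: "x \<in> Obj C" "y \<in> Obj C" "f \<in> Hom C x y" "g \<in> Hom C x y"
  shows "Add Q x y (coset C I x y f) (coset C I x y g) = coset C I x y (Add C x y f g)"
proof -
  have "coset C I x y (Add C x y (Add C x y f i) (Add C x y g j)) = coset C I x y (Add C x y f g)"
    if [simp]: "i \<in> I x y" "j \<in> I x y" for i j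
  proof -
    have [simp]: "i \<in> Hom C x y" "j \<in> Hom C x y" by simp_all
    have "Add C x y (Add C x y f i) (Add C x y g j) = Add C x y (Add C x y f g) (Add C x y i j)"
      by (simp add: Add_assoc Add_left_commute[of x y i g])
    then show ?thesis by (simp add: coset_Add_ideal)
  qed
  then show ?thesis
    unfolding quotient_category_def by (simp add: UN_coset_eq)
qed

lemma quotient_Scl [simp]:
  assumes [simp]: "x \<in> Obj C" "y \<in> Obj C" "f \<in> Hom C x y"
  shows "Scl Q x y c (coset C I x y f) = coset C I x y (Scl C x y c f)"
proof -
  have "coset C I x y (Scl C x y c (Add C x y f i)) = coset C I x y (Scl C x y c f)"
    if [simp]: "i \<in> I x y" for i
    by (simp add: Scl_Add coset_Add_ideal)
  then show ?thesis
    unfolding quotient_category_def by (simp add: UN_coset_eq)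
qed

lemma linear_quotient_category: "linear_category Q"
proof
  fix x y f assume xy: "x \<in> Obj Q" "y \<in> Obj Q" and "f \<in> Hom Q x y"
  then obtain f' where f: "f' \<in> Hom C x y" "f = coset C I x y f'" by auto
  obtain g where g: "g \<in> Hom C x y" "Add C x y f' g = Zer C x y"
    using Add_inverse[of x y f'] xy f(1) by auto
  show "\<exists>g\<in>Hom Q x y. Add Q x y f g = Zer Q x y"
    using xy f g by (intro bexI[of _ "coset C I x y g"]) auto
  show "Add Q x y f g = Add Q x y g f" if "g \<in> Hom Q x y" for g
  proof -
    obtain g' where "g' \<in> Hom C x y" "g = coset C I x y g'" using \<open>g \<in> Hom Q x y\<close> by auto
    then show ?thesis using Add_commute[of x y f' g'] xy f by simp
  qed
qed (auto simp: Add_assoc Cmp_Add_left Cmp_Add_right Scl_mult Scl_plus Scl_Add Cmp_Scl_left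
    Cmp_Scl_right)

lemma coset_eq_Zer_iff:
  assumes "x \<in> Obj C" "y \<in> Obj C" "f \<in> Hom C x y"
  shows "coset C I x y f = coset C I x y (Zer C x y) \<longleftrightarrow> f \<in> I x y"
proof
  assume "coset C I x y f = coset C I x y (Zer C x y)"
  then have "f \<in> coset C I x y (Zer C x y)" using coset_self[OF assms] by simp
  then show "f \<in> I x y" using assms by (auto simp: coset_def)
next
  assume f: "f \<in> I x y"
  show "coset C I x y f = coset C I x y (Zer C x y)"
    using coset_Add_ideal[of x y "Zer C x y" f] assms f by simp
qed

end

section \<open>Ore systems\<close>

text \<open>\<open>S\<close> is a class of denominators with at most one member between two objects.
  \<open>common_target\<close> and \<open>common_source\<close> therefore need not ask for commuting
  squares: thinness supplies the commutativity.\<close>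

locale thin_system = linear_category C
  for C :: "('o, 'm, 'k :: {comm_ring, comm_monoid_mult}, 'z) lcat_scheme" +
  fixes S :: "'o \<Rightarrow> 'o \<Rightarrow> 'm set"
  assumes S_Hom: "\<lbrakk>x \<in> Obj C; y \<in> Obj C; s \<in> S x y\<rbrakk> \<Longrightarrow> s \<in> Hom C x y"
    and S_Idn: "x \<in> Obj C \<Longrightarrow> Idn C x \<in> S x x"
    and S_Cmp: "\<lbrakk>x \<in> Obj C; y \<in> Obj C; z \<in> Obj C; s \<in> S x y; t \<in> S y z\<rbrakk> \<Longrightarrow> Cmp C x y z t s \<in> S x z"
    and S_thin: "\<lbrakk>x \<in> Obj C; y \<in> Obj C; s \<in> S x y; t \<in> S x y\<rbrakk> \<Longrightarrow> s = t"
    and common_target: "\<lbrakk>x \<in> Obj C; y \<in> Obj C; z \<in> Obj C; s \<in> S x y; t \<in> S x z\<rbrakk>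
      \<Longrightarrow> \<exists>w\<in>Obj C. \<exists>u\<in>S y w. \<exists>v\<in>S z w. True"
    and common_source: "\<lbrakk>x \<in> Obj C; y \<in> Obj C; z \<in> Obj C; s \<in> S y x; t \<in> S z x\<rbrakk>
      \<Longrightarrow> \<exists>w\<in>Obj C. \<exists>u\<in>S w y. \<exists>v\<in>S w z. True"
begin

declare S_Hom [simp]

lemma S_square:
  assumes "w \<in> Obj C" "x \<in> Obj C" "y \<in> Obj C" "z \<in> Obj C"
    and "s \<in> S w x" "t \<in> S x z" "u \<in> S w y" "v \<in> S y z"
  shows "Cmp C w x z t s = Cmp C w y z v u"
  using assms S_thin[of w z] S_Cmp by blast

text \<open>The Ore condition for one morphism at a time, so that it can be verified on multiples of
  path classes and then extended to sums.\<close>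

definition right_ore :: "'o \<Rightarrow> 'o \<Rightarrow> 'm \<Rightarrow> bool" where
  "right_ore x y f \<longleftrightarrow> (\<forall>x'\<in>Obj C. \<forall>s\<in>S x x'. \<exists>y'\<in>Obj C. \<exists>s'\<in>S y y'. \<exists>f'\<in>Hom C x' y'.
     Cmp C x y y' s' f = Cmp C x x' y' f' s)"

definition left_ore :: "'o \<Rightarrow> 'o \<Rightarrow> 'm \<Rightarrow> bool" where
  "left_ore x y f \<longleftrightarrow> (\<forall>y'\<in>Obj C. \<forall>t\<in>S y' y. \<exists>x'\<in>Obj C. \<exists>t'\<in>S x' x. \<exists>f'\<in>Hom C x' y'.
     Cmp C x' x y f t' = Cmp C x' y' y t f')"

lemma right_ore_Zer:
  assumes "x \<in> Obj C" "y \<in> Obj C" shows "right_ore x y (Zer C x y)"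
  unfolding right_ore_def
proof (intro ballI)
  fix x' s assume "x' \<in> Obj C" "s \<in> S x x'"
  then show "\<exists>y'\<in>Obj C. \<exists>s'\<in>S y y'. \<exists>f'\<in>Hom C x' y'.
      Cmp C x y y' s' (Zer C x y) = Cmp C x x' y' f' s"
    using assms S_Idn by (intro bexI[of _ y] bexI[of _ "Idn C y"] bexI[of _ "Zer C x' y"]) simp_all
qed

lemma left_ore_Zer:
  assumes "x \<in> Obj C" "y \<in> Obj C" shows "left_ore x y (Zer C x y)"
  unfolding left_ore_def
proof (intro ballI)
  fix y' t assume "y' \<in> Obj C" "t \<in> S y' y"
  then show "\<exists>x'\<in>Obj C. \<exists>t'\<in>S x' x. \<exists>f'\<in>Hom C x' y'.
      Cmp C x' x y (Zer C x y) t' = Cmp C x' y' y t f'"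
    using assms S_Idn by (intro bexI[of _ x] bexI[of _ "Idn C x"] bexI[of _ "Zer C x y'"]) simp_all
qed

text \<open>The squares for \<open>f\<close> and \<open>g\<close> end in different denominators
  \<open>s1\<close> and \<open>s2\<close>; both are continued to a common target, where thinness
  makes the denominators equal.\<close>

lemma right_ore_Add:
  assumes [simp]: "x \<in> Obj C" "y \<in> Obj C" "f \<in> Hom C x y" "g \<in> Hom C x y"
    and f: "right_ore x y f" and g: "right_ore x y g"
  shows "right_ore x y (Add C x y f g)"
  unfolding right_ore_def
proof (intro ballI)
  fix x' s assume [simp]: "x' \<in> Obj C" "s \<in> S x x'"
  obtain y1 s1 f1 where [simp]: "y1 \<in> Obj C" "s1 \<in> S y y1" "f1 \<in> Hom C x' y1"
    and 1: "Cmp C x y y1 s1 f = Cmp C x x' y1 f1 s"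
    using f unfolding right_ore_def by (meson \<open>x' \<in> Obj C\<close> \<open>s \<in> S x x'\<close>)
  obtain y2 s2 g2 where [simp]: "y2 \<in> Obj C" "s2 \<in> S y y2" "g2 \<in> Hom C x' y2"
    and 2: "Cmp C x y y2 s2 g = Cmp C x x' y2 g2 s"
    using g unfolding right_ore_def by (meson \<open>x' \<in> Obj C\<close> \<open>s \<in> S x x'\<close>)
  obtain w u v where [simp]: "w \<in> Obj C" "u \<in> S y1 w" "v \<in> S y2 w"
    using common_target[of y y1 y2 s1 s2] by auto
  have uv: "Cmp C y y1 w u s1 = Cmp C y y2 w v s2"
    by (rule S_square) simp_all
  let ?f = "Add C x' w (Cmp C x' y1 w u f1) (Cmp C x' y2 w v g2)"
  have "Cmp C x y w (Cmp C y y1 w u s1) (Add C x y f g) =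
    Add C x w (Cmp C x y1 w u (Cmp C x y y1 s1 f)) (Cmp C x y w (Cmp C y y1 w u s1) g)"
    by (simp add: Cmp_Add_right)
  also have "\<dots> = Cmp C x x' w ?f s"
    unfolding uv by (simp add: Cmp_Add_left 1 2)
  finally show "\<exists>y'\<in>Obj C. \<exists>s'\<in>S y y'. \<exists>f'\<in>Hom C x' y'.
      Cmp C x y y' s' (Add C x y f g) = Cmp C x x' y' f' s"
    by (intro bexI[of _ w] bexI[of _ "Cmp C y y1 w u s1"] bexI[of _ ?f]) (simp_all add: S_Cmp)
qed

lemma left_ore_Add:
  assumes [simp]: "x \<in> Obj C" "y \<in> Obj C" "f \<in> Hom C x y" "g \<in> Hom C x y"
    and f: "left_ore x y f" and g: "left_ore x y g"
  shows "left_ore x y (Add C x y f g)"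
  unfolding left_ore_def
proof (intro ballI)
  fix y' t assume [simp]: "y' \<in> Obj C" "t \<in> S y' y"
  obtain x1 t1 f1 where [simp]: "x1 \<in> Obj C" "t1 \<in> S x1 x" "f1 \<in> Hom C x1 y'"
    and 1: "Cmp C x1 x y f t1 = Cmp C x1 y' y t f1"
    using f unfolding left_ore_def by (meson \<open>y' \<in> Obj C\<close> \<open>t \<in> S y' y\<close>)
  obtain x2 t2 g2 where [simp]: "x2 \<in> Obj C" "t2 \<in> S x2 x" "g2 \<in> Hom C x2 y'"
    and 2: "Cmp C x2 x y g t2 = Cmp C x2 y' y t g2"
    using g unfolding left_ore_def by (meson \<open>y' \<in> Obj C\<close> \<open>t \<in> S y' y\<close>)
  obtain w u v where [simp]: "w \<in> Obj C" "u \<in> S w x1" "v \<in> S w x2"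
    using common_source[of x x1 x2 t1 t2] by auto
  have uv: "Cmp C w x1 x t1 u = Cmp C w x2 x t2 v"
    by (rule S_square) simp_all
  let ?f = "Add C w y' (Cmp C w x1 y' f1 u) (Cmp C w x2 y' g2 v)"
  have "Cmp C w x y (Add C x y f g) (Cmp C w x1 x t1 u) =
    Add C w y (Cmp C w x y f (Cmp C w x1 x t1 u)) (Cmp C w x y g (Cmp C w x2 x t2 v))"
    unfolding uv[symmetric] by (simp add: Cmp_Add_left)
  also have "\<dots> = Cmp C w y' y t ?f"
    by (simp add: Cmp_Add_right Cmp_reassoc'[OF 1] Cmp_reassoc'[OF 2])
  finally show "\<exists>x'\<in>Obj C. \<exists>t'\<in>S x' x. \<exists>f'\<in>Hom C x' y'.
      Cmp C x' x y (Add C x y f g) t' = Cmp C x' y' y t f'"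
    by (intro bexI[of _ w] bexI[of _ "Cmp C w x1 x t1 u"] bexI[of _ ?f]) (simp_all add: S_Cmp)
qed

text \<open>\<open>S\<close>-related morphisms become isomorphic when the morphisms in \<open>S\<close> are inverted.\<close>

definition S_related :: "'o \<Rightarrow> 'o \<Rightarrow> 'm \<Rightarrow> 'o \<Rightarrow> 'o \<Rightarrow> 'm \<Rightarrow> bool" where
  "S_related x y f x\<^sub>2 y\<^sub>2 g \<longleftrightarrow> (\<exists>x'\<in>Obj C. \<exists>y'\<in>Obj C. \<exists>t\<in>S x' x. \<exists>t\<^sub>2\<in>S x' x\<^sub>2. \<exists>s\<in>S y y'. \<exists>s\<^sub>2\<in>S y\<^sub>2 y'.
     Cmp C x' y y' s (Cmp C x' x y f t) = Cmp C x' y\<^sub>2 y' s\<^sub>2 (Cmp C x' x\<^sub>2 y\<^sub>2 g t\<^sub>2))"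

text \<open>The witnesses for the two relations are brought to a common source \<open>w\<close> and
  a common target \<open>w'\<close>, after which the two equations can be added.\<close>

lemma S_related_Add:
  assumes [simp]: "x \<in> Obj C" "y \<in> Obj C" "x\<^sub>2 \<in> Obj C" "y\<^sub>2 \<in> Obj C"
    "f \<in> Hom C x y" "g \<in> Hom C x y" "f\<^sub>2 \<in> Hom C x\<^sub>2 y\<^sub>2" "g\<^sub>2 \<in> Hom C x\<^sub>2 y\<^sub>2"
    and f: "S_related x y f x\<^sub>2 y\<^sub>2 f\<^sub>2" and g: "S_related x y g x\<^sub>2 y\<^sub>2 g\<^sub>2"
  shows "S_related x y (Add C x y f g) x\<^sub>2 y\<^sub>2 (Add C x\<^sub>2 y\<^sub>2 f\<^sub>2 g\<^sub>2)"
proof -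
  obtain a b t t2 s s2 where [simp]: "a \<in> Obj C" "b \<in> Obj C" "t \<in> S a x" "t2 \<in> S a x\<^sub>2"
      "s \<in> S y b" "s2 \<in> S y\<^sub>2 b"
    and 1: "Cmp C a y b s (Cmp C a x y f t) = Cmp C a y\<^sub>2 b s2 (Cmp C a x\<^sub>2 y\<^sub>2 f\<^sub>2 t2)"
    using f unfolding S_related_def by blast
  obtain c d p p2 q q2 where [simp]: "c \<in> Obj C" "d \<in> Obj C" "p \<in> S c x" "p2 \<in> S c x\<^sub>2"
      "q \<in> S y d" "q2 \<in> S y\<^sub>2 d"
    and 2: "Cmp C c y d q (Cmp C c x y g p) = Cmp C c y\<^sub>2 d q2 (Cmp C c x\<^sub>2 y\<^sub>2 g\<^sub>2 p2)"
    using g unfolding S_related_def by blast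
  obtain w u v where [simp]: "w \<in> Obj C" "u \<in> S w a" "v \<in> S w c"
    using common_source[of x a c t p] by auto
  obtain w' u' v' where [simp]: "w' \<in> Obj C" "u' \<in> S b w'" "v' \<in> S d w'"
    using common_target[of y b d s q] by auto
  \<comment> \<open>\<open>u\<close> and \<open>v\<close> were chosen for the denominators at
    \<open>x\<close> only; thinness makes them match those at \<open>x\<^sub>2\<close> as well, and
    likewise at the targets.\<close>
  have tp: "Cmp C w a x t u = Cmp C w c x p v" "Cmp C w a x\<^sub>2 t2 u = Cmp C w c x\<^sub>2 p2 v"
    "Cmp C y b w' u' s = Cmp C y d w' v' q" "Cmp C y\<^sub>2 b w' u' s2 = Cmp C y\<^sub>2 d w' v' q2"
    by (rule S_square; simp)+
  let ?T = "Cmp C w a x t u" and ?T2 = "Cmp C w a x\<^sub>2 t2 u"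
  let ?S = "Cmp C y b w' u' s" and ?S2 = "Cmp C y\<^sub>2 b w' u' s2"
  have f: "Cmp C w y w' ?S (Cmp C w x y f ?T) = Cmp C w y\<^sub>2 w' ?S2 (Cmp C w x\<^sub>2 y\<^sub>2 f\<^sub>2 ?T2)"
  proof -
    have "Cmp C w y w' ?S (Cmp C w x y f ?T) =
      Cmp C w b w' u' (Cmp C w a b (Cmp C a y b s (Cmp C a x y f t)) u)" by simp
    then show ?thesis unfolding 1 by simp
  qed
  have g: "Cmp C w y w' ?S (Cmp C w x y g ?T) = Cmp C w y\<^sub>2 w' ?S2 (Cmp C w x\<^sub>2 y\<^sub>2 g\<^sub>2 ?T2)"
    unfolding tp
  proof -
    have "Cmp C w y w' (Cmp C y d w' v' q) (Cmp C w x y g (Cmp C w c x p v)) =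
      Cmp C w d w' v' (Cmp C w c d (Cmp C c y d q (Cmp C c x y g p)) v)" by simp
    then show "Cmp C w y w' (Cmp C y d w' v' q) (Cmp C w x y g (Cmp C w c x p v)) =
      Cmp C w y\<^sub>2 w' (Cmp C y\<^sub>2 d w' v' q2) (Cmp C w x\<^sub>2 y\<^sub>2 g\<^sub>2 (Cmp C w c x\<^sub>2 p2 v))"
      unfolding 2 by simp
  qed
  have [simp]: "?T \<in> S w x" "?T2 \<in> S w x\<^sub>2" "?S \<in> S y w'" "?S2 \<in> S y\<^sub>2 w'"
    by (simp_all add: S_Cmp)
  have "Cmp C w y w' ?S (Cmp C w x y (Add C x y f g) ?T) =
    Cmp C w y\<^sub>2 w' ?S2 (Cmp C w x\<^sub>2 y\<^sub>2 (Add C x\<^sub>2 y\<^sub>2 f\<^sub>2 g\<^sub>2) ?T2)"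
    using f g by (simp add: Cmp_Add_left Cmp_Add_right del: Cmp_assoc)
  then show ?thesis
    unfolding S_related_def
    using \<open>w \<in> Obj C\<close> \<open>w' \<in> Obj C\<close> \<open>?T \<in> S w x\<close> \<open>?T2 \<in> S w x\<^sub>2\<close> \<open>?S \<in> S y w'\<close> \<open>?S2 \<in> S y\<^sub>2 w'\<close> by blast
qed

text \<open>
  The localization at \<open>S\<close> is never formed: the saturation consists of the morphisms whose image
  in it lies in the ideal generated by \<open>I\<close>.
\<close>

definition saturation :: "('o \<Rightarrow> 'o \<Rightarrow> 'm set) \<Rightarrow> 'o \<Rightarrow> 'o \<Rightarrow> 'm set" where
  "saturation I x y = {f \<in> Hom C x y. \<exists>x'\<in>Obj C. \<exists>y'\<in>Obj C. \<exists>t\<in>S x' x. \<exists>s\<in>S y y'.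
     Cmp C x' y y' s (Cmp C x' x y f t) \<in> I x' y'}"

text \<open>The relation turns \<open>f\<close>, enlarged by denominators, into \<open>g\<close>
  enlarged by denominators, and the latter stays in the ideal.\<close>

lemma S_related_saturation:
  assumes "x \<in> Obj C" "y \<in> Obj C" "x\<^sub>2 \<in> Obj C" "y\<^sub>2 \<in> Obj C" "cat_ideal C I"
    and f: "f \<in> Hom C x y" and g: "g \<in> I x\<^sub>2 y\<^sub>2" and fg: "S_related x y f x\<^sub>2 y\<^sub>2 g"
  shows "f \<in> saturation I x y"
proof -
  interpret I: category_ideal C I by unfold_locales fact
  show ?thesis
    using fg f g assms(1-4) unfolding S_related_def saturation_def
    by (smt (verit) I.ideal_Cmp S_Hom mem_Collect_eq)
qed

text \<open>Sums use common denominators. In a composite, the denominator between the two factors is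
  in the way, and the Ore conditions move it to the outside.\<close>

lemma cat_ideal_saturation:
  assumes I: "cat_ideal C I"
    and right: "\<And>x y f. \<lbrakk>x \<in> Obj C; y \<in> Obj C; f \<in> Hom C x y\<rbrakk> \<Longrightarrow> right_ore x y f"
    and left: "\<And>x y f. \<lbrakk>x \<in> Obj C; y \<in> Obj C; f \<in> Hom C x y\<rbrakk> \<Longrightarrow> left_ore x y f"
  shows "cat_ideal C (saturation I)"
proof -
  interpret I: category_ideal C I by unfold_locales fact
  have saturationI: "f \<in> saturation I x y"
    if "f \<in> Hom C x y" "x' \<in> Obj C" "y' \<in> Obj C" "t \<in> S x' x" "s \<in> S y y'"
      "Cmp C x' y y' s (Cmp C x' x y f t) \<in> I x' y'" for f x y x' y' t s
    using that unfolding saturation_def by blast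
  have saturationE: "\<exists>x' y' t s. f \<in> Hom C x y \<and> x' \<in> Obj C \<and> y' \<in> Obj C \<and> t \<in> S x' x \<and> s \<in> S y y' \<and>
      Cmp C x' y y' s (Cmp C x' x y f t) \<in> I x' y'" if "f \<in> saturation I x y" for f x y
    using that unfolding saturation_def by blast
  have add: "Add C x y f g \<in> saturation I x y"
    if [simp]: "x \<in> Obj C" "y \<in> Obj C" and fg: "f \<in> saturation I x y" "g \<in> saturation I x y" for x y f g
  proof -
    obtain a b t s where [simp]: "f \<in> Hom C x y" "a \<in> Obj C" "b \<in> Obj C" "t \<in> S a x" "s \<in> S y b"
      and 1: "Cmp C a y b s (Cmp C a x y f t) \<in> I a b" using saturationE[OF fg(1)] by blast
    obtain c d p q where [simp]: "g \<in> Hom C x y" "c \<in> Obj C" "d \<in> Obj C" "p \<in> S c x" "q \<in> S y d"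
      and 2: "Cmp C c y d q (Cmp C c x y g p) \<in> I c d" using saturationE[OF fg(2)] by blast
    obtain w u v where [simp]: "w \<in> Obj C" "u \<in> S w a" "v \<in> S w c"
      using common_source[of x a c t p] by auto
    obtain w' u' v' where [simp]: "w' \<in> Obj C" "u' \<in> S b w'" "v' \<in> S d w'"
      using common_target[of y b d s q] by auto
    have tp: "Cmp C w a x t u = Cmp C w c x p v" "Cmp C y b w' u' s = Cmp C y d w' v' q"
      by (rule S_square; simp)+
    let ?T = "Cmp C w a x t u" and ?S = "Cmp C y b w' u' s"
    \<comment> \<open>Enlarging the denominators of \<open>f\<close> by \<open>u\<close> and
      \<open>u'\<close> keeps the fraction in \<open>I\<close> and reaches the denominators shared
      with \<open>g\<close>.\<close>
    have "Cmp C w b w' u' (Cmp C w a b (Cmp C a y b s (Cmp C a x y f t)) u) \<in> I w w'"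
      using 1 by (intro I.ideal_Cmp(1)[of w b w'] I.ideal_Cmp(2)[of w a b]) simp_all
    then have f: "Cmp C w y w' ?S (Cmp C w x y f ?T) \<in> I w w'" by simp
    have "Cmp C w d w' v' (Cmp C w c d (Cmp C c y d q (Cmp C c x y g p)) v) \<in> I w w'"
      using 2 by (intro I.ideal_Cmp(1)[of w d w'] I.ideal_Cmp(2)[of w c d]) simp_all
    then have g: "Cmp C w y w' ?S (Cmp C w x y g ?T) \<in> I w w'" unfolding tp by simp
    have [simp]: "?T \<in> S w x" "?S \<in> S y w'" by (simp_all add: S_Cmp)
    have "Cmp C w y w' ?S (Cmp C w x y (Add C x y f g) ?T) \<in> I w w'"
      using f g by (simp add: Cmp_Add_left Cmp_Add_right del: Cmp_assoc)
    then show ?thesis by (rule saturationI[rotated -1]) simp_all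
  qed
  have zero: "Zer C x y \<in> saturation I x y" if "x \<in> Obj C" "y \<in> Obj C" for x y
    by (rule saturationI[of _ _ _ x y "Idn C x" "Idn C y"]) (use that S_Idn in simp_all)
  have scl: "Scl C x y r f \<in> saturation I x y"
    if [simp]: "x \<in> Obj C" "y \<in> Obj C" and f: "f \<in> saturation I x y" for x y f r
  proof -
    obtain a b t s where [simp]: "f \<in> Hom C x y" "a \<in> Obj C" "b \<in> Obj C" "t \<in> S a x" "s \<in> S y b"
      and 1: "Cmp C a y b s (Cmp C a x y f t) \<in> I a b" using saturationE[OF f] by blast
    show ?thesis
      by (rule saturationI[of _ _ _ a b t s]) (use 1 in \<open>simp_all add: Cmp_Scl_left Cmp_Scl_right\<close>)
  qed
  have post: "Cmp C x y z g f \<in> saturation I x z"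
    if [simp]: "x \<in> Obj C" "y \<in> Obj C" "z \<in> Obj C" "g \<in> Hom C y z" and f: "f \<in> saturation I x y"
    for x y z f g
  proof -
    obtain a b t s where [simp]: "f \<in> Hom C x y" "a \<in> Obj C" "b \<in> Obj C" "t \<in> S a x" "s \<in> S y b"
      and 1: "Cmp C a y b s (Cmp C a x y f t) \<in> I a b" using saturationE[OF f] by blast
    have r: "right_ore y z g" by (rule right) simp_all
    obtain z' s' g' where [simp]: "z' \<in> Obj C" "s' \<in> S z z'" "g' \<in> Hom C b z'"
      and 2: "Cmp C y z z' s' g = Cmp C y b z' g' s"
      using r unfolding right_ore_def by (meson \<open>b \<in> Obj C\<close> \<open>s \<in> S y b\<close>)
    \<comment> \<open>The Ore square replaces \<open>g'\<close> after \<open>s\<close> by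
      \<open>s'\<close> after \<open>g\<close>, so this element is the composite of \<open>g\<close>
      and \<open>f\<close> between the denominators \<open>t\<close> and \<open>s'\<close>.\<close>
    have "Cmp C a b z' g' (Cmp C a y b s (Cmp C a x y f t)) \<in> I a z'"
      using 1 by (intro I.ideal_Cmp(1)[of a b z']) simp_all
    then have "Cmp C a z z' s' (Cmp C a x z (Cmp C x y z g f) t) \<in> I a z'"
      by (simp add: Cmp_reassoc[OF 2])
    then show ?thesis by (rule saturationI[rotated -1]) simp_all
  qed
  have pre: "Cmp C w x y f h \<in> saturation I w y"
    if [simp]: "w \<in> Obj C" "x \<in> Obj C" "y \<in> Obj C" "h \<in> Hom C w x" and f: "f \<in> saturation I x y"
    for w x y f h
  proof -
    obtain a b t s where [simp]: "f \<in> Hom C x y" "a \<in> Obj C" "b \<in> Obj C" "t \<in> S a x" "s \<in> S y b"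
      and 1: "Cmp C a y b s (Cmp C a x y f t) \<in> I a b" using saturationE[OF f] by blast
    have l: "left_ore w x h" by (rule left) simp_all
    obtain w' t' h' where [simp]: "w' \<in> Obj C" "t' \<in> S w' w" "h' \<in> Hom C w' a"
      and 2: "Cmp C w' w x h t' = Cmp C w' a x t h'"
      using l unfolding left_ore_def by (meson \<open>a \<in> Obj C\<close> \<open>t \<in> S a x\<close>)
    have "Cmp C w' a b (Cmp C a y b s (Cmp C a x y f t)) h' \<in> I w' b"
      using 1 by (intro I.ideal_Cmp(2)[of w' a b]) simp_all
    then have "Cmp C w' y b s (Cmp C w' w y (Cmp C w x y f h) t') \<in> I w' b"
      by (simp add: 2)
    then show ?thesis by (rule saturationI[rotated -1]) simp_all
  qed
  have "saturation I x y \<subseteq> Hom C x y" for x y by (auto simp: saturation_def)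
  with add zero scl post pre show ?thesis
    unfolding cat_ideal_def by (intro conjI ballI allI) simp_all
qed

end

section \<open>Screens\<close>

lemma im_concat_path_eq: "\<gamma> 1 = \<delta> 0 \<Longrightarrow> im (concat_path \<gamma> \<delta>) = im \<gamma> \<union> im \<delta>"
proof
  assume 1: "\<gamma> 1 = \<delta> 0"
  have "\<gamma> t \<in> im (concat_path \<gamma> \<delta>)" if "t \<in> {0..1}" for t
    using that unfolding im_def concat_path_def by (intro image_eqI[of _ _ "t / 2"]) auto
  moreover have "\<delta> t \<in> im (concat_path \<gamma> \<delta>)" if "t \<in> {0..1}" for t
    using that 1 unfolding im_def concat_path_def
    by (intro image_eqI[of _ _ "(t + 1) / 2"]) (auto simp: field_simps)
  ultimately show "im \<gamma> \<union> im \<delta> \<subseteq> im (concat_path \<gamma> \<delta>)" by (auto simp: im_def[of \<gamma>] im_def[of \<delta>])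
qed (rule im_concat_path)

text \<open>The denominators: classes of paths inside a pixel, with coefficient 1. The first
  disjunct adds the identity of the zero object \<open>None\<close>, so that all identities are
  included.\<close>

definition pixel_arrows ::
  "'a triple \<Rightarrow> 'a set set \<Rightarrow> 'a option \<Rightarrow> 'a option \<Rightarrow>
   ((real \<Rightarrow> 'a) set \<Rightarrow>\<^sub>0 'k :: {comm_ring, comm_monoid_mult}) set" where
  "pixel_arrows T P a b = {f. a = None \<and> b = None \<and> f = 0 \<or>
     (\<exists>\<rho>\<in>Paths T. in_pixel P \<rho> \<and> a = Some (\<rho> 0) \<and> b = Some (\<rho> 1) \<and>
       f = single (path_class T \<rho>) 1)}"

lemma pixel_arrows_None [simp]:
  "pixel_arrows T P None b = {f. b = None \<and> f = 0}" "pixel_arrows T P a None = {f. a = None \<and> f = 0}"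
  by (auto simp: pixel_arrows_def)

lemma pixel_arrows_Some:
  "pixel_arrows T P (Some x) (Some y) =
    {single (path_class T \<rho>) 1 | \<rho>. \<rho> \<in> Paths T \<and> in_pixel P \<rho> \<and> \<rho> 0 = x \<and> \<rho> 1 = y}"
  by (auto simp: pixel_arrows_def)

lemma pixel_arrowsI [simp]:
  "\<lbrakk>\<rho> \<in> Paths T; in_pixel P \<rho>; \<rho> 0 = x; \<rho> 1 = y\<rbrakk> \<Longrightarrow>
    single (path_class T \<rho>) 1 \<in> pixel_arrows T P (Some x) (Some y)"
  by (auto simp: pixel_arrows_Some)

section \<open>Paths inside pixels satisfy the Ore conditions\<close>

context screen
begin

lemma pixel_unique: "\<lbrakk>X \<in> P; Y \<in> P; x \<in> X; x \<in> Y\<rbrakk> \<Longrightarrow> X = Y"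
  using partition by (metis disjointD disjoint_iff partition_onD2)

lemma pixel_subset_Pts: "X \<in> P \<Longrightarrow> X \<subseteq> Pts T"
  using partition partition_onD1 by blast

lemma in_pixel_const: "x \<in> Pts T \<Longrightarrow> in_pixel P (const_path x)"
  using partition partition_onD1 unfolding in_pixel_def by fastforce

lemma in_pixel_concat:
  assumes "in_pixel P \<rho>" "in_pixel P \<sigma>" "\<rho> 1 = \<sigma> 0"
  shows "in_pixel P (concat_path \<rho> \<sigma>)"
  using assms im_concat_path[of \<rho> \<sigma>] endpoints_in_im[of \<rho>] endpoints_in_im[of \<sigma>] pixel_unique
  unfolding in_pixel_def by (metis Un_least subsetD subset_trans)

lemma Eqv_in_pixel:
  assumes "(\<rho>, \<sigma>) \<in> Eqv T" "in_pixel P \<rho>"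
  shows "in_pixel P \<sigma>"
  using assms S1 Eqv_in_Paths Eqv_endpoints unfolding in_pixel_def by metis

lemma in_pixel_concatD:
  assumes "in_pixel P (concat_path \<rho> \<sigma>)" "\<rho> 1 = \<sigma> 0"
  shows "in_pixel P \<rho>" "in_pixel P \<sigma>"
  using assms im_concat_path_eq[of \<rho> \<sigma>] unfolding in_pixel_def by auto

text \<open>The two pixels share the starting point, hence coincide, and (S1) applies. This is the
  thinness of the system of denominators.\<close>

lemma Eqv_if_in_pixel:
  assumes "\<rho> \<in> Paths T" "\<sigma> \<in> Paths T" "\<rho> 0 = \<sigma> 0" "\<rho> 1 = \<sigma> 1" "in_pixel P \<rho>" "in_pixel P \<sigma>"
  shows "(\<rho>, \<sigma>) \<in> Eqv T"
proof -
  obtain X where X: "X \<in> P" "im \<rho> \<subseteq> X" using assms(5) by (auto simp: in_pixel_def)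
  obtain Y where Y: "Y \<in> P" "im \<sigma> \<subseteq> Y" using assms(6) by (auto simp: in_pixel_def)
  have "X = Y"
    using pixel_unique[OF X(1) Y(1), of "\<rho> 0"] X(2) Y(2) endpoints_in_im(1)[of \<rho>]
      endpoints_in_im(1)[of \<sigma>] assms(3) by auto
  then show ?thesis using S1[OF assms(1-4) X] Y by simp
qed

interpretation L: linear_category
  "linear_path_category T :: ('a option, _, 'k :: {comm_ring, comm_monoid_mult}) lcat"
  by (rule linear_category_linear_path_category)

text \<open>Thinness comes from (S1). Common targets and sources come from (S3) and its dual,
  applied to two paths that both lie in a pixel.\<close>

lemma thin_system_pixel_arrows:
  "thin_system (linear_path_category T :: ('a option, _, 'k :: {comm_ring, comm_monoid_mult}) lcat)
    (pixel_arrows T P)"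
proof
  fix a b c :: "'a option" and s t :: "(real \<Rightarrow> 'a) set \<Rightarrow>\<^sub>0 'k"
  let ?C = "linear_path_category T :: ('a option, _, 'k) lcat"
  show "Idn ?C a \<in> pixel_arrows T P a a" if "a \<in> Obj ?C"
    using that in_pixel_const by (cases a) (auto simp: const_in_Paths)
  show "s \<in> Hom ?C a b" if "s \<in> pixel_arrows T P a b"
    using that by (cases a; cases b) (auto simp: pixel_arrows_Some split: if_splits)
  show "Cmp ?C a b c t s \<in> pixel_arrows T P a c"
    if "s \<in> pixel_arrows T P a b" "t \<in> pixel_arrows T P b c"
  proof -
    have "bilinear_ext (Cmp (path_category T) x y z) t s \<in> pixel_arrows T P (Some x) (Some z)"
      if st: "s \<in> pixel_arrows T P (Some x) (Some y)" "t \<in> pixel_arrows T P (Some y) (Some z)" for x y z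
    proof -
      obtain \<rho> \<sigma> where "\<rho> \<in> Paths T" "in_pixel P \<rho>" "\<rho> 0 = x" "\<rho> 1 = y" "\<sigma> \<in> Paths T" "in_pixel P \<sigma>"
        "\<sigma> 0 = y" "\<sigma> 1 = z" "s = single (path_class T \<rho>) 1"
        "t = single (path_class T \<sigma>) 1"
        using st by (auto simp: pixel_arrows_Some)
      then show ?thesis by (simp add: concat_in_Paths in_pixel_concat)
    qed
    then show ?thesis using that by (cases a; cases b; cases c) simp_all
  qed
  show "s = t" if "s \<in> pixel_arrows T P a b" "t \<in> pixel_arrows T P a b"
    using that Eqv_if_in_pixel
    by (cases a; cases b) (auto simp: pixel_arrows_Some intro!: arg_cong2[of _ _ _ _ single] path_class_eqI)
  show "\<exists>w\<in>Obj ?C. \<exists>u\<in>pixel_arrows T P b w. \<exists>v\<in>pixel_arrows T P c w. True"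
    if st: "s \<in> pixel_arrows T P a b" "t \<in> pixel_arrows T P a c"
  proof (cases a)
    case None
    then show ?thesis using that by (intro bexI[of _ None] bexI[of _ s] bexI[of _ t]) auto
  next
    case (Some x)
    then obtain \<rho> \<sigma> where \<rho>: "\<rho> \<in> Paths T" "in_pixel P \<rho>" "\<rho> 0 = x" "b = Some (\<rho> 1)"
      and \<sigma>: "\<sigma> \<in> Paths T" "in_pixel P \<sigma>" "\<sigma> 0 = x" "c = Some (\<sigma> 1)"
      using st by (cases b; cases c) (auto simp: pixel_arrows_Some)
    obtain \<rho>' \<sigma>' where \<rho>': "\<rho>' \<in> Paths T" "\<sigma>' \<in> Paths T" "in_pixel P \<rho>'" "\<sigma> 1 = \<rho>' 0" "\<rho> 1 = \<sigma>' 0"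
      "(concat_path \<sigma> \<rho>', concat_path \<rho> \<sigma>') \<in> Eqv T"
      using S3[OF \<rho>(1) \<sigma>(1) _ \<rho>(2)] \<rho>(3) \<sigma>(3) by auto
    \<comment> \<open>(S3) places only \<rho>' in a pixel. The concatenation of \<sigma> and \<rho>'
      then lies in a pixel, hence so does the equivalent concatenation of \<rho> and \<sigma>', and
      with it \<sigma>'.\<close>
    have "in_pixel P \<sigma>'"
      using in_pixel_concatD(2)[OF Eqv_in_pixel[OF \<rho>'(6)]] in_pixel_concat \<rho>' \<sigma> by blast
    moreover have "\<rho>' 1 = \<sigma>' 1" using Eqv_endpoints[OF \<rho>'(6)] by simp
    ultimately show ?thesis
      using \<rho> \<sigma> \<rho>' Paths_endpoints[of \<rho>']
      by (intro bexI[of _ "Some (\<rho>' 1)"] bexI[of _ "single (path_class T \<sigma>') 1"]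
          bexI[of _ "single (path_class T \<rho>') 1"]) auto
  qed
  show "\<exists>w\<in>Obj ?C. \<exists>u\<in>pixel_arrows T P w b. \<exists>v\<in>pixel_arrows T P w c. True"
    if st: "s \<in> pixel_arrows T P b a" "t \<in> pixel_arrows T P c a"
  proof (cases a)
    case None
    then show ?thesis using that by (intro bexI[of _ None] bexI[of _ s] bexI[of _ t]) auto
  next
    case (Some x)
    then obtain \<rho>' \<sigma>' where \<rho>: "\<rho>' \<in> Paths T" "in_pixel P \<rho>'" "\<rho>' 1 = x" "b = Some (\<rho>' 0)"
      and \<sigma>: "\<sigma>' \<in> Paths T" "in_pixel P \<sigma>'" "\<sigma>' 1 = x" "c = Some (\<sigma>' 0)"
      using st by (cases b; cases c) (auto simp: pixel_arrows_Some)
    obtain \<rho> \<sigma> where \<rho>': "\<rho> \<in> Paths T" "\<sigma> \<in> Paths T" "in_pixel P \<rho>" "\<sigma> 1 = \<rho>' 0" "\<rho> 1 = \<sigma>' 0"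
      "(concat_path \<sigma> \<rho>', concat_path \<rho> \<sigma>') \<in> Eqv T"
      using S3_dual[OF \<rho>(1) \<sigma>(1) _ \<rho>(2)] \<rho>(3) \<sigma>(3) by auto
    have "in_pixel P \<sigma>"
      using in_pixel_concatD(1)[OF Eqv_in_pixel[OF Eqv_sym[OF \<rho>'(6)]]] in_pixel_concat \<rho>' \<sigma> by blast
    moreover have "\<rho> 0 = \<sigma> 0" using Eqv_endpoints[OF \<rho>'(6)] by simp
    ultimately show ?thesis
      using \<rho> \<sigma> \<rho>' Paths_endpoints[of \<rho>]
      by (intro bexI[of _ "Some (\<rho> 0)"] bexI[of _ "single (path_class T \<sigma>) 1"]
          bexI[of _ "single (path_class T \<rho>) 1"]) auto
  qed
qed

end

context screen
begin

interpretation S: thin_system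
  "linear_path_category T :: ('a option, _, 'k :: {comm_ring, comm_monoid_mult}) lcat" "pixel_arrows T P"
  by (rule thin_system_pixel_arrows)

text \<open>For a multiple of one path class this is (S3), with the coefficient carried over to
  \<gamma>'; \<open>right_ore_Add\<close> extends it to linear combinations.\<close>

lemma right_ore_pixel_arrows:
  fixes f :: "(real \<Rightarrow> 'a) set \<Rightarrow>\<^sub>0 'k :: {comm_ring, comm_monoid_mult}"
  assumes a: "a \<in> Obj (linear_path_category T :: ('a option, _, 'k) lcat)"
    and b: "b \<in> Obj (linear_path_category T :: ('a option, _, 'k) lcat)"
    and f: "f \<in> Hom (linear_path_category T) a b"
  shows "S.right_ore a b f"
proof (cases "a = None \<or> b = None")
  case True
  then have "f = 0" using f by (cases a; cases b) auto
  then show ?thesis using S.right_ore_Zer[OF a b] by simp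
next
  case False
  then obtain x y where xy: "a = Some x" "b = Some y" by auto
  then have "keys f \<subseteq> Hom (path_category T) x y" using f by simp
  then show ?thesis
  proof (induction f rule: poly_mapping_induct_keys)
    case zero
    then show ?case using S.right_ore_Zer[OF a b] by simp
  next
    case (single k c)
    then obtain \<gamma> where \<gamma>: "\<gamma> \<in> Paths T" "\<gamma> 0 = x" "\<gamma> 1 = y" "k = path_class T \<gamma>"
      by (auto simp: path_category_Hom)
    show ?case
      unfolding S.right_ore_def
    proof (intro ballI)
      fix a' and s :: "(real \<Rightarrow> 'a) set \<Rightarrow>\<^sub>0 'k" assume s: "s \<in> pixel_arrows T P a a'"
      then obtain \<rho> where \<rho>: "\<rho> \<in> Paths T" "in_pixel P \<rho>" "\<rho> 0 = x" "a' = Some (\<rho> 1)"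
        "s = single (path_class T \<rho>) 1"
        unfolding xy by (cases a') (auto simp: pixel_arrows_Some)
      obtain \<rho>' \<gamma>' where \<rho>': "\<rho>' \<in> Paths T" "\<gamma>' \<in> Paths T" "in_pixel P \<rho>'" "\<gamma> 1 = \<rho>' 0" "\<rho> 1 = \<gamma>' 0"
        "(concat_path \<gamma> \<rho>', concat_path \<rho> \<gamma>') \<in> Eqv T"
        using S3[OF \<rho>(1) \<gamma>(1) _ \<rho>(2)] \<rho>(3) \<gamma>(2) by auto
      have "\<rho>' 1 = \<gamma>' 1" using Eqv_endpoints[OF \<rho>'(6)] by simp
      then show "\<exists>b'\<in>Obj (linear_path_category T :: ('a option, _, 'k) lcat). \<exists>s'\<in>pixel_arrows T P b b'.
          \<exists>f'\<in>Hom (linear_path_category T) a' b'.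
          Cmp (linear_path_category T) a b b' s' (single k c) =
          Cmp (linear_path_category T) a a' b' f' s"
        using xy \<gamma> \<rho> \<rho>' Paths_endpoints[of \<rho>'] path_class_eqI[OF \<rho>'(6)]
        by (intro bexI[of _ "Some (\<rho>' 1)"] bexI[of _ "single (path_class T \<rho>') 1"]
            bexI[of _ "single (path_class T \<gamma>') c"]) (auto split: if_splits)
    qed
  next
    case (add f g)
    then show ?case using S.right_ore_Add[OF a b, of f g] xy by simp
  qed
qed

text \<open>The same argument with the dual half of (S3).\<close>

lemma left_ore_pixel_arrows:
  fixes f :: "(real \<Rightarrow> 'a) set \<Rightarrow>\<^sub>0 'k :: {comm_ring, comm_monoid_mult}"
  assumes a: "a \<in> Obj (linear_path_category T :: ('a option, _, 'k) lcat)"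
    and b: "b \<in> Obj (linear_path_category T :: ('a option, _, 'k) lcat)"
    and f: "f \<in> Hom (linear_path_category T) a b"
  shows "S.left_ore a b f"
proof (cases "a = None \<or> b = None")
  case True
  then have "f = 0" using f by (cases a; cases b) auto
  then show ?thesis using S.left_ore_Zer[OF a b] by simp
next
  case False
  then obtain x y where xy: "a = Some x" "b = Some y" by auto
  then have "keys f \<subseteq> Hom (path_category T) x y" using f by simp
  then show ?thesis
  proof (induction f rule: poly_mapping_induct_keys)
    case zero
    then show ?case using S.left_ore_Zer[OF a b] by simp
  next
    case (single k c)
    then obtain \<gamma> where \<gamma>: "\<gamma> \<in> Paths T" "\<gamma> 0 = x" "\<gamma> 1 = y" "k = path_class T \<gamma>"
      by (auto simp: path_category_Hom)
    show ?case
      unfolding S.left_ore_def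
    proof (intro ballI)
      fix b' and t :: "(real \<Rightarrow> 'a) set \<Rightarrow>\<^sub>0 'k" assume t: "t \<in> pixel_arrows T P b' b"
      then obtain \<rho> where \<rho>: "\<rho> \<in> Paths T" "in_pixel P \<rho>" "\<rho> 1 = y" "b' = Some (\<rho> 0)"
        "t = single (path_class T \<rho>) 1"
        unfolding xy by (cases b') (auto simp: pixel_arrows_Some)
      obtain \<rho>' \<gamma>' where \<rho>': "\<rho>' \<in> Paths T" "\<gamma>' \<in> Paths T" "in_pixel P \<rho>'" "\<gamma>' 1 = \<rho> 0" "\<rho>' 1 = \<gamma> 0"
        "(concat_path \<gamma>' \<rho>, concat_path \<rho>' \<gamma>) \<in> Eqv T"
        using S3_dual[OF \<rho>(1) \<gamma>(1) _ \<rho>(2)] \<rho>(3) \<gamma>(3) by auto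
      have "\<rho>' 0 = \<gamma>' 0" using Eqv_endpoints[OF \<rho>'(6)] by simp
      then show "\<exists>a'\<in>Obj (linear_path_category T :: ('a option, _, 'k) lcat). \<exists>t'\<in>pixel_arrows T P a' a.
          \<exists>f'\<in>Hom (linear_path_category T) a' b'.
          Cmp (linear_path_category T) a' a b (single k c) t' =
          Cmp (linear_path_category T) a' b' b t f'"
        using xy \<gamma> \<rho> \<rho>' Paths_endpoints[of \<rho>'] path_class_eqI[OF \<rho>'(6)]
        by (intro bexI[of _ "Some (\<rho>' 0)"] bexI[of _ "single (path_class T \<rho>') 1"]
            bexI[of _ "single (path_class T \<gamma>') c"]) (auto split: if_splits)
    qed
  next
    case (add f g)
    then show ?case using S.left_ore_Add[OF a b, of f g] xy by simp
  qed
qed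

section \<open>The pixel closure lies in the saturation\<close>

lemma path_sum_Cons: "path_sum T ((c, \<gamma>) # ps) = single (path_class T \<gamma>) c + path_sum T ps"
  by (simp add: path_sum_def)

lemma keys_path_sum:
  assumes "\<forall>(c, \<gamma>)\<in>set ps. \<gamma> \<in> Paths T \<and> \<gamma> 0 = x \<and> \<gamma> 1 = y"
  shows "keys (path_sum T ps) \<subseteq> Hom (path_category T) x y"
  using assms
proof (induction ps)
  case (Cons p ps)
  obtain c \<gamma> where p: "p = (c, \<gamma>)" by (cases p)
  have "keys (path_sum T (p # ps)) \<subseteq> {path_class T \<gamma>} \<union> keys (path_sum T ps)"
    using Poly_Mapping.keys_add[of "single (path_class T \<gamma>) c" "path_sum T ps"]
    unfolding p path_sum_Cons by (auto split: if_splits)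
  then show ?case using Cons p by auto
qed (simp add: path_sum_def)

lemma Cmp_Cmp_single:
  assumes "\<rho> \<in> Paths T" "\<gamma> \<in> Paths T" "\<sigma> \<in> Paths T" "\<rho> 1 = \<gamma> 0" "\<gamma> 1 = \<sigma> 0"
  shows "Cmp (linear_path_category T) (Some x) (Some z) (Some w) (single (path_class T \<sigma>) 1)
      (Cmp (linear_path_category T) (Some x) (Some y) (Some z)
        (single (path_class T \<gamma>) c) (single (path_class T \<rho>) 1)) =
    single (path_class T (concat_path (concat_path \<rho> \<gamma>) \<sigma>)) c"
  using assms by (simp add: concat_in_Paths)

text \<open>The four paths of a pixel equivalence are the denominators: the first two share their
  starting point, the last two their end point, because equivalent paths have equal
  endpoints.\<close>

lemma S_related_paths:
  assumes \<gamma>: "\<gamma> \<in> Paths T" "\<gamma>' \<in> Paths T" and eq: "pixel_equiv_paths T P \<gamma> \<gamma>'"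
  shows "S.S_related (Some (\<gamma> 0)) (Some (\<gamma> 1)) (single (path_class T \<gamma>) c)
    (Some (\<gamma>' 0)) (Some (\<gamma>' 1)) (single (path_class T \<gamma>') c)"
proof -
  obtain \<rho>1 \<rho>2 \<rho>3 \<rho>4 X Y where \<rho>: "\<rho>1 \<in> Paths T" "\<rho>2 \<in> Paths T" "\<rho>3 \<in> Paths T" "\<rho>4 \<in> Paths T"
    "\<rho>1 1 = \<gamma> 0" "\<gamma> 1 = \<rho>3 0" "\<rho>2 1 = \<gamma>' 0" "\<gamma>' 1 = \<rho>4 0"
    and X: "X \<in> P" "im \<rho>1 \<union> im \<rho>2 \<subseteq> X" and Y: "Y \<in> P" "im \<rho>3 \<union> im \<rho>4 \<subseteq> Y"
    and e: "(concat_path (concat_path \<rho>1 \<gamma>) \<rho>3, concat_path (concat_path \<rho>2 \<gamma>') \<rho>4) \<in> Eqv T"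
    using eq unfolding pixel_equiv_paths_def by (elim bexE conjE) (rule that)
  have pix: "in_pixel P \<rho>1" "in_pixel P \<rho>2" "in_pixel P \<rho>3" "in_pixel P \<rho>4"
    using X Y by (auto simp: in_pixel_def)
  have ends: "\<rho>2 0 = \<rho>1 0" "\<rho>4 1 = \<rho>3 1" using Eqv_endpoints[OF e] by auto
  show ?thesis
    unfolding S.S_related_def
  proof (rule bexI[of _ "Some (\<rho>1 0)"], rule bexI[of _ "Some (\<rho>3 1)"],
      rule bexI[of _ "single (path_class T \<rho>1) 1"],
      rule bexI[of _ "single (path_class T \<rho>2) 1"],
      rule bexI[of _ "single (path_class T \<rho>3) 1"],
      rule bexI[of _ "single (path_class T \<rho>4) 1"])
    show "Cmp (linear_path_category T) (Some (\<rho>1 0)) (Some (\<gamma> 1)) (Some (\<rho>3 1))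
        (single (path_class T \<rho>3) 1)
        (Cmp (linear_path_category T) (Some (\<rho>1 0)) (Some (\<gamma> 0)) (Some (\<gamma> 1))
          (single (path_class T \<gamma>) c) (single (path_class T \<rho>1) 1)) =
      Cmp (linear_path_category T) (Some (\<rho>1 0)) (Some (\<gamma>' 1)) (Some (\<rho>3 1))
        (single (path_class T \<rho>4) 1)
        (Cmp (linear_path_category T) (Some (\<rho>1 0)) (Some (\<gamma>' 0)) (Some (\<gamma>' 1))
          (single (path_class T \<gamma>') c) (single (path_class T \<rho>2) 1))"
      unfolding Cmp_Cmp_single[OF \<rho>(1) \<gamma>(1) \<rho>(3,5,6)] Cmp_Cmp_single[OF \<rho>(2) \<gamma>(2) \<rho>(4,7,8)]
      using path_class_eqI[OF e] by simp
    show "Some (\<rho>1 0) \<in> Obj (linear_path_category T)" "Some (\<rho>3 1) \<in> Obj (linear_path_category T)"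
      using \<rho>(1,3) Paths_endpoints by auto
  qed (rule pixel_arrowsI; use \<rho> pix ends in simp)+
qed

text \<open>Empty lists are excluded because they would impose no relation between the endpoints
  \<open>x\<close>, \<open>y\<close> and \<open>x'\<close>, \<open>y'\<close>, whereas
  \<open>S_related\<close> asks for denominators joining them.\<close>

lemma S_related_path_sums:
  assumes "list_all2 (\<lambda>(c, \<gamma>) (d, \<gamma>'). c = d \<and> pixel_equiv_paths T P \<gamma> \<gamma>') ps qs"
    and "\<forall>(c, \<gamma>)\<in>set ps. \<gamma> \<in> Paths T \<and> \<gamma> 0 = x \<and> \<gamma> 1 = y"
    and "\<forall>(c, \<gamma>)\<in>set qs. \<gamma> \<in> Paths T \<and> \<gamma> 0 = x' \<and> \<gamma> 1 = y'"
    and "ps \<noteq> []"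
  shows "S.S_related (Some x) (Some y) (path_sum T ps) (Some x') (Some y') (path_sum T qs)"
  using assms
proof (induction rule: list_all2_induct)
  case (Cons p ps q qs)
  obtain c \<gamma> \<gamma>' where pq: "p = (c, \<gamma>)" "q = (c, \<gamma>')" "pixel_equiv_paths T P \<gamma> \<gamma>'"
    using Cons(1) by auto
  have \<gamma>: "\<gamma> \<in> Paths T" "\<gamma> 0 = x" "\<gamma> 1 = y" "\<gamma>' \<in> Paths T" "\<gamma>' 0 = x'" "\<gamma>' 1 = y'"
    using Cons.prems pq by auto
  have xy: "x \<in> Pts T" "y \<in> Pts T" "x' \<in> Pts T" "y' \<in> Pts T"
    using \<gamma> Paths_endpoints by auto
  have head: "S.S_related (Some x) (Some y) (single (path_class T \<gamma>) c)
    (Some x') (Some y') (single (path_class T \<gamma>') c)"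
    using S_related_paths[OF \<gamma>(1,4) pq(3), of c] \<gamma> by simp
  show ?case
  proof (cases "ps = []")
    case True
    then show ?thesis using Cons(2) head pq by (simp add: path_sum_Cons) (simp add: path_sum_def)
  next
    case False
    then have "S.S_related (Some x) (Some y) (path_sum T ps) (Some x') (Some y') (path_sum T qs)"
      using Cons by simp
    moreover have "keys (path_sum T ps) \<subseteq> Hom (path_category T) x y"
      "keys (path_sum T qs) \<subseteq> Hom (path_category T) x' y'"
      using Cons.prems by (intro keys_path_sum; simp)+
    ultimately show ?thesis
      unfolding pq path_sum_Cons
      using S.S_related_Add[OF _ _ _ _ _ _ _ _ head] xy \<gamma> by simp
  qed
qed simp

text \<open>The closure is the smallest ideal containing its generators, and the saturation is an
  ideal containing them: a nonempty sum is related to a member of \<open>I\<close>, and an empty one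
  is zero.\<close>

lemma pixel_closure_subset_saturation:
  fixes I :: "'a option \<Rightarrow> 'a option \<Rightarrow> ((real \<Rightarrow> 'a) set \<Rightarrow>\<^sub>0 'k :: {comm_ring, comm_monoid_mult}) set"
  assumes I: "cat_ideal (linear_path_category T) I"
  shows "pixel_closure T P I a b \<subseteq> S.saturation I a b"
proof -
  let ?C = "linear_path_category T :: ('a option, _, 'k) lcat"
  have sat: "cat_ideal ?C (S.saturation I)"
    using S.cat_ideal_saturation[OF I] right_ore_pixel_arrows left_ore_pixel_arrows by blast
  interpret J: category_ideal ?C "S.saturation I"
    by unfold_locales (rule sat)
  have "f \<in> S.saturation I a b"
    if ab: "a \<in> Obj ?C" "b \<in> Obj ?C" and ab': "a' \<in> Obj ?C" "b' \<in> Obj ?C"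
      and g: "g \<in> I a' b'" and fg: "pixel_equiv_sums T P a b f a' b' g" for a b a' b' f g
  proof -
    obtain ps qs where fg': "f = path_sum T ps" "g = path_sum T qs"
      and ps: "\<forall>(c, \<gamma>)\<in>set ps. \<gamma> \<in> Paths T \<and> a = Some (\<gamma> 0) \<and> b = Some (\<gamma> 1)"
      and qs: "\<forall>(c, \<gamma>)\<in>set qs. \<gamma> \<in> Paths T \<and> a' = Some (\<gamma> 0) \<and> b' = Some (\<gamma> 1)"
      and all: "list_all2 (\<lambda>(c, \<gamma>) (d, \<gamma>'). c = d \<and> pixel_equiv_paths T P \<gamma> \<gamma>') ps qs"
      using fg unfolding pixel_equiv_sums_def by blast
    show ?thesis
    proof (cases "ps = []")
      case True
      then show ?thesis using J.ideal_simps(2)[OF ab] fg' by (simp add: path_sum_def)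
    next
      case False
      moreover from this have "qs \<noteq> []" using all by auto
      ultimately obtain x y x' y' where xy: "a = Some x" "b = Some y" "a' = Some x'" "b' = Some y'"
        using ps qs by (cases ps; cases qs) auto
      have 1: "\<forall>(c, \<gamma>)\<in>set ps. \<gamma> \<in> Paths T \<and> \<gamma> 0 = x \<and> \<gamma> 1 = y"
        "\<forall>(c, \<gamma>)\<in>set qs. \<gamma> \<in> Paths T \<and> \<gamma> 0 = x' \<and> \<gamma> 1 = y'"
        using ps qs xy by auto
      have "f \<in> Hom ?C a b" using keys_path_sum[OF 1(1)] fg' xy by simp
      then show ?thesis
        using S.S_related_saturation[OF ab ab' I _ g] S_related_path_sums[OF all 1 False] xy fg' by simp
    qed
  qed
  then show ?thesis
    unfolding pixel_closure_def generated_ideal_def using sat by blast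
qed

lemma quotient_path_class_eq_Zer_iff:
  assumes I: "cat_ideal (linear_path_category T) I" and \<rho>: "\<rho> \<in> Paths T"
  shows "quotient_path_class T I \<rho>
      = Zer (quotient_category (linear_path_category T) I) (Some (\<rho> 0)) (Some (\<rho> 1))
    \<longleftrightarrow> single (path_class T \<rho>) (1 :: 'k :: {comm_ring, comm_monoid_mult}) \<in> I (Some (\<rho> 0)) (Some (\<rho> 1))"
proof -
  interpret I: category_ideal "linear_path_category T :: ('a option, _, 'k) lcat" I
    by unfold_locales (rule I)
  show ?thesis
    unfolding quotient_path_class_def I.quotient_simps
    by (rule I.coset_eq_Zer_iff) (use \<rho> Paths_endpoints in auto)
qed

text \<open>By saturation, \<rho> extended at both ends by paths in pixels has its class in
  \<open>I\<close>. The extensions share endpoints with \<rho>, so the extended path stays in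
  \<open>X\<close> and witnesses that \<open>X\<close> is pre-dead.\<close>

lemma pre_dead_if_closure_zero:
  fixes I :: "'a option \<Rightarrow> 'a option \<Rightarrow> ((real \<Rightarrow> 'a) set \<Rightarrow>\<^sub>0 'k :: {comm_ring, comm_monoid_mult}) set"
  assumes I: "cat_ideal (linear_path_category T) I"
    and \<rho>: "\<rho> \<in> Paths T" "X \<in> P" "im \<rho> \<subseteq> X"
    and 0: "quotient_path_class T (pixel_closure T P I) \<rho>
      = Zer (quotient_category (linear_path_category T) (pixel_closure T P I)) (Some (\<rho> 0)) (Some (\<rho> 1))"
  shows "pre_dead T I X"
proof -
  let ?C = "linear_path_category T :: ('a option, _, 'k) lcat"
  let ?f = "single (path_class T \<rho>) (1 :: 'k)"
  \<comment> \<open>With 0 in the closure, \<open>?f\<close> belongs to its own coset, which equals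
    the coset of 0, that is, the closure itself.\<close>
  have "0 \<in> pixel_closure T P I (Some (\<rho> 0)) (Some (\<rho> 1))"
    using Paths_endpoints[OF \<rho>(1)]
    by (auto simp: pixel_closure_def generated_ideal_def cat_ideal_def)
  then have "?f \<in> pixel_closure T P I (Some (\<rho> 0)) (Some (\<rho> 1))"
    using 0 unfolding quotient_path_class_def quotient_category_def coset_def by auto
  then have "?f \<in> S.saturation I (Some (\<rho> 0)) (Some (\<rho> 1))"
    using pixel_closure_subset_saturation[OF I] by blast
  then obtain a b t s where ts: "t \<in> pixel_arrows T P a (Some (\<rho> 0))" "s \<in> pixel_arrows T P (Some (\<rho> 1)) b"
    and in_I: "Cmp ?C a (Some (\<rho> 1)) b s (Cmp ?C a (Some (\<rho> 0)) (Some (\<rho> 1)) ?f t) \<in> I a b"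
    unfolding S.saturation_def by blast
  obtain \<tau> where \<tau>: "\<tau> \<in> Paths T" "in_pixel P \<tau>" "a = Some (\<tau> 0)" "\<tau> 1 = \<rho> 0"
    "t = single (path_class T \<tau>) 1"
    using ts(1) by (cases a) (auto simp: pixel_arrows_Some)
  obtain \<sigma> where \<sigma>: "\<sigma> \<in> Paths T" "in_pixel P \<sigma>" "b = Some (\<sigma> 1)" "\<sigma> 0 = \<rho> 1"
    "s = single (path_class T \<sigma>) 1"
    using ts(2) by (cases b) (auto simp: pixel_arrows_Some)
  let ?\<gamma> = "concat_path (concat_path \<tau> \<rho>) \<sigma>"
  have "single (path_class T ?\<gamma>) 1 \<in> I (Some (?\<gamma> 0)) (Some (?\<gamma> 1))"
    using in_I Cmp_Cmp_single[OF \<tau>(1) \<rho>(1) \<sigma>(1) \<tau>(4) \<sigma>(4)[symmetric], where c = "1 :: 'k"]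
    unfolding \<tau>(3,5) \<sigma>(3,5) by (simp del: linear_path_category_simps)
  moreover have \<gamma>: "?\<gamma> \<in> Paths T" using \<tau> \<sigma> \<rho>(1) by (simp add: concat_in_Paths)
  moreover have "im \<tau> \<subseteq> X"
    using \<tau> \<rho> endpoints_in_im[of \<tau>] endpoints_in_im[of \<rho>] pixel_unique unfolding in_pixel_def
    by (metis subsetD)
  moreover have "im \<sigma> \<subseteq> X"
    using \<sigma> \<rho> endpoints_in_im[of \<sigma>] endpoints_in_im[of \<rho>] pixel_unique unfolding in_pixel_def
    by (metis subsetD)
  ultimately show ?thesis
    unfolding pre_dead_def using \<rho>(3) \<tau> \<sigma> quotient_path_class_eq_Zer_iff[OF I \<gamma>]
    by (intro bexI[of _ ?\<gamma>]) (simp_all add: im_concat_path_eq)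
qed

end

section \<open>Pixelated representations\<close>

definition pixel_morphism_set :: "'a triple \<Rightarrow> 'a set set \<Rightarrow> ('a \<times> 'a \<times> (real \<Rightarrow> 'a) set) set" where
  "pixel_morphism_set T P = {(x, y, \<sigma>). x \<in> Pts T \<and> y \<in> Pts T \<and> \<sigma> \<in> pixel_morphisms T P x y}"

lemma pixelates_iff_inverts: "pixelates T K P M \<longleftrightarrow> inverts K (pixel_morphism_set T P) M"
  by (auto simp: pixelates_def inverts_def pixel_morphism_set_def)

definition linear_pixel_morphism_set ::
  "'a triple \<Rightarrow>
   ('a option \<Rightarrow> 'a option \<Rightarrow> ((real \<Rightarrow> 'a) set \<Rightarrow>\<^sub>0 'k :: {comm_ring, comm_monoid_mult}) set) \<Rightarrow>
   'a set set \<Rightarrow> ('a option \<times> 'a option \<times> ((real \<Rightarrow> 'a) set \<Rightarrow>\<^sub>0 'k) set) set" where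
  "linear_pixel_morphism_set T I P =
     (\<lambda>\<rho>. (Some (\<rho> 0), Some (\<rho> 1), quotient_path_class T I \<rho>)) ` {\<rho> \<in> Paths T. in_pixel P \<rho> \<and>
        quotient_path_class T (pixel_closure T P I) \<rho>
          \<noteq> Zer (quotient_category (linear_path_category T) (pixel_closure T P I))
              (Some (\<rho> 0)) (Some (\<rho> 1))} \<union>
     (\<lambda>(x, y). (Some x, Some y, Zer (quotient_category (linear_path_category T) I) (Some x) (Some y))) `
        (\<Union>X\<in>{X \<in> P. pre_dead T I X}. X \<times> X)"

lemma linear_pixelates_iff_inverts:
  "linear_pixelates T I K P M \<longleftrightarrow> inverts K (linear_pixel_morphism_set T I P) M"
  unfolding linear_pixelates_def inverts_def linear_pixel_morphism_set_def
    ball_Un ball_simps(9) UN_ball_bex_simps split_paired_Ball_Sigma split_beta fst_conv snd_conv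
  by (intro arg_cong2[of _ _ _ _ "(\<and>)"]; simp only: Ball_def mem_Collect_eq) blast+

lemma in_pixel_refines: "\<lbrakk>refines A P Q; in_pixel P \<rho>\<rbrakk> \<Longrightarrow> in_pixel Q \<rho>"
  unfolding refines_def in_pixel_def by (meson subset_trans)

text \<open>In \<open>C\<close> a finer screen inverts fewer morphisms, so the passage to
  refinements is immediate there.\<close>

lemma pixel_morphism_set_refines:
  "refines A P Q \<Longrightarrow> pixel_morphism_set T P \<subseteq> pixel_morphism_set T Q"
  using in_pixel_refines unfolding pixel_morphism_set_def pixel_morphisms_def by fastforce

lemma (in screen) pixel_morphism_set_arrows: "pixel_morphism_set T P \<subseteq> arrows (path_category T)"
  by (auto simp: pixel_morphism_set_def pixel_morphisms_def arrows_def)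

lemma pre_dead_mono: "\<lbrakk>pre_dead T I X; X \<subseteq> Y\<rbrakk> \<Longrightarrow> pre_dead T I Y"
  unfolding pre_dead_def by blast

context screen
begin

lemma linear_pixel_morphism_set_arrows:
  fixes I :: "'a option \<Rightarrow> 'a option \<Rightarrow> ((real \<Rightarrow> 'a) set \<Rightarrow>\<^sub>0 'k :: {comm_ring, comm_monoid_mult}) set"
  assumes I: "cat_ideal (linear_path_category T) I"
  shows "linear_pixel_morphism_set T I P \<subseteq> arrows (quotient_category (linear_path_category T) I)"
proof -
  interpret linear_category "linear_path_category T :: ('a option, _, 'k) lcat"
    by (rule linear_category_linear_path_category)
  interpret I: category_ideal "linear_path_category T :: ('a option, _, 'k) lcat" I
    by unfold_locales (rule I)
  have "quotient_path_class T I \<rho> \<in> Hom I.Q (Some (\<rho> 0)) (Some (\<rho> 1))" if "\<rho> \<in> Paths T" for \<rho>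
    using that by (auto simp: quotient_path_class_def intro!: imageI)
  moreover have "Zer I.Q (Some x) (Some y) \<in> Hom I.Q (Some x) (Some y)" for x y
    by (auto intro!: imageI)
  ultimately show ?thesis
    using Paths_endpoints pixel_subset_Pts
    unfolding linear_pixel_morphism_set_def arrows_def by fastforce
qed

text \<open>The key is that \<open>M\<close> inverts every path inside a pixel of \<open>P\<close>,
  whether or not its class vanishes modulo the closure with respect to \<open>P\<close>.\<close>

lemma linear_pixelates_refinement:
  fixes I :: "'a option \<Rightarrow> 'a option \<Rightarrow> ((real \<Rightarrow> 'a) set \<Rightarrow>\<^sub>0 'k :: {comm_ring, comm_monoid_mult}) set"
  assumes I: "cat_ideal (linear_path_category T) I" and K: "category K"
    and R: "refines (Pts T) R P"
    and M: "is_functor (quotient_category (linear_path_category T) I) K M"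
    and inv: "linear_pixelates T I K P M"
  shows "linear_pixelates T I K R M"
proof -
  let ?A = "quotient_category (linear_path_category T) I"
  interpret K: category K by (rule K)
  interpret L: linear_category "linear_path_category T :: ('a option, _, 'k) lcat"
    by (rule linear_category_linear_path_category)
  interpret I: category_ideal "linear_path_category T :: ('a option, _, 'k) lcat" I
    by unfold_locales (rule I)
  note M' = is_functorD[OF M]
  have zero_iso: "is_iso K (FOb M (Some x)) (FOb M (Some y))
      (FMor M (Some x) (Some y) (Zer ?A (Some x) (Some y)))"
    if "X \<in> P" "pre_dead T I X" "x \<in> X" "y \<in> X" for x y X
    using inv that unfolding linear_pixelates_def by blast
  have path_iso: "is_iso K (FOb M (Some (\<rho> 0))) (FOb M (Some (\<rho> 1)))
      (FMor M (Some (\<rho> 0)) (Some (\<rho> 1)) (quotient_path_class T I \<rho>))"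
    if \<rho>: "\<rho> \<in> Paths T" "in_pixel P \<rho>" for \<rho>
  proof (cases "quotient_path_class T (pixel_closure T P I) \<rho>
      = Zer (quotient_category (linear_path_category T) (pixel_closure T P I)) (Some (\<rho> 0)) (Some (\<rho> 1))")
    case False
    then show ?thesis
      using inv \<rho> unfolding linear_pixelates_def by blast
  next
    \<comment> \<open>The pixel is pre-dead, so \<open>M\<close> inverts the zero morphisms between
      its points. It remains to pass from these to the class of \<rho>.\<close>
    case True
    obtain X where X: "X \<in> P" "im \<rho> \<subseteq> X" using \<rho>(2) by (auto simp: in_pixel_def)
    have dead: "pre_dead T I X" using pre_dead_if_closure_zero[OF I \<rho>(1) X True] .
    have x: "\<rho> 0 \<in> X" "\<rho> 1 \<in> X" using X endpoints_in_im by auto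
    then have pts: "\<rho> 0 \<in> Pts T" "\<rho> 1 \<in> Pts T" using pixel_subset_Pts X(1) by auto
    define f where "f = single (path_class T \<rho>) (1 :: 'k)"
    have f: "f \<in> Hom (linear_path_category T) (Some (\<rho> 0)) (Some (\<rho> 1))"
      using \<rho> by (auto simp: f_def)
    have \<rho>f: "quotient_path_class T I \<rho> = coset (linear_path_category T) I (Some (\<rho> 0)) (Some (\<rho> 1)) f"
      by (simp add: quotient_path_class_def f_def)
    have obj: "Some (\<rho> 0) \<in> Obj ?A" "Some (\<rho> 1) \<in> Obj ?A" using pts by auto
    note obj' = obj[unfolded I.quotient_simps]
    have hom: "quotient_path_class T I \<rho> \<in> Hom ?A (Some (\<rho> 0)) (Some (\<rho> 1))"
      "Zer ?A (Some (\<rho> 1)) (Some (\<rho> 1)) \<in> Hom ?A (Some (\<rho> 1)) (Some (\<rho> 1))"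
      unfolding \<rho>f I.quotient_simps by (intro imageI f L.Zer_in_Hom obj')+
    \<comment> \<open>The class of \<rho> followed by the zero endomorphism is a zero morphism.
      \<open>M\<close> inverts both zero morphisms, so cancelling the left one shows that it inverts
      the class of \<rho>.\<close>
    have "Cmp ?A (Some (\<rho> 0)) (Some (\<rho> 1)) (Some (\<rho> 1)) (Zer ?A (Some (\<rho> 1)) (Some (\<rho> 1)))
        (quotient_path_class T I \<rho>) = Zer ?A (Some (\<rho> 0)) (Some (\<rho> 1))"
      unfolding \<rho>f I.quotient_simps
      using I.quotient_Cmp[OF obj'(1,2,2) f L.Zer_in_Hom[OF obj'(2,2)]] L.Cmp_Zer_left[OF obj'(1,2,2) f]
      by (simp only:)
    then have "is_iso K (FOb M (Some (\<rho> 0))) (FOb M (Some (\<rho> 1)))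
      (Cmp K (FOb M (Some (\<rho> 0))) (FOb M (Some (\<rho> 1))) (FOb M (Some (\<rho> 1)))
        (FMor M (Some (\<rho> 1)) (Some (\<rho> 1)) (Zer ?A (Some (\<rho> 1)) (Some (\<rho> 1))))
        (FMor M (Some (\<rho> 0)) (Some (\<rho> 1)) (quotient_path_class T I \<rho>)))"
      using zero_iso[OF X(1) dead x] M'(4)[OF obj(1,2,2) hom] by simp
    then show ?thesis
      using K.is_iso_cancel_left[OF _ _ _ _ zero_iso[OF X(1) dead x(2,2)]] M'(1,2) obj hom by blast
  qed
  show ?thesis
    unfolding linear_pixelates_def
  proof (intro conjI ballI impI)
    fix \<rho> assume "\<rho> \<in> Paths T" "in_pixel R \<rho>"
    then show "is_iso K (FOb M (Some (\<rho> 0))) (FOb M (Some (\<rho> 1)))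
      (FMor M (Some (\<rho> 0)) (Some (\<rho> 1)) (quotient_path_class T I \<rho>))"
      using path_iso in_pixel_refines[OF R] by blast
  next
    fix X x y assume X: "X \<in> R" "pre_dead T I X" "x \<in> X" "y \<in> X"
    then obtain Y where "Y \<in> P" "X \<subseteq> Y" using R unfolding refines_def by blast
    then show "is_iso K (FOb M (Some x)) (FOb M (Some y))
      (FMor M (Some x) (Some y) (Zer ?A (Some x) (Some y)))"
      using zero_iso[of Y x y] pre_dead_mono[OF X(2)] X(3,4) by blast
  qed
qed

end

section \<open>Directed sets of screens and the four subcategories\<close>

lemma directed_screen_setsD:
  assumes "L \<in> directed_screen_sets T"
  shows "L \<noteq> {}" "P \<in> L \<Longrightarrow> screen T P"
    and "\<lbrakk>P \<in> L; Q \<in> L\<rbrakk> \<Longrightarrow> \<exists>R\<in>L. refines (Pts T) R P \<and> refines (Pts T) R Q"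
proof -
  show "L \<noteq> {}" "P \<in> L \<Longrightarrow> screen T P"
    using assms by (auto simp: directed_screen_sets_def screens_def)
  have "\<forall>F\<subseteq>L. finite F \<longrightarrow> (\<exists>R\<in>L. \<forall>S\<in>F. refines (Pts T) R S)"
    using assms by (simp add: directed_screen_sets_def)
  from this[rule_format, of "{P, Q}"]
  show "\<exists>R\<in>L. refines (Pts T) R P \<and> refines (Pts T) R Q" if "P \<in> L" "Q \<in> L"
    using that by simp
qed

lemma pointwise_abelian_pixelated_by:
  assumes "diagram_category K (path_category T)" and L: "L \<in> directed_screen_sets T"
  shows "pointwise_abelian K (path_category T) (pixelated_by T K L)"
proof -
  interpret diagram_category K "path_category T" by fact
  note d = directed_screen_setsD[OF L]
  have "pointwise_abelian K (path_category T) {M. \<exists>P\<in>L. inverts K (pixel_morphism_set T P) M}"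
  proof (rule pointwise_abelian_inverts)
    fix P Q assume "P \<in> L" "Q \<in> L"
    then obtain R where "R \<in> L" "refines (Pts T) R P" "refines (Pts T) R Q" using d(3) by blast
    then show "\<exists>R\<in>L. \<forall>M. is_functor (path_category T) K M \<longrightarrow>
        inverts K (pixel_morphism_set T P) M \<or> inverts K (pixel_morphism_set T Q) M \<longrightarrow>
        inverts K (pixel_morphism_set T R) M"
      using inverts_subset pixel_morphism_set_refines by blast
  qed (use d(1,2) screen.pixel_morphism_set_arrows in auto)
  then show ?thesis by (simp add: pixelated_by_def pixelates_iff_inverts)
qed

text \<open>Directedness enters through \<open>linear_pixelates_refinement\<close>, which compares
  the functors rather than the sets of morphisms they invert.\<close>

lemma pointwise_abelian_linear_pixelated_by:
  assumes "diagram_category K (quotient_category (linear_path_category T) I)"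
    and I: "cat_ideal (linear_path_category T) I" and L: "L \<in> directed_screen_sets T"
  shows "pointwise_abelian K (quotient_category (linear_path_category T) I)
    (linear_pixelated_by T I K L)"
proof -
  interpret diagram_category K "quotient_category (linear_path_category T) I" by fact
  note d = directed_screen_setsD[OF L]
  have "pointwise_abelian K (quotient_category (linear_path_category T) I)
    {M. \<exists>P\<in>L. inverts K (linear_pixel_morphism_set T I P) M}"
  proof (rule pointwise_abelian_inverts)
    fix P Q assume PQ: "P \<in> L" "Q \<in> L"
    then obtain R where "R \<in> L" "refines (Pts T) R P" "refines (Pts T) R Q" using d(3) by blast
    then show "\<exists>R\<in>L. \<forall>M. is_functor (quotient_category (linear_path_category T) I) K M \<longrightarrow>
        inverts K (linear_pixel_morphism_set T I P) M \<or> inverts K (linear_pixel_morphism_set T I Q) M \<longrightarrow>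
        inverts K (linear_pixel_morphism_set T I R) M"
      using screen.linear_pixelates_refinement[OF d(2) I category_axioms] PQ
      unfolding linear_pixelates_iff_inverts[symmetric] by blast
  qed (use d(1,2) screen.linear_pixel_morphism_set_arrows[OF _ I] in auto)
  then show ?thesis by (simp add: linear_pixelated_by_def linear_pixelates_iff_inverts)
qed

theorem theorem3p10:
  fixes K :: "('o, 'm, 'k :: {comm_ring, comm_monoid_mult}) lcat"
    and T :: "'a triple"
    and I :: "'a option \<Rightarrow> 'a option \<Rightarrow> ((real \<Rightarrow> 'a) set \<Rightarrow>\<^sub>0 'k) set"
    and L :: "'a set set set"
  defines "C \<equiv> path_category T"
    and "A \<equiv> quotient_category (linear_path_category T) I"
  defines "Rep_C_L \<equiv> full_subcategory (Rep K C) (pixelated_by T K L)"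
    and "rep_C_L \<equiv> full_subcategory (rep_pwf K C) (pixelated_by T K L)"
    and "Rep_A_L \<equiv> full_subcategory (Rep_lin K A) (linear_pixelated_by T I K L)"
    and "rep_A_L \<equiv> full_subcategory (rep_lin_pwf K A) (linear_pixelated_by T I K L)"
  assumes "linear_category K" and "abelian_category K"
    and "path_triple T" and "screens T \<noteq> {}"
    and "path_based_ideal T I"
    and "L \<in> directed_screen_sets T"
  shows "abelian_category Rep_C_L \<and> exact_functor Rep_C_L (Rep K C) (embedding Rep_C_L) \<and>
    abelian_category rep_C_L \<and> exact_functor rep_C_L (rep_pwf K C) (embedding rep_C_L) \<and>
    abelian_category Rep_A_L \<and> exact_functor Rep_A_L (Rep_lin K A) (embedding Rep_A_L) \<and>
    abelian_category rep_A_L \<and> exact_functor rep_A_L (rep_lin_pwf K A) (embedding rep_A_L)"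
proof -
  interpret K: linear_category K by fact
  interpret K: abelian_category K by fact
  interpret path_triple T by fact
  have I: "cat_ideal (linear_path_category T) I"
    using \<open>path_based_ideal T I\<close> by (simp add: path_based_ideal_def)
  interpret linear_category "linear_path_category T :: ('a option, _, 'k) lcat"
    by (rule linear_category_linear_path_category)
  interpret I: category_ideal "linear_path_category T :: ('a option, _, 'k) lcat" I
    by unfold_locales (rule I)
  interpret C: category C unfolding C_def by (rule category_path_category)
  interpret A: linear_category A unfolding A_def by (rule I.linear_quotient_category)
  interpret RC: diagram_category K C by unfold_locales
  interpret RA: diagram_category K A by unfold_locales
  let ?FC = "functor_category C K" and ?FA = "functor_category A K"
  let ?fC = "pointwise_finite_length K C" and ?fA = "pointwise_finite_length K A"
  let ?pC = "pixelated_by T K L" and ?pA = "linear_pixelated_by T I K L"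
  let ?lin = "{M. is_linear_functor A K M}"
  have pC: "pointwise_abelian K C ?pC"
    unfolding C_def
    by (rule pointwise_abelian_pixelated_by)
      (use RC.diagram_category_axioms assms(12) in \<open>simp_all add: C_def\<close>)
  have pA: "pointwise_abelian K A ?pA"
    unfolding A_def
    by (rule pointwise_abelian_linear_pixelated_by)
      (use RA.diagram_category_axioms I assms(12) in \<open>simp_all add: A_def\<close>)
  have lin: "pointwise_abelian K A ?lin"
    by (rule pointwise_abelian_linear) unfold_locales
  note fC = RC.pointwise_abelian_finite_length and fA = RA.pointwise_abelian_finite_length
  \<comment> \<open>Nested full subcategories flatten to intersections. Each embedding thus becomes
    an inclusion of closed classes inside a single functor category, as
    \<open>exact_embedding\<close> requires.\<close>
  have eqs: "Rep K C = full_subcategory ?FC UNIV" "Rep_C_L = full_subcategory ?FC ?pC"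
    "rep_pwf K C = full_subcategory ?FC ?fC" "rep_C_L = full_subcategory ?FC (?fC \<inter> ?pC)"
    "Rep_lin K A = full_subcategory ?FA ?lin" "Rep_A_L = full_subcategory ?FA (?lin \<inter> ?pA)"
    "rep_lin_pwf K A = full_subcategory ?FA (?lin \<inter> ?fA)"
    "rep_A_L = full_subcategory ?FA (?lin \<inter> ?fA \<inter> ?pA)"
    by (simp_all add: Rep_C_L_def rep_C_L_def Rep_A_L_def rep_A_L_def Rep_def rep_pwf_def
        Rep_lin_def rep_lin_pwf_def full_subcategory_UNIV full_subcategory_Int)
  note Int = pointwise_abelian_Int
  show ?thesis
    unfolding eqs
    using pointwise_abelian.abelian_FS[OF pC] exact_embedding[OF pC RC.pointwise_abelian_UNIV]
      pointwise_abelian.abelian_FS[OF Int[OF fC pC]] exact_embedding[OF Int[OF fC pC] fC]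
      pointwise_abelian.abelian_FS[OF Int[OF lin pA]] exact_embedding[OF Int[OF lin pA] lin]
      pointwise_abelian.abelian_FS[OF Int[OF Int[OF lin fA] pA]]
      exact_embedding[OF Int[OF Int[OF lin fA] pA] Int[OF lin fA]]
    by blast
qed

end
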